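(* Let $f:\mathcal{P}_2(\mathbb{R}^d)\to\mathbb{R}$ be Lipschitz with respect to the Wasserstein distance $W_2$ (i.e. $|f(\mu)-f(\mu')|\le CW_2(\mu,\mu')$ for some $C>0$) and differentiable (in the sense recalled in the context), with Lipschitz derivative $\partial_\mu f:\mathcal{P}_2(\mathbb{R}^d)\times\mathbb{R}^d\to\mathbb{R}^d$. Let $\xi,\eta\in L_G^2(\Omega;\mathbb{R}^d)$ with $\hat{\mathbb{E}}[(|\xi|^2+|\eta|^2)I_{\{|\xi|+|\eta|\ge N\}}]\to0$ as $N\to\infty$. Put $F_f(\zeta):=\sup_{P\in\mathcal{P}}f(P_\zeta)$, $\zeta\in L_G^2(\Omega;\mathbb{R}^d)$, and $\mathcal{P}^f_{\{\xi\}}:=\{P\in\mathcal{P}:f(P_\xi)=F_f(\xi)\}$. Then i) $\displaystyle\lim_{0<\varepsilon\downarrow0}\frac{F_f(\xi+\varepsilon\eta)-F_f(\xi)}{\varepsilon}=\sup_{P\in\mathcal{P}^f_{\{\xi\}}}E_P[(\partial_\mu f)(P_\xi,\xi)\eta]$; ii) $\displaystyle\lim_{0>\varepsilon\uparrow0}\frac{F_f(\xi+\varepsilon\eta)-F_f(\xi)}{\varepsilon}=-\sup_{P\in\mathcal{P}^f_{\{\xi\}}}\Big(-E_P[(\partial_\mu f)(P_\xi,\xi)\eta]\Big)$.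
   Context: Fix $T>0$ and $0<\underline\sigma^2\le\overline\sigma^2<\infty$; $G(a)=\frac12(\overline\sigma^2a^+-\underline\sigma^2a^-)$. $\Omega=C([0,T];\mathbb{R})$ with the uniform distance and Borel $\sigma$-field $\mathcal{B}(\Omega)$; $B$ is the coordinate process; $L_{ip}(\Omega)$ is the set of random variables $\varphi(B_{t_1},B_{t_2}-B_{t_1},\dots,B_{t_n}-B_{t_{n-1}})$ with $n\ge1$, $0\le t_1<\dots<t_n\le T$, $\varphi$ bounded Lipschitz. $\hat{\mathbb{E}}$ is the $G$-expectation, i.e. the sublinear expectation on $L_{ip}(\Omega)$ under which $B$ is a one-dimensional $G$-Brownian motion: $\hat{\mathbb{E}}[\varphi(B_{t_1},\dots,B_{t_n}-B_{t_{n-1}})]=\widetilde{\mathbb{E}}[\varphi(\sqrt{t_1}\xi_1,\dots,\sqrt{t_n-t_{n-1}}\xi_n)]$, where on some sublinear expectation space the $\xi_i$ are identically distributed and $G$-normal (with $\widetilde{\mathbb{E}}[\xi_i^2]=\overline\sigma^2$, $-\widetilde{\mathbb{E}}[-\xi_i^2]=\underline\sigma^2$), each $\xi_i$ independent of $(\xi_1,\dots,\xi_{i-1})$ in Peng's sense. $L_G^p(\Omega)$ is the completion of $L_{ip}(\Omega)$ under $(\hat{\mathbb{E}}[|\cdot|^p])^{1/p}$; $L_G^2(\Omega;\mathbb{R}^d)$ is the space of $\mathbb{R}^d$-valued random vectors with components in $L_G^2(\Omega)$. $\mathcal{P}=\{P\text{ probability on }(\Omega,\mathcal{B}(\Omega)):E_P[X]\le\hat{\mathbb{E}}[X]\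 \forall X\in L_G^1(\Omega)\}$; it is known to be nonempty, convex, weakly compact, with $\hat{\mathbb{E}}[\zeta]=\max_{P\in\mathcal{P}}E_P[\zeta]$ for $\zeta\in L_G^1(\Omega)$; $\hat{\mathbb{E}}[\cdot]=\sup_{P\in\mathcal{P}}E_P[\cdot]$ is also used for indicator-truncated random variables. $P_\xi=P\circ\xi^{-1}$ is the law of $\xi$ under $P$; $\mathcal{P}_2(\mathbb{R}^d)$ is the set of probability measures on $\mathbb{R}^d$ with finite second moment, with the 2-Wasserstein distance $W_2$. Products of $\mathbb{R}^d$-valued quantities are inner products. Differentiability: $f:\mathcal{P}_2(\mathbb{R}^d)\to\mathbb{R}$ is differentiable if there is a continuous function $\partial_mf:\mathcal{P}_2(\mathbb{R}^d)\times\mathbb{R}^d\to\mathbb{R}$, with $\partial_mf(\mu,\cdot)$ differentiable for all $\mu$, such that $\lim_{0<\lambda\downarrow0}\frac{f((1-\lambda)\mu+\lambda\mu')-f(\mu)}{\lambda}=\int_{\mathbb{R}^d}\partial_mf(\mu,y)(\mu'-\mu)(dy)$ for all $\mu,\mu'\in\mathcal{P}_2(\mathbb{R}^d)$; the derivative is $\partial_\mu f(\mu,y):=\partial_y(\partial_mf)(\mu,y)$ (Lions' derivative). *)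

theory Defs
  imports "HOL-Probability.Probability"
begin

section \<open>Sublinear expectations, independence and G-normality\<close>

text \<open>
  A function on \<open>R^n\<close> is represented by a function \<^term>\<open>\<phi> :: (nat \<Rightarrow> real) \<Rightarrow> real\<close>. Both
  Lipschitz conditions below are stated with the Euclidean norm of the first \<^term>\<open>n\<close> coordinates,
  so that they force \<^term>\<open>\<phi>\<close> to depend on these coordinates only.
\<close>

definition bounded_Lipschitz :: "nat \<Rightarrow> ((nat \<Rightarrow> real) \<Rightarrow> real) \<Rightarrow> bool" where
  "bounded_Lipschitz n \<phi> \<longleftrightarrow>
     (\<exists>K. \<forall>x. \<bar>\<phi> x\<bar> \<le> K) \<and>
     (\<exists>C. \<forall>x y. \<bar>\<phi> x - \<phi> y\<bar> \<le> C * L2_set (\<lambda>i. x i - y i) {..<n})"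

text \<open>Peng's class \<open>C_{l,Lip}(R^n)\<close> of test functions.\<close>

definition local_Lipschitz_poly :: "nat \<Rightarrow> ((nat \<Rightarrow> real) \<Rightarrow> real) \<Rightarrow> bool" where
  "local_Lipschitz_poly n \<phi> \<longleftrightarrow>
     (\<exists>C m. \<forall>x y. \<bar>\<phi> x - \<phi> y\<bar> \<le>
        C * (1 + L2_set x {..<n} ^ m + L2_set y {..<n} ^ m) * L2_set (\<lambda>i. x i - y i) {..<n})"

definition sublinear_expectation ::
  "'w set \<Rightarrow> ('w \<Rightarrow> real) set \<Rightarrow> (('w \<Rightarrow> real) \<Rightarrow> real) \<Rightarrow> bool" where
  "sublinear_expectation S H E \<longleftrightarrow>
     (\<forall>X\<in>H. \<forall>Y\<in>H. (\<forall>w\<in>S. X w \<le> Y w) \<longrightarrow> E X \<le> E Y) \<and>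
     (\<forall>c. E (\<lambda>_. c) = c) \<and>
     (\<forall>X\<in>H. \<forall>Y\<in>H. E (\<lambda>w. X w + Y w) \<le> E X + E Y) \<and>
     (\<forall>X\<in>H. \<forall>a\<ge>0. E (\<lambda>w. a * X w) = a * E X)"

text \<open>
  Closure of \<^term>\<open>H\<close> under \<open>C_{l,Lip}\<close> functions subsumes that \<^term>\<open>H\<close> is a vector lattice
  containing the constants.
\<close>

definition sublinear_expectation_space ::
  "('w \<Rightarrow> real) set \<Rightarrow> (('w \<Rightarrow> real) \<Rightarrow> real) \<Rightarrow> bool" where
  "sublinear_expectation_space H E \<longleftrightarrow>
     (\<forall>n \<phi> X. local_Lipschitz_poly n \<phi> \<longrightarrow> (\<forall>i<n. X i \<in> H) \<longrightarrow> (\<lambda>w. \<phi> (\<lambda>i. X i w)) \<in> H) \<and>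
     sublinear_expectation UNIV H E"

definition ident_distributed ::
  "(('w \<Rightarrow> real) \<Rightarrow> real) \<Rightarrow> ('w \<Rightarrow> real) \<Rightarrow> ('w \<Rightarrow> real) \<Rightarrow> bool" where
  "ident_distributed E X Y \<longleftrightarrow>
     (\<forall>\<phi>. local_Lipschitz_poly 1 \<phi> \<longrightarrow> E (\<lambda>w. \<phi> (\<lambda>_. X w)) = E (\<lambda>w. \<phi> (\<lambda>_. Y w)))"

text \<open>
  \<^term>\<open>Y\<close> is independent of the random vector \<open>(X 0, \<dots>, X (n - 1))\<close>:
  \<open>E[\<phi>(X, Y)] = E[E[\<phi>(x, Y)] at x = X]\<close>. The relation is not symmetric in \<open>X\<close> and \<open>Y\<close>.
\<close>

definition Peng_independent ::
  "(('w \<Rightarrow> real) \<Rightarrow> real) \<Rightarrow> nat \<Rightarrow> (nat \<Rightarrow> 'w \<Rightarrow> real) \<Rightarrow> ('w \<Rightarrow> real) \<Rightarrow> bool" where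
  "Peng_independent E n X Y \<longleftrightarrow>
     (\<forall>\<phi>. local_Lipschitz_poly (Suc n) \<phi> \<longrightarrow>
        E (\<lambda>w. \<phi> ((\<lambda>i. X i w)(n := Y w))) =
        E (\<lambda>w. E (\<lambda>w'. \<phi> ((\<lambda>i. X i w)(n := Y w')))))"

text \<open>
  Peng's definition of a G-normal random variable: \<open>a X + b X'\<close> is distributed as
  \<open>sqrt (a^2 + b^2) X\<close> for an independent copy \<open>X'\<close> of \<open>X\<close>. The two variances determine
  \<open>G(a) = E[a X^2] / 2\<close>.
\<close>

definition G_normal ::
  "('w \<Rightarrow> real) set \<Rightarrow> (('w \<Rightarrow> real) \<Rightarrow> real) \<Rightarrow> real \<Rightarrow> real \<Rightarrow> ('w \<Rightarrow> real) \<Rightarrow> bool" where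
  "G_normal H E \<sigma>lo \<sigma>hi X \<longleftrightarrow>
     X \<in> H \<and>
     (\<exists>X'\<in>H. ident_distributed E X' X \<and> Peng_independent E 1 (\<lambda>_. X) X' \<and>
        (\<forall>a\<ge>0. \<forall>b\<ge>0. ident_distributed E (\<lambda>w. a * X w + b * X' w) (\<lambda>w. sqrt (a\<^sup>2 + b\<^sup>2) * X w))) \<and>
     E (\<lambda>w. (X w)\<^sup>2) = \<sigma>hi\<^sup>2 \<and>
     - E (\<lambda>w. - (X w)\<^sup>2) = \<sigma>lo\<^sup>2"


section \<open>Path space and G-expectation\<close>

text \<open>
  \<open>C([0,T]; R)\<close> with the uniform distance. Its elements are functions on the reals with an arbitrary
  fixed value outside \<open>[0,T]\<close>.
\<close>

definition path_metric :: "real \<Rightarrow> (real \<Rightarrow> real) metric" where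
  "path_metric T = cfunspace (top_of_set {0..T}) euclidean_metric"

definition path_borel :: "real \<Rightarrow> (real \<Rightarrow> real) measure" where
  "path_borel T = sigma (mspace (path_metric T)) {U. openin (mtopology_of (path_metric T)) U}"

text \<open>
  Times \<open>t 0 < \<dots> < t (n - 1)\<close> in \<open>[0,T]\<close>; the increment with index \<open>0\<close> is \<open>B_{t 0}\<close> itself,
  and the corresponding time step is \<open>t 0\<close>.
\<close>

definition time_grid :: "real \<Rightarrow> nat \<Rightarrow> (nat \<Rightarrow> real) \<Rightarrow> bool" where
  "time_grid T n t \<longleftrightarrow> n \<ge> 1 \<and> 0 \<le> t 0 \<and> strict_mono_on {..<n} t \<and> t (n - 1) \<le> T"

definition increment :: "(nat \<Rightarrow> real) \<Rightarrow> (real \<Rightarrow> real) \<Rightarrow> nat \<Rightarrow> real" where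
  "increment t \<omega> i = (if i = 0 then \<omega> (t 0) else \<omega> (t i) - \<omega> (t (i - 1)))"

definition time_step :: "(nat \<Rightarrow> real) \<Rightarrow> nat \<Rightarrow> real" where
  "time_step t i = (if i = 0 then t 0 else t i - t (i - 1))"

definition L_ip :: "real \<Rightarrow> ((real \<Rightarrow> real) \<Rightarrow> real) set" where
  "L_ip T = {(\<lambda>\<omega>. \<phi> (increment t \<omega>)) | n t \<phi>. time_grid T n t \<and> bounded_Lipschitz n \<phi>}"

text \<open>
  \<^term>\<open>Ehat\<close> is the G-expectation on \<^term>\<open>L_ip T\<close>, expressed through a sequence \<^term>\<open>\<xi>\<close> of
  identically distributed G-normal random variables on the sublinear expectation space
  \<^term>\<open>(H, E)\<close>, each independent of its predecessors.
\<close>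

definition G_expectation ::
  "real \<Rightarrow> real \<Rightarrow> real \<Rightarrow> ('w \<Rightarrow> real) set \<Rightarrow> (('w \<Rightarrow> real) \<Rightarrow> real) \<Rightarrow> (nat \<Rightarrow> 'w \<Rightarrow> real) \<Rightarrow>
   (((real \<Rightarrow> real) \<Rightarrow> real) \<Rightarrow> real) \<Rightarrow> bool" where
  "G_expectation T \<sigma>lo \<sigma>hi H E \<xi> Ehat \<longleftrightarrow>
     sublinear_expectation_space H E \<and>
     (\<forall>i. G_normal H E \<sigma>lo \<sigma>hi (\<xi> i)) \<and>
     (\<forall>i j. ident_distributed E (\<xi> i) (\<xi> j)) \<and>
     (\<forall>i. Peng_independent E i \<xi> (\<xi> i)) \<and>
     sublinear_expectation (mspace (path_metric T)) (L_ip T) Ehat \<and>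
     (\<forall>n t \<phi>. time_grid T n t \<longrightarrow> bounded_Lipschitz n \<phi> \<longrightarrow>
        Ehat (\<lambda>\<omega>. \<phi> (increment t \<omega>)) = E (\<lambda>w. \<phi> (\<lambda>i. sqrt (time_step t i) * \<xi> i w)))"


section \<open>The spaces \<open>L_G^p\<close> and the set of dominated probability measures\<close>

text \<open>\<open>sup_P E_P[X]\<close> for nonnegative \<^term>\<open>X\<close>, possibly infinite.\<close>

definition upper_expectation :: "'w measure set \<Rightarrow> ('w \<Rightarrow> real) \<Rightarrow> ennreal" where
  "upper_expectation Q X = (SUP P\<in>Q. \<integral>\<^sup>+\<omega>. ennreal (X \<omega>) \<partial>P)"

text \<open>
  \<open>L_G^p\<close> is the completion of \<^term>\<open>L_ip T\<close> under the seminorm \<open>Ehat[|.|^p]^{1/p}\<close>. Its elements are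
  represented by Borel functions on the path space. A probability measure can be applied to elements
  of the completion only if it is dominated by \<^term>\<open>Ehat\<close> on \<^term>\<open>L_ip T\<close>; a Borel
  function \<^term>\<open>X\<close> represents the Cauchy sequence \<^term>\<open>Xs\<close> if \<^term>\<open>Xs\<close> converges to
  \<^term>\<open>X\<close> in \<open>L^p(P)\<close> uniformly over all these measures \<^term>\<open>P\<close>.
\<close>

definition dominated_on_L_ip ::
  "real \<Rightarrow> (((real \<Rightarrow> real) \<Rightarrow> real) \<Rightarrow> real) \<Rightarrow> (real \<Rightarrow> real) measure set" where
  "dominated_on_L_ip T Ehat =
     {P. prob_space P \<and> sets P = sets (path_borel T) \<and> (\<forall>X\<in>L_ip T. integral\<^sup>L P X \<le> Ehat X)}"

definition LG_represents ::
  "real \<Rightarrow> (((real \<Rightarrow> real) \<Rightarrow> real) \<Rightarrow> real) \<Rightarrow> nat \<Rightarrow> ((real \<Rightarrow> real) \<Rightarrow> real) \<Rightarrow>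
   (nat \<Rightarrow> (real \<Rightarrow> real) \<Rightarrow> real) \<Rightarrow> bool" where
  "LG_represents T Ehat p X Xs \<longleftrightarrow>
     X \<in> borel_measurable (path_borel T) \<and>
     (\<forall>n. Xs n \<in> L_ip T) \<and>
     (\<forall>e>0. \<exists>N. \<forall>m\<ge>N. \<forall>n\<ge>N. root p (Ehat (\<lambda>\<omega>. \<bar>Xs m \<omega> - Xs n \<omega>\<bar> ^ p)) < e) \<and>
     (\<lambda>n. upper_expectation (dominated_on_L_ip T Ehat) (\<lambda>\<omega>. \<bar>X \<omega> - Xs n \<omega>\<bar> ^ p)) \<longlonglongrightarrow> 0"

definition LG ::
  "real \<Rightarrow> (((real \<Rightarrow> real) \<Rightarrow> real) \<Rightarrow> real) \<Rightarrow> nat \<Rightarrow> ((real \<Rightarrow> real) \<Rightarrow> real) set" where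
  "LG T Ehat p = {X. \<exists>Xs. LG_represents T Ehat p X Xs}"

definition LG_vec ::
  "real \<Rightarrow> (((real \<Rightarrow> real) \<Rightarrow> real) \<Rightarrow> real) \<Rightarrow> nat \<Rightarrow> ((real \<Rightarrow> real) \<Rightarrow> 'a::euclidean_space) set" where
  "LG_vec T Ehat p = {X. \<forall>b\<in>Basis. (\<lambda>\<omega>. X \<omega> \<bullet> b) \<in> LG T Ehat p}"

text \<open>
  The continuous extension of \<^term>\<open>Ehat\<close> to \<open>L_G^1\<close>, as a relation: \<^term>\<open>r\<close> is the value of the
  extension at \<^term>\<open>X\<close>.
\<close>

definition Ehat_extension ::
  "real \<Rightarrow> (((real \<Rightarrow> real) \<Rightarrow> real) \<Rightarrow> real) \<Rightarrow> ((real \<Rightarrow> real) \<Rightarrow> real) \<Rightarrow> real \<Rightarrow> bool" where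
  "Ehat_extension T Ehat X r \<longleftrightarrow>
     (\<exists>Xs. LG_represents T Ehat 1 X Xs \<and> (\<lambda>n. Ehat (Xs n)) \<longlonglongrightarrow> r)"

definition G_measures ::
  "real \<Rightarrow> (((real \<Rightarrow> real) \<Rightarrow> real) \<Rightarrow> real) \<Rightarrow> (real \<Rightarrow> real) measure set" where
  "G_measures T Ehat =
     {P. prob_space P \<and> sets P = sets (path_borel T) \<and>
         (\<forall>X\<in>LG T Ehat 1. \<forall>r. Ehat_extension T Ehat X r \<longrightarrow> integral\<^sup>L P X \<le> r)}"


section \<open>Wasserstein space and Lions' derivative\<close>

definition P2 :: "'a::euclidean_space measure set" where
  "P2 = {\<mu>. prob_space \<mu> \<and> sets \<mu> = sets borel \<and> integrable \<mu> (\<lambda>x. (norm x)\<^sup>2)}"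

definition couplings :: "'a::euclidean_space measure \<Rightarrow> 'a measure \<Rightarrow> ('a \<times> 'a) measure set" where
  "couplings \<mu> \<nu> =
     {\<pi>. prob_space \<pi> \<and> sets \<pi> = sets borel \<and> distr \<pi> borel fst = \<mu> \<and> distr \<pi> borel snd = \<nu>}"

definition W2 :: "'a::euclidean_space measure \<Rightarrow> 'a measure \<Rightarrow> real" where
  "W2 \<mu> \<nu> = sqrt (INF \<pi>\<in>couplings \<mu> \<nu>. \<integral>z. (dist (fst z) (snd z))\<^sup>2 \<partial>\<pi>)"

text \<open>\<open>(1 - \<lambda>) \<mu> + \<lambda> \<nu>\<close> for \<open>0 \<le> \<lambda> \<le> 1\<close>.\<close>

definition mixture ::
  "real \<Rightarrow> 'a::euclidean_space measure \<Rightarrow> 'a measure \<Rightarrow> 'a measure" where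
  "mixture l \<mu> \<nu> = measure_of UNIV (sets borel)
     (\<lambda>A. ennreal (1 - l) * emeasure \<mu> A + ennreal l * emeasure \<nu> A)"

definition jointly_continuous :: "('a::euclidean_space measure \<Rightarrow> 'a \<Rightarrow> real) \<Rightarrow> bool" where
  "jointly_continuous g \<longleftrightarrow>
     (\<forall>\<mu>\<in>P2. \<forall>y. \<forall>e>0. \<exists>d>0. \<forall>\<nu>\<in>P2. \<forall>z.
        W2 \<mu> \<nu> < d \<and> dist y z < d \<longrightarrow> \<bar>g \<nu> z - g \<mu> y\<bar> < e)"

text \<open>
  \<^term>\<open>f\<close> is differentiable with derivative \<^term>\<open>D\<close>, where \<^term>\<open>dm\<close> plays the role of
  \<open>\<partial>\<^sub>m f\<close>. The integrability clause says that the integral of \<open>\<partial>\<^sub>m f(\<mu>, .)\<close> against \<open>\<nu> - \<mu>\<close>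
  is defined; a Bochner integral that does not exist would be \<open>0\<close>.
\<close>

definition has_Lions_derivative ::
  "('a::euclidean_space measure \<Rightarrow> real) \<Rightarrow> ('a measure \<Rightarrow> 'a \<Rightarrow> 'a) \<Rightarrow> bool" where
  "has_Lions_derivative f D \<longleftrightarrow>
     (\<exists>dm. jointly_continuous dm \<and>
        (\<forall>\<mu>\<in>P2. \<forall>y. GDERIV (dm \<mu>) y :> D \<mu> y) \<and>
        (\<forall>\<mu>\<in>P2. \<forall>\<nu>\<in>P2. integrable \<nu> (dm \<mu>)) \<and>
        (\<forall>\<mu>\<in>P2. \<forall>\<nu>\<in>P2.
           ((\<lambda>l. (f (mixture l \<mu> \<nu>) - f \<mu>) / l) \<longlongrightarrow> (\<integral>y. dm \<mu> y \<partial>\<nu>) - (\<integral>y. dm \<mu> y \<partial>\<mu>)) (at_right 0)))"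

definition W2_Lipschitz :: "('a::euclidean_space measure \<Rightarrow> real) \<Rightarrow> bool" where
  "W2_Lipschitz f \<longleftrightarrow> (\<exists>C>0. \<forall>\<mu>\<in>P2. \<forall>\<nu>\<in>P2. \<bar>f \<mu> - f \<nu>\<bar> \<le> C * W2 \<mu> \<nu>)"

definition Lipschitz_derivative :: "('a::euclidean_space measure \<Rightarrow> 'a \<Rightarrow> 'a) \<Rightarrow> bool" where
  "Lipschitz_derivative D \<longleftrightarrow>
     (\<exists>C>0. \<forall>\<mu>\<in>P2. \<forall>\<nu>\<in>P2. \<forall>y z. dist (D \<mu> y) (D \<nu> z) \<le> C * (W2 \<mu> \<nu> + dist y z))"


section \<open>The functional \<open>F_f\<close>\<close>

definition F_sup ::
  "real \<Rightarrow> (((real \<Rightarrow> real) \<Rightarrow> real) \<Rightarrow> real) \<Rightarrow> ('a::euclidean_space measure \<Rightarrow> real) \<Rightarrow>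
   ((real \<Rightarrow> real) \<Rightarrow> 'a) \<Rightarrow> real" where
  "F_sup T Ehat f \<zeta> = (SUP P\<in>G_measures T Ehat. f (distr P borel \<zeta>))"

definition G_maximizers ::
  "real \<Rightarrow> (((real \<Rightarrow> real) \<Rightarrow> real) \<Rightarrow> real) \<Rightarrow> ('a::euclidean_space measure \<Rightarrow> real) \<Rightarrow>
   ((real \<Rightarrow> real) \<Rightarrow> 'a) \<Rightarrow> (real \<Rightarrow> real) measure set" where
  "G_maximizers T Ehat f \<xi> = {P \<in> G_measures T Ehat. f (distr P borel \<xi>) = F_sup T Ehat f \<xi>}"

end

theory Submission
  imports Defs
begin

text \<open>
  Both \<open>f(P\<^sub>\<xi>)\<close> and \<open>f(P\<^sub>\<xi>\<^sub>+\<^sub>\<epsilon>\<^sub>\<eta>)\<close> depend only on the joint law of \<open>(\<xi>, \<eta>)\<close> under \<open>P\<close>. Integrating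
  Lions' derivative along the segment of mixtures between the two laws gives
  \<open>f(P\<^sub>\<xi>\<^sub>+\<^sub>\<epsilon>\<^sub>\<eta>) = f(P\<^sub>\<xi>) + \<epsilon> E\<^sub>P[(\<partial>\<^sub>\<mu>f)(P\<^sub>\<xi>, \<xi>)\<eta>] + O(\<epsilon>\<^sup>2)\<close> uniformly in \<open>P\<close>, and Danskin's theorem
  yields both limits as soon as the functions \<open>P \<mapsto> f(P\<^sub>\<xi>)\<close> and \<open>P \<mapsto> E\<^sub>P[(\<partial>\<^sub>\<mu>f)(P\<^sub>\<xi>, \<xi>)\<eta>]\<close> are sequentially
  continuous along subsequences of any sequence of dominated measures.

  The bound on the fourth moments of the increments makes the dominated measures tight: their restrictions
  to the dyadic times converge along a subsequence in the almost sure sense of Skorokhod (Helly selection after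
  coding a sequence of reals by one real in the Cantor set), and Kolmogorov's criterion puts the limit back on
  continuous paths. The same compactness reduces existence of a dominated measure to finitely many cylinder
  functions, where a uniform measure on paths chosen by Blackwell's approachability strategy will do.
\<close>

section \<open>Compactness of laws on a sequence space\<close>

text \<open>The obstacle is uniformity: an expansion of \<open>f\<close> at the law under one
  \<open>P\<close> says nothing about a supremum over all \<open>P\<close>. Because the derivative
  is Lipschitz in both arguments, the remainder is at most a constant times
  \<open>E_P[|V|^2]\<close>, and elements of \<open>L_G^2\<close> have second moments bounded over
  all dominated \<open>P\<close>, so one constant serves the whole set. Weak convergence of the
  measures is too weak for the two functionals: \<open>\<xi>\<close> and \<open>\<eta>\<close> are
  merely Borel, and \<open>f\<close> is continuous for \<open>W2\<close>. Hence the compactness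
  result delivers almost surely convergent copies of the dyadic coordinates. The pair of
  \<open>\<xi>\<close> and \<open>\<eta>\<close> is replaced, in \<open>L^2\<close> and uniformly in
  \<open>P\<close>, by bounded functions of finitely many coordinates; bounded convergence then
  yields couplings of small quadratic cost, and along such couplings both functionals are Lipschitz.
  The Cantor set is chosen for the coding because reading a digit is locally constant on it:
  convergence of codes forces every digit to stabilise. Moments occur in truncated form because
  \<open>Ehat\<close> is given on bounded functions.\<close>

definition cantor_enc :: "(nat \<Rightarrow> bool) \<Rightarrow> real" where
  "cantor_enc a = (\<Sum>m. 2 * of_bool (a m) / 3 ^ Suc m)"

text \<open>On codes this removes the leading digit. The comparison with 1/2 takes place inside the
  gap (1/3, 2/3) that no code enters; elsewhere on the line the value carries no meaning.\<close>

definition cantor_shift :: "real \<Rightarrow> real" where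
  "cantor_shift z = 3 * z - 2 * of_bool (z \<ge> 1/2)"

definition cantor_bit :: "nat \<Rightarrow> real \<Rightarrow> bool" where
  "cantor_bit m z \<longleftrightarrow> (cantor_shift ^^ m) z \<ge> 1/2"

lemma summable_cantor: "summable (\<lambda>m. 2 * of_bool (a m) / 3 ^ Suc m :: real)"
proof (rule summable_comparison_test')
  show "summable (\<lambda>m. 2 * (1/3::real)^m)"
    by (intro summable_mult summable_geometric) simp
  show "norm (2 * of_bool (a m) / 3 ^ Suc m :: real) \<le> 2 * (1/3)^m" if "m \<ge> 0" for m
    by (simp add: field_simps of_bool_def)
qed

lemma cantor_enc_unfold: "cantor_enc a = (2 * of_bool (a 0) + cantor_enc (\<lambda>m. a (Suc m))) / 3"
proof -
  have "(\<Sum>m. 2 * of_bool (a (Suc m)) / 3 ^ Suc (Suc m)) = cantor_enc a - 2 * of_bool (a 0) / 3"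
    unfolding cantor_enc_def using suminf_split_head[OF summable_cantor[of a]] by simp
  moreover have "(\<Sum>m. 2 * of_bool (a (Suc m)) / 3 ^ Suc (Suc m)) = cantor_enc (\<lambda>m. a (Suc m)) / 3"
    unfolding cantor_enc_def using suminf_divide[OF summable_cantor[of "\<lambda>m. a (Suc m)"], of 3]
    by (simp add: field_simps)
  ultimately show ?thesis by (simp add: field_simps)
qed

lemma cantor_enc_bounds: "0 \<le> cantor_enc a" "cantor_enc a \<le> 1"
proof -
  show "0 \<le> cantor_enc a"
    unfolding cantor_enc_def by (rule suminf_nonneg[OF summable_cantor]) simp
  have s: "(\<lambda>m. 2/3 * (1/3::real)^m) sums (2/3 * (1 / (1 - 1/3)))"
    by (intro sums_mult geometric_sums) simp
  have "cantor_enc a \<le> (\<Sum>m. 2/3 * (1/3::real)^m)"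
    unfolding cantor_enc_def
    by (rule suminf_le[OF _ summable_cantor]) (use s in \<open>auto simp: of_bool_def field_simps sums_iff\<close>)
  also have "\<dots> = 1" using s by (simp add: sums_iff)
  finally show "cantor_enc a \<le> 1" .
qed

text \<open>This gap is the source of all stability of digits under limits.\<close>

lemma cantor_enc_range: "cantor_enc a \<in> {..1/3} \<union> {2/3..}"
  using cantor_enc_bounds[of "\<lambda>m. a (Suc m)"] by (subst (1) cantor_enc_unfold) auto

lemma cantor_enc_ge_half: "cantor_enc a \<ge> 1/2 \<longleftrightarrow> a 0"
  using cantor_enc_bounds[of "\<lambda>m. a (Suc m)"] by (subst cantor_enc_unfold) auto

lemma cantor_shift_pow_enc: "(cantor_shift ^^ m) (cantor_enc a) = cantor_enc (\<lambda>k. a (m + k))"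
proof (induction m arbitrary: a)
  case (Suc m)
  have "cantor_shift (cantor_enc a) = cantor_enc (\<lambda>k. a (Suc k))"
    unfolding cantor_shift_def cantor_enc_ge_half
    by (subst cantor_enc_unfold) (simp add: field_simps)
  then show ?case by (simp add: funpow_Suc_right Suc.IH del: funpow.simps)
qed simp

lemma cantor_bit_enc: "cantor_bit m (cantor_enc a) \<longleftrightarrow> a m"
  unfolding cantor_bit_def cantor_shift_pow_enc cantor_enc_ge_half by simp

text \<open>The shift jumps only at 1/2. The range hypothesis keeps all shifted terms out of (1/3,
  2/3), and by closedness the limit too, so the shift is continuous along the sequence and the
  argument can be repeated for the next digit. The hypothesis concerns the terms only, since for the
  limit nothing is known beforehand.\<close>

lemma cantor_bit_eventually_eq:
  assumes lim: "zs \<longlonglongrightarrow> z" and rng: "\<And>n m. (cantor_shift ^^ m) (zs n) \<in> {..1/3} \<union> {2/3..}"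
  shows "\<forall>\<^sub>F n in sequentially. cantor_bit m (zs n) = cantor_bit m z"
proof -
  have step: "\<forall>\<^sub>F n in sequentially. (ws n \<ge> 1/2) = (w \<ge> 1/2)"
    if "ws \<longlonglongrightarrow> w" "\<And>n. ws n \<in> {..1/3} \<union> {2/3..}" for ws and w :: real
  proof -
    have "w \<in> {..1/3} \<union> {2/3..}"
      by (rule Lim_in_closed_set[OF _ _ _ that(1)]) (use that(2) in \<open>auto intro!: closed_Un\<close>)
    then consider "w < 1/2" | "w > 1/2" by fastforce
    then show ?thesis
    proof cases
      case 1 then show ?thesis using order_tendstoD(2)[OF that(1) 1] by (auto elim!: eventually_mono)
    next
      case 2 then show ?thesis using order_tendstoD(1)[OF that(1) 2] by (auto elim!: eventually_mono)
    qed
  qed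
  have conv: "(\<lambda>n. (cantor_shift ^^ m) (zs n)) \<longlonglongrightarrow> (cantor_shift ^^ m) z" for m
  proof (induction m)
    case (Suc m)
    let ?w = "(cantor_shift ^^ m) z"
    \<comment> \<open>The digit is frozen at its value for the limit, which leaves an affine
      expression; by \<open>step\<close> this alters only finitely many terms.\<close>
    have "(\<lambda>n. 3 * (cantor_shift ^^ m) (zs n) - 2 * of_bool (?w \<ge> 1/2)) \<longlonglongrightarrow> 3 * ?w - 2 * of_bool (?w \<ge> 1/2)"
      by (intro tendsto_intros Suc)
    moreover have "\<forall>\<^sub>F n in sequentially. 3 * (cantor_shift ^^ m) (zs n) - 2 * of_bool (?w \<ge> 1/2)
        = (cantor_shift ^^ Suc m) (zs n)"
      using step[OF Suc rng]
    proof eventually_elim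
      case (elim n)
      then show ?case by (simp add: cantor_shift_def[of "(cantor_shift ^^ m) (zs n)"])
    qed
    ultimately have "(\<lambda>n. (cantor_shift ^^ Suc m) (zs n)) \<longlonglongrightarrow> 3 * ?w - 2 * of_bool (?w \<ge> 1/2)"
      by (rule Lim_transform_eventually)
    then show ?case by (simp add: cantor_shift_def[of ?w])
  qed (use lim in simp)
  show ?thesis unfolding cantor_bit_def by (rule step[OF conv rng])
qed

lemma cantor_shift_pow_measurable [measurable]: "(cantor_shift ^^ m) \<in> borel_measurable borel"
proof (induction m)
  case (Suc m)
  have [measurable]: "cantor_shift \<in> borel_measurable borel"
    unfolding cantor_shift_def[abs_def] of_bool_def by measurable
  show ?case unfolding funpow.simps by (rule measurable_comp[OF Suc]) measurable
qed (simp add: id_def)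

lemma cantor_bit_measurable [measurable]: "Measurable.pred borel (cantor_bit m)"
  unfolding cantor_bit_def[abs_def] by measurable

section \<open>Binary digits, and the coding of a sequence of reals by one real\<close>

definition bin_digit :: "nat \<Rightarrow> real \<Rightarrow> bool" where
  "bin_digit j y \<longleftrightarrow> odd \<lfloor>2 ^ Suc j * y\<rfloor>"

definition bin_val :: "(nat \<Rightarrow> bool) \<Rightarrow> real" where
  "bin_val a = (\<Sum>j. of_bool (a j) / 2 ^ Suc j)"

text \<open>The first \<open>n\<close> digits add up to \<open>y\<close> rounded down to a multiple
  of \<open>1 / 2 ^ n\<close>: passing from level \<open>n + 1\<close> back to level
  \<open>n\<close> halves the floor and drops the last digit.\<close>

lemma bin_val_digit:
  assumes "0 \<le> y" "y < 1"
  shows "bin_val (\<lambda>j. bin_digit j y) = y"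
proof -
  have part: "(\<Sum>j<n. of_bool (bin_digit j y) / 2 ^ Suc j) = \<lfloor>2 ^ n * y\<rfloor> / 2 ^ n" for n
  proof (induction n)
    case 0 then show ?case using assms by (simp add: floor_eq_iff)
  next
    case (Suc n)
    have "\<lfloor>2 ^ n * y\<rfloor> = \<lfloor>(2 ^ Suc n * y) / of_int 2\<rfloor>" by simp
    also have "\<dots> = \<lfloor>2 ^ Suc n * y\<rfloor> div 2" by (rule floor_divide_real_eq_div) simp
    finally have "\<lfloor>2 ^ Suc n * y\<rfloor> = 2 * \<lfloor>2 ^ n * y\<rfloor> + of_bool (bin_digit n y)"
      unfolding bin_digit_def by (auto simp: of_bool_def elim!: oddE)
    then have "real_of_int \<lfloor>2 ^ Suc n * y\<rfloor> = 2 * \<lfloor>2 ^ n * y\<rfloor> + of_bool (bin_digit n y)"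
      by simp
    then show ?case using Suc by (simp add: field_simps)
  qed
  have "(\<lambda>n. \<lfloor>2 ^ n * y\<rfloor> / 2 ^ n) \<longlonglongrightarrow> y"
  proof (rule tendsto_sandwich)
    show "(\<lambda>n. y - (1/2)^n) \<longlonglongrightarrow> y"
      by (rule tendsto_eq_rhs[OF tendsto_diff[OF tendsto_const LIMSEQ_power_zero]]) auto
    show "\<forall>\<^sub>F n in sequentially. y - (1/2)^n \<le> \<lfloor>2 ^ n * y\<rfloor> / 2 ^ n"
    proof (rule always_eventually, rule allI)
      fix n :: nat
      have "2 ^ n * y - 1 \<le> real_of_int \<lfloor>2 ^ n * y\<rfloor>" by linarith
      then have "(2 ^ n * y - 1) / 2 ^ n \<le> real_of_int \<lfloor>2 ^ n * y\<rfloor> / 2 ^ n"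
        by (rule divide_right_mono) simp
      then show "y - (1/2)^n \<le> \<lfloor>2 ^ n * y\<rfloor> / 2 ^ n" by (simp add: diff_divide_distrib power_divide)
    qed
    show "\<forall>\<^sub>F n in sequentially. \<lfloor>2 ^ n * y\<rfloor> / 2 ^ n \<le> y"
      by (rule always_eventually) (simp add: field_simps)
  qed auto
  then have "(\<lambda>j. of_bool (bin_digit j y) / 2 ^ Suc j) sums y"
    unfolding sums_def part .
  then show ?thesis by (simp add: bin_val_def sums_iff)
qed

text \<open>Digits do not depend continuously on the number, but the number depends continuously on
  the digits, and only this direction is used when codes converge.\<close>

lemma bin_val_tendsto:
  assumes "\<And>j. \<forall>\<^sub>F n in sequentially. as n j = a j"
  shows "(\<lambda>n. bin_val (as n)) \<longlonglongrightarrow> bin_val a"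
proof -
  have "((\<lambda>n. \<Sum>j. of_bool (as n j) / 2 ^ Suc j :: real) \<longlongrightarrow> (\<Sum>j. of_bool (a j) / 2 ^ Suc j)) sequentially"
  proof (rule conjunct2[OF conjunct2[OF tannerys_theorem]])
    show "(\<lambda>n. of_bool (as n j) / 2 ^ Suc j :: real) \<longlonglongrightarrow> of_bool (a j) / 2 ^ Suc j" for j
      by (rule tendsto_eventually) (use assms[of j] in \<open>auto elim!: eventually_mono\<close>)
    show "\<forall>\<^sub>F (k, n) in sequentially \<times>\<^sub>F sequentially. norm (of_bool (as n k) / 2 ^ Suc k :: real) \<le> (1/2)^k"
      by (rule always_eventually) (auto simp: field_simps of_bool_def)
    show "summable (\<lambda>m. (1/2::real)^m)" by (intro summable_geometric) simp
  qed simp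
  then show ?thesis by (simp add: bin_val_def)
qed

definition seq_code :: "(nat \<Rightarrow> real) \<Rightarrow> real" where
  "seq_code x = cantor_enc (\<lambda>m. bin_digit (snd (prod_decode m)) (1/2 + arctan (x (fst (prod_decode m))) / pi))"

text \<open>Coordinate \<open>i\<close> of the sequence coded by \<open>z\<close>, still squeezed
  into [0,1] by the arctangent. At this stage limits always exist; the end points 0 and 1 stand for
  a coordinate that has escaped to infinity.\<close>

definition seq_val :: "real \<Rightarrow> nat \<Rightarrow> real" where
  "seq_val z i = bin_val (\<lambda>j. cantor_bit (prod_encode (i, j)) z)"

definition seq_decode :: "real \<Rightarrow> nat \<Rightarrow> real" where
  "seq_decode z i = tan (pi * (seq_val z i - 1/2))"

lemma arctan_scaled: "\<bar>arctan x / pi\<bar> < 1/2"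
  using arctan_bounded[of x] by (auto simp: abs_less_iff field_simps)

lemma seq_val_code: "seq_val (seq_code x) i = 1/2 + arctan (x i) / pi"
  unfolding seq_val_def seq_code_def cantor_bit_enc
  using arctan_scaled[of "x i"] by (simp only: fst_conv snd_conv prod_encode_inverse) (intro bin_val_digit; linarith)

lemma seq_decode_code: "seq_decode (seq_code x) = x"
  unfolding seq_decode_def seq_val_code by (auto simp: tan_arctan)

abbreviation RN :: "(nat \<Rightarrow> real) measure" where "RN \<equiv> PiM UNIV (\<lambda>_. borel)"

lemma seq_val_measurable [measurable]: "(\<lambda>z. seq_val z i) \<in> borel_measurable borel"
  unfolding seq_val_def bin_val_def of_bool_def by measurable

lemma seq_decode_measurable [measurable]: "seq_decode \<in> measurable borel RN"
proof -
  have "(\<lambda>z i. seq_decode z i) \<in> measurable borel RN"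
    unfolding seq_decode_def tan_def by (rule measurable_PiM_single') (auto simp: space_PiM)
  then show ?thesis by simp
qed

lemma seq_code_measurable [measurable]: "seq_code \<in> borel_measurable RN"
proof -
  have [measurable]: "Measurable.pred borel (bin_digit j)" for j
    unfolding bin_digit_def[abs_def] by measurable
  have [measurable]: "arctan \<in> borel_measurable borel"
    by (intro borel_measurable_continuous_onI continuous_intros)
  have "(\<lambda>x. seq_code x) \<in> borel_measurable RN"
    unfolding seq_code_def cantor_enc_def of_bool_def by measurable
  then show ?thesis by simp
qed

text \<open>The codes lie in [0,1], so their laws are tight on the line in any case and Helly
  selection applies to them. Encoding is highly discontinuous, but only its measurability is used;
  decoding is continuous along codes. The tightness hypothesis serves to keep the decoded limits
  finite.\<close>

theorem skorokhod_sequence_space: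
  fixes \<mu> :: "nat \<Rightarrow> (nat \<Rightarrow> real) measure"
  assumes prob: "\<And>n. prob_space (\<mu> n)" and sets[measurable_cong]: "\<And>n. sets (\<mu> n) = sets RN"
    and tight: "\<And>i e. 0 < e \<Longrightarrow> \<exists>R. \<forall>\<^sub>F n in sequentially. measure (\<mu> n) {x. \<bar>x i\<bar> > R} \<le> e"
  obtains r and \<Omega> :: "real measure" and Y :: "nat \<Rightarrow> real \<Rightarrow> nat \<Rightarrow> real" and Z :: "real \<Rightarrow> nat \<Rightarrow> real"
  where "strict_mono r" "prob_space \<Omega>" "\<And>n. Y n \<in> measurable \<Omega> RN" "Z \<in> measurable \<Omega> RN"
    "\<And>n. distr \<Omega> RN (Y n) = \<mu> (r n)" "AE w in \<Omega>. \<forall>i. (\<lambda>n. Y n w i) \<longlonglongrightarrow> Z w i"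
proof -
  define Q where "Q n = distr (\<mu> n) borel seq_code" for n
  have Q_real: "real_distribution (Q n)" for n
  proof -
    interpret prob_space "\<mu> n" by (rule prob)
    show ?thesis unfolding Q_def by (rule real_distribution_distr) measurable
  qed
  have Q_prob: "measure (Q n) {-1<..1} = 1" for n
  proof -
    interpret prob_space "\<mu> n" by (rule prob)
    have "seq_code x \<in> {-1<..1}" for x
      using cantor_enc_bounds unfolding seq_code_def by (meson greaterThanAtMost_iff less_le_trans neg_less_0_iff_less zero_less_one order.trans)
    then have "measure (Q n) {-1<..1} = measure (\<mu> n) (space (\<mu> n))"
      unfolding Q_def by (subst measure_distr) (auto intro!: arg_cong[where f="measure (\<mu> n)"])
    then show ?thesis using prob_space by simp
  qed
  have "tight Q"
    unfolding tight_def
  proof (intro conjI allI impI exI)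
    show "(-1::real) < 1" by simp
  qed (simp_all add: Q_real Q_prob)
  from tight_imp_convergent_subsubsequence[OF this strict_mono_id]
  obtain r M where r: "strict_mono r" and M: "real_distribution M" and w: "weak_conv_m (Q \<circ> id \<circ> r) M"
    by blast
  from w have "weak_conv_m (\<lambda>n. Q (r n)) M" by (simp add: comp_def)
  from Skorohod[OF Q_real M this]
  obtain \<Omega> :: "real measure" and ys y where \<Omega>: "prob_space \<Omega>"
    and ys[measurable]: "\<And>n. ys n \<in> borel_measurable \<Omega>" and dys: "\<And>n. distr \<Omega> borel (ys n) = Q (r n)"
    and "y \<in> measurable \<Omega> lborel" and conv: "\<And>w. w \<in> space \<Omega> \<Longrightarrow> (\<lambda>n. ys n w) \<longlonglongrightarrow> y w"
    by blast
  then have y[measurable]: "y \<in> borel_measurable \<Omega>" by simp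
  interpret \<Omega>: prob_space \<Omega> by fact
  have lawY: "distr \<Omega> RN (\<lambda>w. seq_decode (ys n w)) = \<mu> (r n)" for n
  proof -
    have "distr \<Omega> RN (\<lambda>w. seq_decode (ys n w)) = distr (distr \<Omega> borel (ys n)) RN seq_decode"
      by (subst distr_distr) (auto simp: comp_def)
    also have "\<dots> = distr (\<mu> (r n)) RN (\<lambda>x. x)"
      unfolding dys Q_def by (subst distr_distr) (auto simp: comp_def seq_decode_code)
    also have "\<dots> = \<mu> (r n)" by (intro distr_id2 sets[symmetric])
    finally show ?thesis .
  qed
  \<comment> \<open>Almost surely only: \<open>ys n\<close> shares the law of a code but need not be
    a code at every point.\<close>
  have "AE w in \<Omega>. \<forall>m. (cantor_shift ^^ m) (ys n w) \<in> {..1/3} \<union> {2/3..}" for n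
  proof -
    interpret \<mu>: prob_space "\<mu> (r n)" by (rule prob)
    have "AE z in Q (r n). \<forall>m. (cantor_shift ^^ m) z \<in> {..1/3} \<union> {2/3..}"
      unfolding Q_def by (subst AE_distr_iff)
        (auto simp: seq_code_def cantor_shift_pow_enc simp del: Un_iff atMost_iff atLeast_iff intro!: cantor_enc_range)
    then show ?thesis unfolding dys[symmetric] by (subst (asm) AE_distr_iff) auto
  qed
  then have rng: "AE w in \<Omega>. \<forall>n m. (cantor_shift ^^ m) (ys n w) \<in> {..1/3} \<union> {2/3..}"
    by (simp add: AE_all_countable)
  have vconv: "AE w in \<Omega>. \<forall>i. (\<lambda>n. seq_val (ys n w) i) \<longlonglongrightarrow> seq_val (y w) i"
    using rng
  proof (rule AE_mp, intro AE_I2 impI allI)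
    fix w i assume w: "w \<in> space \<Omega>" and "\<forall>n m. (cantor_shift ^^ m) (ys n w) \<in> {..1/3} \<union> {2/3..}"
    then show "(\<lambda>n. seq_val (ys n w) i) \<longlonglongrightarrow> seq_val (y w) i"
      unfolding seq_val_def by (intro bin_val_tendsto cantor_bit_eventually_eq[OF conv]) auto
  qed
  \<comment> \<open>A squeezed limit at 0 or 1 means that mass escapes to infinity. The tail bound
    passes to the limit through a continuous cut-off, so this event has probability at most
    \<open>e\<close> for every \<open>e\<close>.\<close>
  have inner: "AE w in \<Omega>. \<bar>seq_val (y w) i - 1/2\<bar> < 1/2" for i
  proof -
    let ?N = "{w \<in> space \<Omega>. \<not> \<bar>seq_val (y w) i - 1/2\<bar> < 1/2}"
    have N[measurable]: "?N \<in> sets \<Omega>" by measurable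
    have "measure \<Omega> ?N \<le> e" if e: "e > 0" for e
    proof -
      obtain R0 where R0: "\<forall>\<^sub>F n in sequentially. measure (\<mu> n) {x. \<bar>x i\<bar> > R0} \<le> e" using tight[OF e] by blast
      define R where "R = max R0 0"
      have R: "\<forall>\<^sub>F n in sequentially. measure (\<mu> n) {x. \<bar>x i\<bar> > R} \<le> e"
        using R0
      proof eventually_elim
        case (elim n)
        interpret prob_space "\<mu> n" by (rule prob)
        have sp: "space (\<mu> n) = UNIV" using sets_eq_imp_space_eq[OF sets[of n]] by (simp add: space_PiM)
        have "{x \<in> space (\<mu> n). \<bar>x i\<bar> > R0} \<in> sets (\<mu> n)" by measurable
        then have "measure (\<mu> n) {x. \<bar>x i\<bar> > R} \<le> measure (\<mu> n) {x. \<bar>x i\<bar> > R0}"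
          by (intro finite_measure_mono) (auto simp: R_def sp)
        then show ?case using elim by simp
      qed
      define a where "a = arctan R / pi"
      have a: "0 \<le> a" "a < 1/2" using arctan_scaled[of R] by (auto simp: a_def R_def)
      \<comment> \<open>A ramp that vanishes where the coordinate is at most \<open>R\<close> in
        absolute value and equals 1 at the two ends of the squeezed range. Unlike the indicator of
        the tail it is continuous.\<close>
      define \<psi> where "\<psi> v = max 0 (min 1 ((\<bar>v - 1/2\<bar> - a) / (1/2 - a)))" for v :: real
      have \<psi>c: "continuous_on UNIV \<psi>" unfolding \<psi>_def[abs_def] using a by (intro continuous_intros) auto
      then have [measurable]: "\<psi> \<in> borel_measurable borel" by (rule borel_measurable_continuous_onI)
      have \<psi>b: "\<bar>\<psi> v\<bar> \<le> 1" for v by (auto simp: \<psi>_def)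
      have lim: "(\<lambda>n. \<integral>w. \<psi> (seq_val (ys n w) i) \<partial>\<Omega>) \<longlonglongrightarrow> (\<integral>w. \<psi> (seq_val (y w) i) \<partial>\<Omega>)"
      proof (rule integral_dominated_convergence[where w="\<lambda>_. 1"])
        show "AE w in \<Omega>. (\<lambda>n. \<psi> (seq_val (ys n w) i)) \<longlonglongrightarrow> \<psi> (seq_val (y w) i)"
          using vconv
        proof (rule AE_mp, intro AE_I2 impI)
          fix w assume "\<forall>i. (\<lambda>n. seq_val (ys n w) i) \<longlonglongrightarrow> seq_val (y w) i"
          then show "(\<lambda>n. \<psi> (seq_val (ys n w) i)) \<longlonglongrightarrow> \<psi> (seq_val (y w) i)"
            by (intro continuous_on_tendsto_compose[OF \<psi>c]) auto
        qed
      qed (use \<psi>b in auto)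
      have ev: "\<forall>\<^sub>F n in sequentially. (\<integral>w. \<psi> (seq_val (ys n w) i) \<partial>\<Omega>) \<le> e"
      proof (rule eventually_mono[OF eventually_subseq[OF r R]])
        fix n assume n: "measure (\<mu> (r n)) {x. \<bar>x i\<bar> > R} \<le> e"
        interpret \<mu>: prob_space "\<mu> (r n)" by (rule prob)
        have sp: "space (\<mu> (r n)) = UNIV" using sets_eq_imp_space_eq[OF sets[of "r n"]] by (simp add: space_PiM)
        have "{x \<in> space (\<mu> (r n)). \<bar>x i\<bar> > R} \<in> sets (\<mu> (r n))" by measurable
        then have ms: "{x. \<bar>x i\<bar> > R} \<in> sets (\<mu> (r n))" by (simp add: sp)
        have "(\<integral>w. \<psi> (seq_val (ys n w) i) \<partial>\<Omega>) = (\<integral>z. \<psi> (seq_val z i) \<partial>Q (r n))"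
          unfolding dys[symmetric] by (subst integral_distr) auto
        also have "\<dots> = (\<integral>x. \<psi> (1/2 + arctan (x i) / pi) \<partial>\<mu> (r n))"
          unfolding Q_def by (subst integral_distr) (auto simp: seq_val_code)
        also have "\<dots> \<le> (\<integral>x. indicator {x. \<bar>x i\<bar> > R} x \<partial>\<mu> (r n))"
        proof (rule integral_mono')
          show "integrable (\<mu> (r n)) (\<lambda>x. indicator {x. \<bar>x i\<bar> > R} x :: real)"
            using ms by (auto simp: \<mu>.emeasure_eq_measure)
          fix x :: "nat \<Rightarrow> real"
          show "\<psi> (1/2 + arctan (x i) / pi) \<le> indicator {x. \<bar>x i\<bar> > R} x"
          proof (cases "\<bar>x i\<bar> > R")
            case True then show ?thesis using \<psi>b[of "1/2 + arctan (x i) / pi"] by simp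
          next
            case False
            then have "arctan (x i) \<le> arctan R" "arctan (-R) \<le> arctan (x i)"
              by (auto simp: arctan_le_iff)
            then have "\<bar>arctan (x i)\<bar> \<le> arctan R" by (auto simp: arctan_minus abs_le_iff)
            then have "\<bar>arctan (x i) / pi\<bar> \<le> a" by (simp add: a_def divide_right_mono)
            then have "(\<bar>1/2 + arctan (x i) / pi - 1/2\<bar> - a) / (1/2 - a) \<le> 0"
              using a by (intro divide_nonpos_pos) auto
            then have "\<psi> (1/2 + arctan (x i) / pi) = 0"
              unfolding \<psi>_def by linarith
            then show ?thesis using False by simp
          qed
        qed simp
        also have "\<dots> \<le> e" using n ms by (simp add: sp)
        finally show "(\<integral>w. \<psi> (seq_val (ys n w) i) \<partial>\<Omega>) \<le> e" .
      qed
      have "measure \<Omega> ?N = (\<integral>w. indicator ?N w \<partial>\<Omega>)" by simp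
      also have "\<dots> \<le> (\<integral>w. \<psi> (seq_val (y w) i) \<partial>\<Omega>)"
      proof (rule integral_mono)
        show "integrable \<Omega> (\<lambda>w. indicator ?N w :: real)" by (simp add: \<Omega>.emeasure_eq_measure)
        show "integrable \<Omega> (\<lambda>w. \<psi> (seq_val (y w) i))"
          using \<psi>b by (intro \<Omega>.integrable_const_bound[where B=1]) auto
        show "indicator ?N w \<le> \<psi> (seq_val (y w) i)" if "w \<in> space \<Omega>" for w
          using a by (auto simp: indicator_def \<psi>_def field_simps)
      qed
      also have "\<dots> \<le> e" by (rule tendsto_upperbound[OF lim ev]) simp
      finally show ?thesis .
    qed
    then have "measure \<Omega> ?N \<le> 0" by (rule field_le_epsilon) simp
    then have "?N \<in> null_sets \<Omega>"
      using N by (auto simp: null_sets_def \<Omega>.emeasure_eq_measure measure_le_0_iff)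
    then show ?thesis by (rule AE_I') auto
  qed
  have inner': "AE w in \<Omega>. \<forall>i. \<bar>seq_val (y w) i - 1/2\<bar> < 1/2"
    using inner by (simp add: AE_all_countable)
  have fin: "AE w in \<Omega>. \<forall>i. (\<lambda>n. seq_decode (ys n w) i) \<longlonglongrightarrow> seq_decode (y w) i"
    using vconv inner'
  proof eventually_elim
    case (elim w)
    show ?case
    proof
      fix i
      have "\<bar>pi * (seq_val (y w) i - 1/2)\<bar> < pi / 2"
        using elim(2) by (auto simp: abs_mult)
      then have "- (pi / 2) < pi * (seq_val (y w) i - 1/2)" "pi * (seq_val (y w) i - 1/2) < pi / 2"
        by linarith+
      then have "cos (pi * (seq_val (y w) i - 1/2)) \<noteq> 0"
        by (intro less_imp_neq[THEN not_sym] cos_gt_zero_pi)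
      then show "(\<lambda>n. seq_decode (ys n w) i) \<longlonglongrightarrow> seq_decode (y w) i"
        unfolding seq_decode_def
        by (intro isCont_tendsto_compose[OF isCont_tan] tendsto_intros elim(1)[rule_format])
    qed
  qed
  show ?thesis
    by (rule that[OF r \<Omega> _ _ lawY fin]) measurable
qed

section \<open>Laws of continuous paths with bounded increments\<close>

lemma paths_iff:
  "\<omega> \<in> mspace (path_metric T) \<longleftrightarrow> \<omega> \<in> extensional {0..T} \<and> continuous_on {0..T} \<omega>"
proof -
  have "compactin (top_of_set {0..T}) (topspace (top_of_set {0..T}))"
    by (simp add: compactin_subtopology)
  from compactin_mspace_cfunspace[OF this, of euclidean_metric]
  show ?thesis by (auto simp: path_metric_def)
qed

lemma path_dist_le:
  assumes "0 \<le> T" "f \<in> mspace (path_metric T)" "g \<in> mspace (path_metric T)"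
  shows "mdist (path_metric T) f g \<le> a \<longleftrightarrow> (\<forall>x\<in>{0..T}. \<bar>f x - g x\<bar> \<le> a)"
proof -
  have "topspace (top_of_set {0..T}) \<noteq> {}" using assms(1) by simp
  from cfunspace_mdist_le[OF assms(2,3)[unfolded path_metric_def] this, of a]
  show ?thesis by (simp add: path_metric_def dist_real_def del: mspace_cfunspace)
qed

lemma open_paths_subset: "{U. openin (mtopology_of (path_metric T)) U} \<subseteq> Pow (mspace (path_metric T))"
  by (rule subsetI, rule PowI, drule CollectD, drule openin_subset) (simp only: topspace_mtopology_of)

lemma space_path_borel [simp]: "space (path_borel T) = mspace (path_metric T)"
  unfolding path_borel_def by (rule space_measure_of[OF open_paths_subset])

lemma openin_path_borel: "openin (mtopology_of (path_metric T)) U \<Longrightarrow> U \<in> sets (path_borel T)"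
  unfolding path_borel_def by (subst sets_measure_of[OF open_paths_subset]) auto

text \<open>The premise is continuity for the uniform distance, written pointwise; preimages of open
  sets are then open and hence among the generators.\<close>

lemma path_functional_measurable:
  fixes X :: "(real \<Rightarrow> real) \<Rightarrow> real"
  assumes T: "0 \<le> T"
    and X: "\<And>\<omega> e. \<omega> \<in> mspace (path_metric T) \<Longrightarrow> 0 < e \<Longrightarrow>
      \<exists>d>0. \<forall>\<omega>'. (\<forall>t\<in>{0..T}. \<bar>\<omega> t - \<omega>' t\<bar> < d) \<longrightarrow> \<bar>X \<omega> - X \<omega>'\<bar> < e"
  shows "X \<in> borel_measurable (path_borel T)"
proof (rule borel_measurableI)
  fix S :: "real set" assume S: "open S"
  interpret PM: Metric_space "mspace (path_metric T)" "mdist (path_metric T)"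
    by (rule Metric_space_mspace_mdist)
  have "openin PM.mtopology {\<omega> \<in> mspace (path_metric T). X \<omega> \<in> S}"
    unfolding PM.openin_mtopology
  proof (intro conjI allI impI)
    fix \<omega> assume w: "\<omega> \<in> {\<omega> \<in> mspace (path_metric T). X \<omega> \<in> S}"
    then obtain e where e: "e > 0" "ball (X \<omega>) e \<subseteq> S" using S by (auto simp: open_contains_ball)
    obtain d where d: "d > 0" "\<And>\<omega>'. \<forall>t\<in>{0..T}. \<bar>\<omega> t - \<omega>' t\<bar> < d \<Longrightarrow> \<bar>X \<omega> - X \<omega>'\<bar> < e"
      using X[of \<omega> e] w e by blast
    have "PM.mball \<omega> d \<subseteq> {\<omega> \<in> mspace (path_metric T). X \<omega> \<in> S}"
    proof
      fix \<omega>' assume w': "\<omega>' \<in> PM.mball \<omega> d"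
      then have lt: "mdist (path_metric T) \<omega> \<omega>' < d" and P: "\<omega>' \<in> mspace (path_metric T)" by auto
      have "\<bar>\<omega> t - \<omega>' t\<bar> \<le> mdist (path_metric T) \<omega> \<omega>'" if "t \<in> {0..T}" for t
        using path_dist_le[of T \<omega> \<omega>' "mdist (path_metric T) \<omega> \<omega>'"] T w P that by auto
      then have "\<bar>X \<omega> - X \<omega>'\<bar> < e" using lt by (intro d(2)) force
      then show "\<omega>' \<in> {\<omega> \<in> mspace (path_metric T). X \<omega> \<in> S}"
        using e(2) P by (auto simp: dist_real_def subset_iff)
    qed
    then show "\<exists>r>0. PM.mball \<omega> r \<subseteq> {\<omega> \<in> mspace (path_metric T). X \<omega> \<in> S}" using d by blast
  qed auto
  then have "{\<omega> \<in> mspace (path_metric T). X \<omega> \<in> S} \<in> sets (path_borel T)"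
    by (intro openin_path_borel) (simp add: mtopology_of_def)
  then show "X -` S \<inter> space (path_borel T) \<in> sets (path_borel T)"
    by (simp add: vimage_def Int_def conj_commute)
qed

lemma path_eval_measurable:
  assumes t: "t \<in> {0..T}"
  shows "(\<lambda>\<omega>. \<omega> t) \<in> borel_measurable (path_borel T)"
  using t by (intro path_functional_measurable) auto

text \<open>A Bernstein polynomial of degree \<open>n\<close> with coefficients in multiples of
  \<open>1 / Suc n\<close>: one parameter refines both the degree and the rounding.\<close>

definition rounded_path :: "real \<Rightarrow> nat \<Rightarrow> int list \<Rightarrow> real \<Rightarrow> real" where
  "rounded_path T n xs =
     restrict (\<lambda>t. \<Sum>k\<le>n. real_of_int (xs ! k) / real (Suc n) * Bernstein n k (t / T)) {0..T}"

lemma rounded_path_in: "rounded_path T n xs \<in> mspace (path_metric T)"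
proof -
  have "continuous_on {0..T} (\<lambda>t. \<Sum>k\<le>n. real_of_int (xs ! k) / real (Suc n) * Bernstein n k (t / T))"
    unfolding Bernstein_def divide_inverse by (intro continuous_intros)
  then have "continuous_on {0..T} (rounded_path T n xs)"
    by (rule continuous_on_eq) (simp add: rounded_path_def)
  then show ?thesis
    unfolding paths_iff by (simp add: rounded_path_def)
qed

definition path_code :: "real \<Rightarrow> nat \<Rightarrow> (real \<Rightarrow> real) \<Rightarrow> int list" where
  "path_code T n \<omega> = map (\<lambda>k. \<lfloor>real (Suc n) * \<omega> (T * (k / n))\<rfloor>) [0..<Suc n]"

text \<open>The Bernstein weights are nonnegative with sum 1, so rounding the coefficients costs no
  more than rounding a single value; the rest is Bernstein's proof of the Weierstrass
  theorem.\<close>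

lemma rounded_path_tendsto:
  assumes T: "0 < T" and w: "\<omega> \<in> mspace (path_metric T)" and e: "0 < e"
  shows "\<exists>N. \<forall>n\<ge>N. mdist (path_metric T) (rounded_path T n (path_code T n \<omega>)) \<omega> < e"
proof -
  have "continuous_on {0..1} (\<lambda>x. \<omega> (T * x))"
    using w T unfolding paths_iff
    by (intro continuous_on_compose2[of "{0..T}" \<omega> "{0..1}" "\<lambda>x. T * x"])
       (auto intro!: continuous_intros simp: mult_left_le)
  from Bernstein_Weierstrass[OF this, of "e/3"] e obtain N1 where
    N1: "\<And>n x. N1 \<le> n \<Longrightarrow> x \<in> {0..1} \<Longrightarrow> \<bar>\<omega> (T * x) - (\<Sum>k\<le>n. \<omega> (T * (k / n)) * Bernstein n k x)\<bar> < e/3"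
    by auto
  obtain N2 where N2: "1 / real (Suc N2) < e/3" using e by (metis divide_pos_pos nat_approx_posE zero_less_numeral)
  show ?thesis
  proof (intro exI allI impI)
    fix n assume n: "n \<ge> max N1 N2"
    have "\<bar>rounded_path T n (path_code T n \<omega>) t - \<omega> t\<bar> \<le> 2 * e / 3" if t: "t \<in> {0..T}" for t
    proof -
      have x: "t / T \<in> {0..1}" using t T by auto
      have *: "\<bar>real_of_int (path_code T n \<omega> ! k) / Suc n - \<omega> (T * (k / n))\<bar> \<le> e/3" if "k \<le> n" for k
      proof -
        have nth: "path_code T n \<omega> ! k = \<lfloor>real (Suc n) * \<omega> (T * (k / n))\<rfloor>"
          using that unfolding path_code_def by (simp del: upt_Suc)
        have "\<bar>real_of_int (path_code T n \<omega> ! k) - real (Suc n) * \<omega> (T * (k / n))\<bar> \<le> 1"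
          unfolding nth by linarith
        then have "\<bar>real_of_int (path_code T n \<omega> ! k) - real (Suc n) * \<omega> (T * (k / n))\<bar> / Suc n \<le> 1 / Suc n"
          by (rule divide_right_mono) simp
        moreover have "\<bar>real_of_int (path_code T n \<omega> ! k) - real (Suc n) * \<omega> (T * (k / n))\<bar> / Suc n
            = \<bar>real_of_int (path_code T n \<omega> ! k) / Suc n - \<omega> (T * (k / n))\<bar>"
        proof -
          have "\<bar>real_of_int (path_code T n \<omega> ! k) - real (Suc n) * \<omega> (T * (k / n))\<bar> / Suc n
            = \<bar>(real_of_int (path_code T n \<omega> ! k) - real (Suc n) * \<omega> (T * (k / n))) / real (Suc n)\<bar>"
            by (simp only: abs_divide abs_of_nat)
          then show ?thesis by (simp add: diff_divide_distrib del: of_nat_Suc)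
        qed
        moreover have "1 / real (Suc n) \<le> 1 / real (Suc N2)" using n by (simp add: frac_le)
        ultimately show ?thesis using N2 by linarith
      qed
      have "\<bar>rounded_path T n (path_code T n \<omega>) t - (\<Sum>k\<le>n. \<omega> (T * (k / n)) * Bernstein n k (t/T))\<bar>
          = \<bar>\<Sum>k\<le>n. (real_of_int (path_code T n \<omega> ! k) / Suc n - \<omega> (T * (k / n))) * Bernstein n k (t/T)\<bar>"
        using t unfolding rounded_path_def by (simp add: sum_subtractf left_diff_distrib)
      also have "\<dots> \<le> (\<Sum>k\<le>n. \<bar>(real_of_int (path_code T n \<omega> ! k) / Suc n - \<omega> (T * (k / n))) * Bernstein n k (t/T)\<bar>)"
        by (rule sum_abs)
      also have "\<dots> \<le> (\<Sum>k\<le>n. e/3 * Bernstein n k (t/T))"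
      proof (rule sum_mono)
        fix k assume "k \<in> {..n}"
        then have "k \<le> n" by simp
        moreover have "0 \<le> Bernstein n k (t/T)" using x by (intro Bernstein_nonneg) auto
        ultimately show "\<bar>(real_of_int (path_code T n \<omega> ! k) / Suc n - \<omega> (T * (k / n))) * Bernstein n k (t/T)\<bar>
            \<le> e/3 * Bernstein n k (t/T)"
          unfolding abs_mult using mult_right_mono[OF *] by simp
      qed
      also have "\<dots> = e/3 * (\<Sum>k\<le>n. Bernstein n k (t/T))" by (rule sum_distrib_left[symmetric])
      also have "\<dots> = e/3" by simp
      finally have le: "\<bar>rounded_path T n (path_code T n \<omega>) t - (\<Sum>k\<le>n. \<omega> (T * (k / n)) * Bernstein n k (t/T))\<bar> \<le> e/3" .
      have "\<bar>\<omega> (T * (t / T)) - (\<Sum>k\<le>n. \<omega> (T * (k / n)) * Bernstein n k (t/T))\<bar> < e/3"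
        using n by (intro N1[OF _ x]) simp
      moreover have te: "T * (t / T) = t" using T by simp
      ultimately have "\<bar>\<omega> t - (\<Sum>k\<le>n. \<omega> (T * (k / n)) * Bernstein n k (t/T))\<bar> < e/3" by (simp only: te)
      then show ?thesis using le by linarith
    qed
    then have "mdist (path_metric T) (rounded_path T n (path_code T n \<omega>)) \<omega> \<le> 2 * e / 3"
      using T w by (subst path_dist_le) (auto simp: rounded_path_in)
    then show "mdist (path_metric T) (rounded_path T n (path_code T n \<omega>)) \<omega> < e" using e by linarith
  qed
qed

text \<open>
  Rounded Bernstein polynomials take countably many values, so that a limit of them is Borel without
  any appeal to separability of the path space.
\<close>

lemma measurable_into_paths:
  assumes T: "0 < T" and \<Phi>: "\<And>w. w \<in> space M \<Longrightarrow> \<Phi> w \<in> mspace (path_metric T)"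
    and meas: "\<And>t. t \<in> {0..T} \<Longrightarrow> (\<lambda>w. \<Phi> w t) \<in> borel_measurable M"
  shows "\<Phi> \<in> measurable M (path_borel T)"
  unfolding path_borel_def
proof (rule measurable_measure_of)
  show "{U. openin (mtopology_of (path_metric T)) U} \<subseteq> Pow (mspace (path_metric T))"
    by (rule open_paths_subset)
  show "\<Phi> \<in> space M \<rightarrow> mspace (path_metric T)" using \<Phi> by auto
  fix U assume "U \<in> {U. openin (mtopology_of (path_metric T)) U}"
  interpret PM: Metric_space "mspace (path_metric T)" "mdist (path_metric T)"
    by (rule Metric_space_mspace_mdist)
  have U: "openin PM.mtopology U" using \<open>U \<in> _\<close> by (simp add: mtopology_of_def)
  define app where "app n w = rounded_path T n (path_code T n (\<Phi> w))" for n w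
  have code: "(\<lambda>w. path_code T n (\<Phi> w)) \<in> measurable M (count_space UNIV)" for n
  proof (rule measurable_count_space_eq2_countable[THEN iffD2], intro conjI ballI)
    fix xs :: "int list"
    \<comment> \<open>For \<open>n = 0\<close> the only node is \<open>T * (0 / 0) = 0\<close>,
      which still lies in the interval.\<close>
    have mm: "(\<lambda>w. \<Phi> w (T * (real k / real n))) \<in> borel_measurable M" if "k < Suc n" for k
      using that T by (intro meas) (cases "n = 0"; auto simp: divide_le_eq mult_left_le)
    have "{w \<in> space M. length xs = Suc n \<and> (\<forall>k\<in>{..<Suc n}. \<lfloor>real (Suc n) * \<Phi> w (T * (real k / real n))\<rfloor> = xs ! k)} \<in> sets M"
    proof (cases "length xs = Suc n")
      case True
      have "{w \<in> space M. \<forall>k\<in>{..<Suc n}. \<lfloor>real (Suc n) * \<Phi> w (T * (real k / real n))\<rfloor> = xs ! k} \<in> sets M"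
      proof (rule sets.sets_Collect_finite_All)
        fix k assume "k \<in> {..<Suc n}"
        then have [measurable]: "(\<lambda>w. \<Phi> w (T * (real k / real n))) \<in> borel_measurable M" using mm by simp
        show "{w \<in> space M. \<lfloor>real (Suc n) * \<Phi> w (T * (real k / real n))\<rfloor> = xs ! k} \<in> sets M" by measurable
      qed simp
      then show ?thesis using True by simp
    qed simp
    also have "{w \<in> space M. length xs = Suc n \<and> (\<forall>k\<in>{..<Suc n}. \<lfloor>real (Suc n) * \<Phi> w (T * (real k / real n))\<rfloor> = xs ! k)}
       = (\<lambda>w. path_code T n (\<Phi> w)) -` {xs} \<inter> space M"
      unfolding path_code_def by (auto simp: list_eq_iff_nth_eq simp del: upt_Suc)
    finally show "(\<lambda>w. path_code T n (\<Phi> w)) -` {xs} \<inter> space M \<in> sets M" .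
  qed auto
  have app: "{w \<in> space M. app n w \<in> V} \<in> sets M" for n V
  proof -
    have "(\<lambda>w. path_code T n (\<Phi> w)) -` {xs. rounded_path T n xs \<in> V} \<inter> space M \<in> sets M"
      by (rule measurable_sets[OF code]) simp
    then show ?thesis by (simp add: app_def vimage_def Int_def conj_commute)
  qed
  \<comment> \<open>The limit of the approximations lies in the open set \<open>U\<close> iff, for
    some \<open>k\<close>, they are eventually centres of balls of radius \<open>1 / Suc k\<close>
    inside \<open>U\<close>. This expresses the preimage of \<open>U\<close> by countably many
    operations.\<close>
  define V where "V k = {c \<in> mspace (path_metric T). PM.mball c (1 / Suc k) \<subseteq> U}" for k
  have "\<Phi> -` U \<inter> space M = (\<Union>k. \<Union>N. \<Inter>n\<in>{N..}. {w \<in> space M. app n w \<in> V k})"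
  proof (intro equalityI subsetI)
    fix w assume w: "w \<in> \<Phi> -` U \<inter> space M"
    then obtain r where r: "r > 0" "PM.mball (\<Phi> w) r \<subseteq> U" using U unfolding PM.openin_mtopology by blast
    obtain k where k: "1 / real (Suc k) < r / 2" using r(1) by (metis half_gt_zero nat_approx_posE)
    obtain N where N: "\<And>n. n \<ge> N \<Longrightarrow> mdist (path_metric T) (app n w) (\<Phi> w) < r / 2"
      using rounded_path_tendsto[OF T \<Phi>, of w "r/2"] w r(1) unfolding app_def by auto
    have "app n w \<in> V k" if "n \<ge> N" for n
    proof -
      have "PM.mball (app n w) (1 / Suc k) \<subseteq> PM.mball (\<Phi> w) r"
      proof
        fix c assume c: "c \<in> PM.mball (app n w) (1 / Suc k)"
        then have "mdist (path_metric T) (\<Phi> w) c \<le> mdist (path_metric T) (\<Phi> w) (app n w) + mdist (path_metric T) (app n w) c"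
          using w \<Phi> by (intro PM.triangle) auto
        also have "\<dots> < r / 2 + r / 2"
          using N[OF that] c k by (intro add_strict_mono) (auto simp: PM.commute)
        finally show "c \<in> PM.mball (\<Phi> w) r" using c w \<Phi> by auto
      qed
      then show ?thesis using r by (auto simp: V_def app_def rounded_path_in)
    qed
    then show "w \<in> (\<Union>k. \<Union>N. \<Inter>n\<in>{N..}. {w \<in> space M. app n w \<in> V k})" using w by auto
  next
    fix w assume "w \<in> (\<Union>k. \<Union>N. \<Inter>n\<in>{N..}. {w \<in> space M. app n w \<in> V k})"
    then obtain k N where kN: "\<And>n. n \<ge> N \<Longrightarrow> w \<in> space M \<and> app n w \<in> V k" by auto
    then have w: "w \<in> space M" by blast
    obtain N' where N': "\<And>n. n \<ge> N' \<Longrightarrow> mdist (path_metric T) (app n w) (\<Phi> w) < 1 / Suc k"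
      using rounded_path_tendsto[OF T \<Phi>, of w "1 / Suc k"] w unfolding app_def by auto
    have "\<Phi> w \<in> PM.mball (app (max N N') w) (1 / Suc k)"
      using N'[of "max N N'"] \<Phi>[OF w] by (auto simp: app_def rounded_path_in)
    then show "w \<in> \<Phi> -` U \<inter> space M" using kN[of "max N N'"] w by (auto simp: V_def)
  qed
  also have "\<dots> \<in> sets M"
    by (intro sets.countable_UN sets.countable_INT' image_subsetI countableI_type) (use app in auto)
  finally show "\<Phi> -` U \<inter> space M \<in> sets M" .
qed

section \<open>Dyadic times and Kolmogorov's criterion\<close>

definition dyadics :: "real \<Rightarrow> real set" where
  "dyadics T = {T * real k / 2 ^ m | k m. k \<le> 2 ^ m}"

definition dyadic_floor :: "real \<Rightarrow> nat \<Rightarrow> real \<Rightarrow> real" where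
  "dyadic_floor T m s = T * of_int \<lfloor>s / T * 2 ^ m\<rfloor> / 2 ^ m"

lemma dyadic_floor_nat:
  assumes "0 < T" "s \<in> {0..T}"
  shows "nat \<lfloor>s / T * 2 ^ m\<rfloor> \<le> 2 ^ m" "dyadic_floor T m s = T * real (nat \<lfloor>s / T * 2 ^ m\<rfloor>) / 2 ^ m"
proof -
  have "s / T * 2 ^ m \<le> 2 ^ m" "0 \<le> s / T * 2 ^ m" using assms by (auto simp: field_simps)
  then have "\<lfloor>s / T * 2 ^ m\<rfloor> \<le> 2 ^ m" "0 \<le> \<lfloor>s / T * 2 ^ m\<rfloor>" by (auto simp: floor_le_iff)
  then show "nat \<lfloor>s / T * 2 ^ m\<rfloor> \<le> 2 ^ m" "dyadic_floor T m s = T * real (nat \<lfloor>s / T * 2 ^ m\<rfloor>) / 2 ^ m"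
    by (auto simp: dyadic_floor_def nat_le_iff)
qed

lemma dyadic_floor_in: "0 < T \<Longrightarrow> s \<in> {0..T} \<Longrightarrow> dyadic_floor T m s \<in> dyadics T"
  using dyadic_floor_nat[of T s m] unfolding dyadics_def by blast

lemma dyadics_subset: "0 < T \<Longrightarrow> dyadics T \<subseteq> {0..T}"
proof
  fix s assume T: "0 < T" and "s \<in> dyadics T"
  then obtain k m where k: "s = T * real k / 2 ^ m" "k \<le> 2 ^ m" by (auto simp: dyadics_def)
  from k(2) have "real k \<le> real (2 ^ m)" by (simp only: of_nat_le_iff)
  then have "T * real k \<le> T * 2 ^ m" using T by (intro mult_left_mono) auto
  then show "s \<in> {0..T}" using T k(1) by (simp add: divide_le_eq)
qed

lemma countable_dyadics: "countable (dyadics T)"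
proof -
  have "dyadics T \<subseteq> (\<lambda>(k, m). T * real k / 2 ^ m) ` (UNIV :: (nat \<times> nat) set)"
    by (auto simp: dyadics_def)
  then show ?thesis by (rule countable_subset) auto
qed

lemma dyadic_floor_bounds:
  assumes "0 < T" shows "dyadic_floor T m s \<le> s" "s - dyadic_floor T m s \<le> T / 2 ^ m"
proof -
  have x: "0 \<le> s / T * 2 ^ m - of_int \<lfloor>s / T * 2 ^ m\<rfloor>" "s / T * 2 ^ m - of_int \<lfloor>s / T * 2 ^ m\<rfloor> \<le> 1" by linarith+
  have e: "s - dyadic_floor T m s = T / 2 ^ m * (s / T * 2 ^ m - of_int \<lfloor>s / T * 2 ^ m\<rfloor>)"
    using assms unfolding dyadic_floor_def by (simp add: right_diff_distrib)
  have "0 \<le> s - dyadic_floor T m s" unfolding e using x(1) assms by (intro mult_nonneg_nonneg) auto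
  then show "dyadic_floor T m s \<le> s" by simp
  show "s - dyadic_floor T m s \<le> T / 2 ^ m" unfolding e using x(2) assms by (intro mult_left_le) auto
qed

lemma dyadic_floor_tendsto:
  assumes "0 < T" shows "(\<lambda>m. dyadic_floor T m s) \<longlonglongrightarrow> s"
proof (rule tendsto_sandwich)
  have "(\<lambda>m. s - T * (1/2) ^ m) \<longlonglongrightarrow> s - T * 0" by (intro tendsto_intros) simp
  then show "(\<lambda>m. s - T / 2 ^ m) \<longlonglongrightarrow> s" by (simp add: power_divide)
  show "\<forall>\<^sub>F m in sequentially. s - T / 2 ^ m \<le> dyadic_floor T m s"
    using dyadic_floor_bounds(2)[OF assms] by (auto intro!: always_eventually simp: algebra_simps)
  show "\<forall>\<^sub>F m in sequentially. dyadic_floor T m s \<le> s"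
    using dyadic_floor_bounds(1)[OF assms] by (auto intro!: always_eventually)
qed simp

lemma dyadic_floor_eventually:
  assumes T: "0 < T" and s: "s \<in> dyadics T"
  shows "\<forall>\<^sub>F m in sequentially. dyadic_floor T m s = s"
proof -
  obtain k m0 where k: "s = T * real k / 2 ^ m0" using s by (auto simp: dyadics_def)
  show ?thesis
  proof (rule eventually_sequentiallyI[of m0])
    fix m assume m: "m \<ge> m0"
    have "(2::real) ^ m = 2 ^ (m - m0) * 2 ^ m0" using m by (simp add: power_add[symmetric])
    then have "s / T * 2 ^ m = of_int (int k * 2 ^ (m - m0))" using T by (simp add: k)
    then have "\<lfloor>s / T * 2 ^ m\<rfloor> = int k * 2 ^ (m - m0)" by (simp only: floor_of_int)
    then show "dyadic_floor T m s = s"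
      unfolding dyadic_floor_def using \<open>2 ^ m = 2 ^ (m - m0) * 2 ^ m0\<close> by (simp add: k)
  qed
qed

text \<open>Consecutive dyadic floors of \<open>s\<close> coincide or are neighbours on the finer
  grid, so the values along the floors differ by a geometric sum and converge. Two times closer than
  \<open>T / 2 ^ m\<close> have equal or neighbouring floors at level \<open>m\<close>; together
  with the geometric tails this gives a modulus of continuity.\<close>

lemma dyadic_chaining:
  fixes b :: "real \<Rightarrow> real"
  assumes T: "0 < T" and \<theta>: "0 < \<theta>" "\<theta> < 1" and K: "0 \<le> K"
    and b: "\<And>m k. k < 2 ^ m \<Longrightarrow> \<bar>b (T * real (Suc k) / 2 ^ m) - b (T * real k / 2 ^ m)\<bar> \<le> K * \<theta> ^ m"
  shows "continuous_on {0..T} (\<lambda>s. lim (\<lambda>m. b (dyadic_floor T m s)))"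
    and "\<And>s. s \<in> dyadics T \<Longrightarrow> lim (\<lambda>m. b (dyadic_floor T m s)) = b s"
proof -
  show "lim (\<lambda>m. b (dyadic_floor T m s)) = b s" if "s \<in> dyadics T" for s
  proof (rule limI, rule tendsto_eventually)
    show "\<forall>\<^sub>F m in sequentially. b (dyadic_floor T m s) = b s"
      using dyadic_floor_eventually[OF T that] by eventually_elim simp
  qed
  have step: "\<bar>b (dyadic_floor T (Suc m) s) - b (dyadic_floor T m s)\<bar> \<le> K * \<theta> ^ m" if s: "s \<in> {0..T}" for s m
  proof -
    define k where "k = nat \<lfloor>s / T * 2 ^ m\<rfloor>"
    define k' where "k' = nat \<lfloor>s / T * 2 ^ Suc m\<rfloor>"
    have "\<lfloor>s / T * 2 ^ m\<rfloor> = \<lfloor>(s / T * 2 ^ Suc m) / of_int 2\<rfloor>" by simp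
    also have "\<dots> = \<lfloor>s / T * 2 ^ Suc m\<rfloor> div 2" by (rule floor_divide_real_eq_div) simp
    finally have "k = k' div 2" unfolding k_def k'_def by (simp add: nat_div_distrib)
    have e1: "dyadic_floor T m s = T * real k / 2 ^ m"
      unfolding k_def by (rule dyadic_floor_nat(2)[OF T s])
    have e2: "dyadic_floor T (Suc m) s = T * real k' / 2 ^ Suc m"
      unfolding k'_def by (rule dyadic_floor_nat(2)[OF T s])
    from \<open>k = k' div 2\<close>
    consider "k' = 2 * k" | "k' = Suc (2 * k)" by linarith
    then show ?thesis
    proof cases
      case 1
      then have "dyadic_floor T (Suc m) s = dyadic_floor T m s"
        by (simp add: e1 e2)
      then show ?thesis using K \<theta> by simp
    next
      case 2
      have "k' \<le> 2 ^ Suc m" unfolding k'_def by (rule dyadic_floor_nat(1)[OF T s])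
      then have "2 * k < 2 ^ Suc m" using 2 by simp
      from b[OF this] have "\<bar>b (T * real k' / 2 ^ Suc m) - b (T * real k / 2 ^ m)\<bar> \<le> K * \<theta> ^ Suc m"
        using 2 by simp
      also have "\<dots> \<le> K * \<theta> ^ m" using K \<theta> by (intro mult_left_mono) (auto simp: mult_left_le_one_le)
      finally show ?thesis by (simp only: e1 e2)
    qed
  qed
  have tele: "\<bar>b (dyadic_floor T (m + j) s) - b (dyadic_floor T m s)\<bar> \<le> K * \<theta> ^ m * (1 - \<theta> ^ j) / (1 - \<theta>)"
    if s: "s \<in> {0..T}" for s m j
  proof (induction j)
    case (Suc j)
    have "\<bar>b (dyadic_floor T (m + Suc j) s) - b (dyadic_floor T m s)\<bar>
        \<le> K * \<theta> ^ (m + j) + K * \<theta> ^ m * (1 - \<theta> ^ j) / (1 - \<theta>)"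
      using step[OF s, of "m + j"] Suc by simp
    also have "\<dots> = K * \<theta> ^ m * (1 - \<theta> ^ Suc j) / (1 - \<theta>)"
      using \<theta> by (simp add: field_simps power_add)
    finally show ?case .
  qed simp
  have tele': "\<bar>b (dyadic_floor T (m + j) s) - b (dyadic_floor T m s)\<bar> \<le> K * \<theta> ^ m / (1 - \<theta>)"
    if s: "s \<in> {0..T}" for s m j
  proof -
    have "K * \<theta> ^ m * (1 - \<theta> ^ j) / (1 - \<theta>) \<le> K * \<theta> ^ m * 1 / (1 - \<theta>)"
      using K \<theta> by (intro divide_right_mono mult_left_mono) auto
    then show ?thesis using tele[OF s, of m j] by simp
  qed
  have pow0: "(\<lambda>m. K' * \<theta> ^ m) \<longlonglongrightarrow> 0" for K'
    using \<theta> by (intro tendsto_mult_right_zero LIMSEQ_power_zero) auto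
  define p where "p s = lim (\<lambda>m. b (dyadic_floor T m s))" for s
  have conv: "(\<lambda>m. b (dyadic_floor T m s)) \<longlonglongrightarrow> p s" if s: "s \<in> {0..T}" for s
  proof -
    have "Cauchy (\<lambda>m. b (dyadic_floor T m s))"
    proof (rule CauchyI')
      fix e :: real assume "e > 0"
      then obtain M where M: "\<And>m. m \<ge> M \<Longrightarrow> \<bar>K / (1 - \<theta>) * \<theta> ^ m\<bar> < e"
        using pow0[of "K / (1 - \<theta>)"] by (auto simp: LIMSEQ_def dist_real_def)
      show "\<exists>M. \<forall>m\<ge>M. \<forall>n>m. dist (b (dyadic_floor T m s)) (b (dyadic_floor T n s)) < e"
      proof (intro exI allI impI)
        fix m n assume mn: "m \<ge> M" "n > m"
        then have "\<bar>b (dyadic_floor T n s) - b (dyadic_floor T m s)\<bar> \<le> K * \<theta> ^ m / (1 - \<theta>)"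
          using tele'[OF s, of m "n - m"] by simp
        also have "K * \<theta> ^ m / (1 - \<theta>) = K / (1 - \<theta>) * \<theta> ^ m" by simp
        also have "\<dots> \<le> \<bar>K / (1 - \<theta>) * \<theta> ^ m\<bar>" by (rule abs_ge_self)
        also have "\<dots> < e" by (rule M[OF mn(1)])
        finally show "dist (b (dyadic_floor T m s)) (b (dyadic_floor T n s)) < e"
          by (simp add: abs_minus_commute dist_real_def)
      qed
    qed
    then show ?thesis unfolding p_def using Cauchy_convergent convergent_LIMSEQ_iff by blast
  qed
  have close: "\<bar>p s - b (dyadic_floor T m s)\<bar> \<le> K * \<theta> ^ m / (1 - \<theta>)" if s: "s \<in> {0..T}" for s m
  proof (rule tendsto_upperbound)
    show "(\<lambda>j. \<bar>b (dyadic_floor T (j + m) s) - b (dyadic_floor T m s)\<bar>) \<longlonglongrightarrow> \<bar>p s - b (dyadic_floor T m s)\<bar>"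
      by (intro tendsto_intros LIMSEQ_ignore_initial_segment conv[OF s])
    show "\<forall>\<^sub>F j in sequentially. \<bar>b (dyadic_floor T (j + m) s) - b (dyadic_floor T m s)\<bar> \<le> K * \<theta> ^ m / (1 - \<theta>)"
    proof (rule always_eventually, rule allI)
      show "\<bar>b (dyadic_floor T (j + m) s) - b (dyadic_floor T m s)\<bar> \<le> K * \<theta> ^ m / (1 - \<theta>)" for j
        using tele'[OF s, of m j] by (simp add: add.commute[of j m])
    qed
  qed simp
  have floors: "\<bar>b (dyadic_floor T m s') - b (dyadic_floor T m s)\<bar> \<le> K * \<theta> ^ m"
    if s: "s \<in> {0..T}" "s' \<in> {0..T}" "s \<le> s'" "s' - s < T / 2 ^ m" for s s' m
  proof -
    have "s' / T * 2 ^ m - s / T * 2 ^ m < 1" "s / T * 2 ^ m \<le> s' / T * 2 ^ m"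
      using T s by (auto simp: field_simps)
    then have "\<lfloor>s' / T * 2 ^ m\<rfloor> = \<lfloor>s / T * 2 ^ m\<rfloor> \<or> \<lfloor>s' / T * 2 ^ m\<rfloor> = \<lfloor>s / T * 2 ^ m\<rfloor> + 1" by linarith
    moreover have "0 \<le> \<lfloor>s / T * 2 ^ m\<rfloor>" using T s by auto
    ultimately consider "nat \<lfloor>s' / T * 2 ^ m\<rfloor> = nat \<lfloor>s / T * 2 ^ m\<rfloor>"
      | "nat \<lfloor>s' / T * 2 ^ m\<rfloor> = Suc (nat \<lfloor>s / T * 2 ^ m\<rfloor>)" by linarith
    then show ?thesis
    proof cases
      case 1
      then have "dyadic_floor T m s' = dyadic_floor T m s"
        by (simp only: dyadic_floor_nat(2)[OF T s(1)] dyadic_floor_nat(2)[OF T s(2)])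
      then show ?thesis using K \<theta> by simp
    next
      case 2
      have "nat \<lfloor>s' / T * 2 ^ m\<rfloor> \<le> 2 ^ m" by (rule dyadic_floor_nat(1)[OF T s(2)])
      then have "nat \<lfloor>s / T * 2 ^ m\<rfloor> < 2 ^ m" using 2 by simp
      from b[OF this] show ?thesis
        by (simp only: dyadic_floor_nat(2)[OF T s(1)] dyadic_floor_nat(2)[OF T s(2)] 2)
    qed
  qed
  have modulus: "\<bar>p s' - p s\<bar> \<le> (2 * K / (1 - \<theta>) + K) * \<theta> ^ m"
    if s: "s \<in> {0..T}" "s' \<in> {0..T}" "\<bar>s' - s\<bar> < T / 2 ^ m" for s s' m
  proof -
    have "\<bar>b (dyadic_floor T m s') - b (dyadic_floor T m s)\<bar> \<le> K * \<theta> ^ m"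
      using floors[of s s' m] floors[of s' s m] s by (cases "s \<le> s'") (auto simp: abs_minus_commute)
    then have "\<bar>p s' - p s\<bar> \<le> K * \<theta> ^ m / (1 - \<theta>) + K * \<theta> ^ m / (1 - \<theta>) + K * \<theta> ^ m"
      using close[OF s(1), of m] close[OF s(2), of m] by linarith
    then show ?thesis by (simp add: algebra_simps)
  qed
  have "continuous_on {0..T} p"
    unfolding continuous_on_iff dist_real_def
  proof (intro ballI allI impI)
    fix s e :: real assume s: "s \<in> {0..T}" and e: "e > 0"
    obtain m where m: "\<bar>(2 * K / (1 - \<theta>) + K) * \<theta> ^ m\<bar> < e"
      using pow0[of "2 * K / (1 - \<theta>) + K"] e by (auto simp: LIMSEQ_def dist_real_def)
    show "\<exists>d>0. \<forall>s'\<in>{0..T}. \<bar>s' - s\<bar> < d \<longrightarrow> \<bar>p s' - p s\<bar> < e"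
      using T modulus[OF s] m by (intro exI[of _ "T / 2 ^ m"]) fastforce
  qed
  then show "continuous_on {0..T} (\<lambda>s. lim (\<lambda>m. b (dyadic_floor T m s)))" by (simp add: p_def)
qed

text \<open>The fourth powers of the increments at level \<open>m\<close>, weighted with
  \<open>(10/9) ^ (4*m)\<close>, have total expectation at most \<open>C * T^2\<close> times
  \<open>(2 * (10/9)^4 / 4) ^ m = (5000/6561) ^ m\<close>, which is summable; any weight whose
  fourth power is between 1 and 2 would do. Hence the weighted sum \<open>W\<close> is almost surely
  finite, and where it is, all increments at level \<open>m\<close> are bounded by a multiple of
  \<open>(9/10) ^ m\<close>.\<close>

theorem dyadic_Kolmogorov_continuity:
  fixes Z :: "'w \<Rightarrow> real \<Rightarrow> real"
  assumes T: "0 < T" and C: "0 \<le> C"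
    and meas: "\<And>s. s \<in> dyadics T \<Longrightarrow> (\<lambda>w. Z w s) \<in> borel_measurable M"
    and mom: "\<And>s t. s \<in> dyadics T \<Longrightarrow> t \<in> dyadics T \<Longrightarrow>
      (\<integral>\<^sup>+w. ennreal (\<bar>Z w t - Z w s\<bar> ^ 4) \<partial>M) \<le> ennreal (C * (t - s)\<^sup>2)"
  obtains \<Phi> where "\<Phi> \<in> measurable M (path_borel T)" "AE w in M. \<forall>s\<in>dyadics T. \<Phi> w s = Z w s"
proof -
  define d where "d m k w = (10/9) ^ m * \<bar>Z w (T * real (Suc k) / 2 ^ m) - Z w (T * real k / 2 ^ m)\<bar>" for m k w
  define W where "W w = (\<Sum>m. \<Sum>k<2^m. ennreal (d m k w ^ 4))" for w
  have dy: "T * real k / 2 ^ m \<in> dyadics T" if "k \<le> 2 ^ m" for k m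
    using that by (auto simp: dyadics_def)
  have dmeas[measurable]: "d m k \<in> borel_measurable M" if "k < 2 ^ m" for m k
    unfolding d_def using that by (intro borel_measurable_times borel_measurable_abs borel_measurable_diff meas dy) auto
  have Wmeas[measurable]: "W \<in> borel_measurable M"
    unfolding W_def by measurable
  have "(\<integral>\<^sup>+w. W w \<partial>M) = (\<Sum>m. \<Sum>k<2^m. (\<integral>\<^sup>+w. ennreal (d m k w ^ 4) \<partial>M))"
    unfolding W_def by (subst nn_integral_suminf; (subst nn_integral_sum)?) auto
  also have "\<dots> \<le> (\<Sum>m. ennreal (C * T\<^sup>2 * (5000/6561) ^ m))"
  proof (intro suminf_le allI)
    fix m :: nat
    have "(\<Sum>k<2^m. (\<integral>\<^sup>+w. ennreal (d m k w ^ 4) \<partial>M)) \<le> (\<Sum>k<(2::nat)^m. ennreal ((10/9)^(4*m) * (C * (T / 2 ^ m)\<^sup>2)))"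
    proof (rule sum_mono)
      fix k :: nat assume k: "k \<in> {..<2^m}"
      let ?D = "\<lambda>w. \<bar>Z w (T * real (Suc k) / 2 ^ m) - Z w (T * real k / 2 ^ m)\<bar> ^ 4"
      have [measurable]: "?D \<in> borel_measurable M"
        using k by (intro borel_measurable_power borel_measurable_abs borel_measurable_diff meas dy) auto
      have "(\<integral>\<^sup>+w. ennreal (d m k w ^ 4) \<partial>M) = (\<integral>\<^sup>+w. ennreal ((10/9)^(4*m)) * ennreal (?D w) \<partial>M)"
        by (intro nn_integral_cong) (simp add: d_def power_mult_distrib power_mult[symmetric] mult.commute ennreal_mult[symmetric])
      also have "\<dots> = ennreal ((10/9)^(4*m)) * (\<integral>\<^sup>+w. ennreal (?D w) \<partial>M)"
        by (rule nn_integral_cmult) measurable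
      also have "\<dots> \<le> ennreal ((10/9)^(4*m)) * ennreal (C * (T * real (Suc k) / 2 ^ m - T * real k / 2 ^ m)\<^sup>2)"
        using k by (intro mult_left_mono mom dy) auto
      also have "T * real (Suc k) / 2 ^ m - T * real k / 2 ^ m = T / 2 ^ m" by (simp add: field_simps)
      finally show "(\<integral>\<^sup>+w. ennreal (d m k w ^ 4) \<partial>M) \<le> ennreal ((10/9)^(4*m) * (C * (T / 2 ^ m)\<^sup>2))"
        using C by (simp add: ennreal_mult)
    qed
    also have "\<dots> = ennreal (2^m * ((10/9)^(4*m) * (C * (T / 2 ^ m)\<^sup>2)))"
      using C by (simp add: ennreal_mult ennreal_of_nat_eq_real_of_nat)
    also have "2^m * ((10/9)^(4*m) * (C * (T / 2 ^ m)\<^sup>2)) = C * T\<^sup>2 * (5000/6561) ^ m"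
    proof -
      have "(10/9::real)^(4*m) = (10000/6561)^m" unfolding power_mult by (simp add: power_divide)
      moreover have "(5000/6561::real)^m = (10000/6561)^m / 2^m" by (simp add: power_divide[symmetric])
      ultimately show ?thesis by (simp add: power2_eq_square field_simps)
    qed
    finally show "(\<Sum>k<2^m. (\<integral>\<^sup>+w. ennreal (d m k w ^ 4) \<partial>M)) \<le> ennreal (C * T\<^sup>2 * (5000/6561) ^ m)" .
  qed auto
  also have "\<dots> = ennreal (\<Sum>m. C * T\<^sup>2 * (5000/6561) ^ m)"
    using C by (intro suminf_ennreal2 summable_mult summable_geometric) auto
  also have "\<dots> < \<top>" by simp
  finally have "(\<integral>\<^sup>+w. W w \<partial>M) \<noteq> \<infinity>" by simp
  then have Wfin: "AE w in M. W w \<noteq> \<infinity>" by (intro nn_integral_PInf_AE) auto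
  \<comment> \<open>On the null set where \<open>W\<close> is infinite the zero path keeps
    \<open>\<Phi>\<close> inside the path space.\<close>
  define \<Phi> where "\<Phi> w = (if W w < \<top> then restrict (\<lambda>s. lim (\<lambda>m. Z w (dyadic_floor T m s))) {0..T}
     else restrict (\<lambda>_. 0) {0..T})" for w
  have bound: "\<bar>Z w (T * real (Suc k) / 2 ^ m) - Z w (T * real k / 2 ^ m)\<bar> \<le> (1 + enn2real (W w)) * (9/10) ^ m"
    if w: "W w < \<top>" and k: "k < 2 ^ m" for w m k
  proof -
    have "ennreal (d m k w ^ 4) \<le> (\<Sum>k<2^m. ennreal (d m k w ^ 4))"
      using k by (intro member_le_sum) auto
    also have "\<dots> = (\<Sum>m\<in>{m}. \<Sum>k<2^m. ennreal (d m k w ^ 4))" by simp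
    also have "\<dots> \<le> W w" unfolding W_def by (rule sum_le_suminf) auto
    also have "\<dots> = ennreal (enn2real (W w))" using w by simp
    finally have le: "d m k w ^ 4 \<le> enn2real (W w)" by (simp add: d_def)
    \<comment> \<open>A number above 1 is at most its fourth power, which avoids a fourth root of
      \<open>W\<close>.\<close>
    have "d m k w \<le> 1 + enn2real (W w)"
    proof (cases "d m k w \<le> 1")
      case False
      then have "d m k w ^ 1 \<le> d m k w ^ 4" by (intro power_increasing) auto
      then show ?thesis using le by simp
    qed (simp add: add_increasing2)
    then show ?thesis unfolding d_def by (simp add: power_divide field_simps)
  qed
  have Z: "continuous_on {0..T} (\<lambda>s. lim (\<lambda>m. Z w (dyadic_floor T m s)))"
      "\<And>s. s \<in> dyadics T \<Longrightarrow> lim (\<lambda>m. Z w (dyadic_floor T m s)) = Z w s" if "W w < \<top>" for w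
    using dyadic_chaining[OF T _ _ _ bound[OF that]] by auto
  have "\<Phi> \<in> measurable M (path_borel T)"
  proof (rule measurable_into_paths[OF T])
    show "\<Phi> w \<in> mspace (path_metric T)" for w
    proof (cases "W w < \<top>")
      case True
      from Z(1)[OF this] have "continuous_on {0..T} (\<Phi> w)"
        by (rule continuous_on_eq) (simp add: \<Phi>_def True)
      then show ?thesis by (simp add: paths_iff \<Phi>_def)
    next
      case False
      have "continuous_on {0..T} (\<Phi> w)"
        by (rule continuous_on_eq[OF continuous_on_const[of _ 0]]) (simp add: \<Phi>_def False)
      then show ?thesis by (simp add: paths_iff \<Phi>_def)
    qed
    fix t assume t: "t \<in> {0..T}"
    have "(\<lambda>w. lim (\<lambda>m. Z w (dyadic_floor T m t))) \<in> borel_measurable M"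
      by (rule borel_measurable_lim_metric) (rule meas[OF dyadic_floor_in[OF T t]])
    then have "(\<lambda>w. if W w < \<top> then lim (\<lambda>m. Z w (dyadic_floor T m t)) else 0) \<in> borel_measurable M" by measurable
    moreover have "(\<lambda>w. \<Phi> w t) = (\<lambda>w. if W w < \<top> then lim (\<lambda>m. Z w (dyadic_floor T m t)) else 0)"
      using t by (auto simp: \<Phi>_def)
    ultimately show "(\<lambda>w. \<Phi> w t) \<in> borel_measurable M" by simp
  qed
  moreover have "AE w in M. \<forall>s\<in>dyadics T. \<Phi> w s = Z w s"
    using Wfin
  proof eventually_elim
    case (elim w)
    then have w: "W w < \<top>" by (simp add: less_top)
    show ?case using Z(2)[OF w] dyadics_subset[OF T] w by (auto simp: \<Phi>_def)
  qed
  ultimately show ?thesis by (rule that)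
qed

section \<open>Bounded Lipschitz cylinder functions and moment bounds\<close>

text \<open>The Lipschitz condition is imposed for all functions on the line and not only for
  continuous paths. Hence the value depends on the times in \<open>F\<close> alone, and such a
  function can be evaluated at step functions and at paths known only at dyadic times.\<close>

definition cylinder :: "real set \<Rightarrow> ((real \<Rightarrow> real) \<Rightarrow> real) \<Rightarrow> bool" where
  "cylinder D X \<longleftrightarrow> (\<exists>K. \<forall>\<omega>. \<bar>X \<omega>\<bar> \<le> K) \<and>
     (\<exists>F C. finite F \<and> F \<subseteq> D \<and> (\<forall>\<omega> \<omega>'. \<bar>X \<omega> - X \<omega>'\<bar> \<le> C * (\<Sum>s\<in>F. \<bar>\<omega> s - \<omega>' s\<bar>)))"

lemma cylinderI:
  assumes "\<And>\<omega>. \<bar>X \<omega>\<bar> \<le> K" "finite F" "F \<subseteq> D"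
    "\<And>\<omega> \<omega>'. \<bar>X \<omega> - X \<omega>'\<bar> \<le> C * (\<Sum>s\<in>F. \<bar>\<omega> s - \<omega>' s\<bar>)"
  shows "cylinder D X"
  using assms unfolding cylinder_def by blast

lemma cylinderE:
  assumes "cylinder D X"
  obtains K F C where "0 \<le> K" "\<And>\<omega>. \<bar>X \<omega>\<bar> \<le> K" "finite F" "F \<subseteq> D" "1 \<le> C"
    "\<And>\<omega> \<omega>'. \<bar>X \<omega> - X \<omega>'\<bar> \<le> C * (\<Sum>s\<in>F. \<bar>\<omega> s - \<omega>' s\<bar>)"
proof -
  obtain K F C where *: "\<And>\<omega>. \<bar>X \<omega>\<bar> \<le> K" "finite F" "F \<subseteq> D"
    "\<And>\<omega> \<omega>'. \<bar>X \<omega> - X \<omega>'\<bar> \<le> C * (\<Sum>s\<in>F. \<bar>\<omega> s - \<omega>' s\<bar>)"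
    using assms unfolding cylinder_def by blast
  show ?thesis
  proof (rule that[of K F "max 1 C"])
    show "0 \<le> K" using *(1)[of undefined] by linarith
    show "\<bar>X \<omega> - X \<omega>'\<bar> \<le> max 1 C * (\<Sum>s\<in>F. \<bar>\<omega> s - \<omega>' s\<bar>)" for \<omega> \<omega>'
      by (rule order.trans[OF *(4)]) (auto intro!: mult_right_mono sum_nonneg)
  qed (use * in auto)
qed

lemma cylinder_mono: "cylinder D X \<Longrightarrow> D \<subseteq> D' \<Longrightarrow> cylinder D' X"
  unfolding cylinder_def by (meson subset_trans)

lemma cylinder_const: "cylinder D (\<lambda>_. c)"
  by (rule cylinderI[of _ "\<bar>c\<bar>" "{}" _ 0]) auto

text \<open>Boundedness confines the arguments to a compact square, where a locally Lipschitz
  operation such as multiplication is Lipschitz.\<close>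

lemma cylinder_compose:
  assumes X: "cylinder D X" and Y: "cylinder D Y"
    and g: "\<And>K. 0 \<le> K \<Longrightarrow> \<exists>B L. 0 \<le> L \<and> (\<forall>a b a' b'. \<bar>a\<bar> \<le> K \<longrightarrow> \<bar>b\<bar> \<le> K \<longrightarrow> \<bar>a'\<bar> \<le> K \<longrightarrow> \<bar>b'\<bar> \<le> K \<longrightarrow>
        \<bar>g a b\<bar> \<le> B \<and> \<bar>g a b - g a' b'\<bar> \<le> L * (\<bar>a - a'\<bar> + \<bar>b - b'\<bar>))"
  shows "cylinder D (\<lambda>\<omega>. g (X \<omega>) (Y \<omega>))"
proof -
  obtain K1 F1 C1 where 1: "0 \<le> K1" "\<And>\<omega>. \<bar>X \<omega>\<bar> \<le> K1" "finite F1" "F1 \<subseteq> D" "1 \<le> C1"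
    "\<And>\<omega> \<omega>'. \<bar>X \<omega> - X \<omega>'\<bar> \<le> C1 * (\<Sum>s\<in>F1. \<bar>\<omega> s - \<omega>' s\<bar>)" using X by (rule cylinderE) blast
  obtain K2 F2 C2 where 2: "0 \<le> K2" "\<And>\<omega>. \<bar>Y \<omega>\<bar> \<le> K2" "finite F2" "F2 \<subseteq> D" "1 \<le> C2"
    "\<And>\<omega> \<omega>'. \<bar>Y \<omega> - Y \<omega>'\<bar> \<le> C2 * (\<Sum>s\<in>F2. \<bar>\<omega> s - \<omega>' s\<bar>)" using Y by (rule cylinderE) blast
  define K where "K = max K1 K2"
  have K: "\<bar>X \<omega>\<bar> \<le> K" "\<bar>Y \<omega>\<bar> \<le> K" for \<omega>
    using 1(2)[of \<omega>] 2(2)[of \<omega>] by (auto simp: K_def)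
  obtain B L where L: "0 \<le> L" and gB: "\<And>a b a' b'. \<bar>a\<bar> \<le> K \<Longrightarrow> \<bar>b\<bar> \<le> K \<Longrightarrow> \<bar>a'\<bar> \<le> K \<Longrightarrow> \<bar>b'\<bar> \<le> K \<Longrightarrow>
        \<bar>g a b\<bar> \<le> B \<and> \<bar>g a b - g a' b'\<bar> \<le> L * (\<bar>a - a'\<bar> + \<bar>b - b'\<bar>)"
  proof -
    have "0 \<le> K" using 1(1) by (simp add: K_def)
    from g[OF this] show ?thesis using that by blast
  qed
  show ?thesis
  proof (rule cylinderI[of _ B "F1 \<union> F2" _ "L * (C1 + C2)"])
    show "\<bar>g (X \<omega>) (Y \<omega>)\<bar> \<le> B" for \<omega> using gB K by blast
    fix \<omega> \<omega>' :: "real \<Rightarrow> real"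
    let ?S = "\<lambda>F. \<Sum>s\<in>F. \<bar>\<omega> s - \<omega>' s\<bar>"
    have S: "?S F1 \<le> ?S (F1 \<union> F2)" "?S F2 \<le> ?S (F1 \<union> F2)"
      using 1(3) 2(3) by (auto intro!: sum_mono2)
    have "\<bar>g (X \<omega>) (Y \<omega>) - g (X \<omega>') (Y \<omega>')\<bar> \<le> L * (\<bar>X \<omega> - X \<omega>'\<bar> + \<bar>Y \<omega> - Y \<omega>'\<bar>)" using gB K by blast
    also have "\<dots> \<le> L * (C1 * ?S (F1 \<union> F2) + C2 * ?S (F1 \<union> F2))"
    proof (intro mult_left_mono add_mono L)
      show "\<bar>X \<omega> - X \<omega>'\<bar> \<le> C1 * ?S (F1 \<union> F2)"
        using 1(5) S(1) by (intro order.trans[OF 1(6)] mult_left_mono) auto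
      show "\<bar>Y \<omega> - Y \<omega>'\<bar> \<le> C2 * ?S (F1 \<union> F2)"
        using 2(5) S(2) by (intro order.trans[OF 2(6)] mult_left_mono) auto
    qed
    finally show "\<bar>g (X \<omega>) (Y \<omega>) - g (X \<omega>') (Y \<omega>')\<bar> \<le> L * (C1 + C2) * ?S (F1 \<union> F2)"
      by (simp add: algebra_simps)
  qed (use 1 2 in auto)
qed

lemma cylinder_add: "cylinder D X \<Longrightarrow> cylinder D Y \<Longrightarrow> cylinder D (\<lambda>\<omega>. X \<omega> + Y \<omega>)"
proof (rule cylinder_compose[where g="(+)"], assumption, assumption)
  show "\<exists>B L. 0 \<le> L \<and> (\<forall>a b a' b'. \<bar>a\<bar> \<le> K \<longrightarrow> \<bar>b\<bar> \<le> K \<longrightarrow> \<bar>a'\<bar> \<le> K \<longrightarrow> \<bar>b'\<bar> \<le> K \<longrightarrow>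
        \<bar>a + b\<bar> \<le> B \<and> \<bar>a + b - (a' + b')\<bar> \<le> L * (\<bar>a - a'\<bar> + \<bar>b - b'\<bar>))" for K :: real
    by (intro exI[of _ "2 * K"] exI[of _ 1]) (auto simp: abs_if)
qed

lemma cylinder_mult: "cylinder D X \<Longrightarrow> cylinder D Y \<Longrightarrow> cylinder D (\<lambda>\<omega>. X \<omega> * Y \<omega>)"
proof (rule cylinder_compose[where g="(*)"], assumption, assumption)
  fix K :: real assume K: "0 \<le> K"
  have "\<bar>a * b - a' * b'\<bar> \<le> K * (\<bar>a - a'\<bar> + \<bar>b - b'\<bar>)" if "\<bar>b\<bar> \<le> K" "\<bar>a'\<bar> \<le> K" for a b a' b'
  proof -
    have "a * b - a' * b' = (a - a') * b + a' * (b - b')" by (simp add: algebra_simps)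
    then have "\<bar>a * b - a' * b'\<bar> \<le> \<bar>a - a'\<bar> * \<bar>b\<bar> + \<bar>a'\<bar> * \<bar>b - b'\<bar>"
      using abs_triangle_ineq[of "(a - a') * b" "a' * (b - b')"] by (simp add: abs_mult)
    also have "\<dots> \<le> \<bar>a - a'\<bar> * K + K * \<bar>b - b'\<bar>"
      using that by (intro add_mono mult_left_mono mult_right_mono) auto
    finally show ?thesis by (simp add: algebra_simps)
  qed
  moreover have "\<bar>a * b\<bar> \<le> K * K" if "\<bar>a\<bar> \<le> K" "\<bar>b\<bar> \<le> K" for a b
    unfolding abs_mult using that K by (intro mult_mono) auto
  ultimately show "\<exists>B L. 0 \<le> L \<and> (\<forall>a b a' b'. \<bar>a\<bar> \<le> K \<longrightarrow> \<bar>b\<bar> \<le> K \<longrightarrow> \<bar>a'\<bar> \<le> K \<longrightarrow> \<bar>b'\<bar> \<le> K \<longrightarrow>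
        \<bar>a * b\<bar> \<le> B \<and> \<bar>a * b - a' * b'\<bar> \<le> L * (\<bar>a - a'\<bar> + \<bar>b - b'\<bar>))"
    using K by blast
qed

lemma cylinder_cmult: "cylinder D X \<Longrightarrow> cylinder D (\<lambda>\<omega>. c * X \<omega>)"
  by (rule cylinder_mult[OF cylinder_const])

lemma cylinder_minus: "cylinder D X \<Longrightarrow> cylinder D (\<lambda>\<omega>. - X \<omega>)"
  using cylinder_cmult[of D X "-1"] by simp

lemma cylinder_diff: "cylinder D X \<Longrightarrow> cylinder D Y \<Longrightarrow> cylinder D (\<lambda>\<omega>. X \<omega> - Y \<omega>)"
  using cylinder_add[of D X "\<lambda>\<omega>. - Y \<omega>"] cylinder_minus by simp

lemma cylinder_abs: "cylinder D X \<Longrightarrow> cylinder D (\<lambda>\<omega>. \<bar>X \<omega>\<bar>)"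
proof (rule cylinder_compose[where g="\<lambda>a b. \<bar>a\<bar>"], assumption, assumption)
  show "\<exists>B L. 0 \<le> L \<and> (\<forall>a b a' b'. \<bar>a\<bar> \<le> K \<longrightarrow> \<bar>b\<bar> \<le> K \<longrightarrow> \<bar>a'\<bar> \<le> K \<longrightarrow> \<bar>b'\<bar> \<le> K \<longrightarrow>
        \<bar>\<bar>a\<bar>\<bar> \<le> B \<and> \<bar>\<bar>a\<bar> - \<bar>a'\<bar>\<bar> \<le> L * (\<bar>a - a'\<bar> + \<bar>b - b'\<bar>))" for K :: real
    by (intro exI[of _ K] exI[of _ 1]) auto
qed

lemma cylinder_power: "cylinder D X \<Longrightarrow> cylinder D (\<lambda>\<omega>. X \<omega> ^ n)"
  by (induction n) (auto intro: cylinder_const cylinder_mult)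

lemma cylinder_sum: "(\<And>i. i \<in> I \<Longrightarrow> cylinder D (X i)) \<Longrightarrow> cylinder D (\<lambda>\<omega>. \<Sum>i\<in>I. X i \<omega>)"
  by (induction I rule: infinite_finite_induct) (auto intro: cylinder_const cylinder_add)

text \<open>An increment itself is unbounded and therefore no cylinder function; moments are taken
  of truncations, and the level \<open>K\<close> is removed only under an honest measure.\<close>

lemma cylinder_increment:
  assumes "0 \<le> K" "s \<in> D" "t \<in> D"
  shows "cylinder D (\<lambda>\<omega>. min K \<bar>\<omega> t - \<omega> s\<bar>)"
proof (rule cylinderI[of _ K "{s, t}" _ 1])
  show "\<bar>min K \<bar>\<omega> t - \<omega> s\<bar>\<bar> \<le> K" for \<omega> :: "real \<Rightarrow> real" using assms by auto
  show "\<bar>min K \<bar>\<omega> t - \<omega> s\<bar> - min K \<bar>\<omega>' t - \<omega>' s\<bar>\<bar> \<le> 1 * (\<Sum>s\<in>{s, t}. \<bar>\<omega> s - \<omega>' s\<bar>)" for \<omega> \<omega>' :: "real \<Rightarrow> real"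
  proof (cases "s = t")
    case False
    have "\<bar>min K \<bar>\<omega> t - \<omega> s\<bar> - min K \<bar>\<omega>' t - \<omega>' s\<bar>\<bar> \<le> \<bar>\<bar>\<omega> t - \<omega> s\<bar> - \<bar>\<omega>' t - \<omega>' s\<bar>\<bar>"
      by (auto simp: min_def)
    also have "\<dots> \<le> \<bar>\<omega> s - \<omega>' s\<bar> + \<bar>\<omega> t - \<omega>' t\<bar>" by linarith
    finally show ?thesis using False by simp
  qed auto
qed (use assms in auto)

lemma cylinder_coordinate:
  assumes "0 \<le> K" "t \<in> D"
  shows "cylinder D (\<lambda>\<omega>. min K \<bar>\<omega> t\<bar>)"
proof (rule cylinderI[of _ K "{t}" _ 1])
  show "\<bar>min K \<bar>\<omega> t\<bar>\<bar> \<le> K" for \<omega> :: "real \<Rightarrow> real" using assms by auto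
qed (use assms in auto)

lemma cylinder_measurable:
  assumes T: "0 \<le> T" and X: "cylinder {0..T} X"
  shows "X \<in> borel_measurable (path_borel T)"
proof (rule path_functional_measurable[OF T])
  obtain K F C where *: "0 \<le> K" "\<And>\<omega>. \<bar>X \<omega>\<bar> \<le> K" "finite F" "F \<subseteq> {0..T}" "1 \<le> C"
    "\<And>\<omega> \<omega>'. \<bar>X \<omega> - X \<omega>'\<bar> \<le> C * (\<Sum>s\<in>F. \<bar>\<omega> s - \<omega>' s\<bar>)" using X by (rule cylinderE) blast
  fix \<omega> :: "real \<Rightarrow> real" and e :: real assume e: "0 < e"
  define d where "d = e / (C * (card F + 1))"
  have d: "0 < d" using e *(5) by (simp add: d_def)
  show "\<exists>d>0. \<forall>\<omega>'. (\<forall>t\<in>{0..T}. \<bar>\<omega> t - \<omega>' t\<bar> < d) \<longrightarrow> \<bar>X \<omega> - X \<omega>'\<bar> < e"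
  proof (intro exI conjI allI impI, rule d)
    fix \<omega>' assume "\<forall>t\<in>{0..T}. \<bar>\<omega> t - \<omega>' t\<bar> < d"
    then have "(\<Sum>s\<in>F. \<bar>\<omega> s - \<omega>' s\<bar>) \<le> (\<Sum>s\<in>F. d)" using *(4) by (intro sum_mono) force
    then have "C * (\<Sum>s\<in>F. \<bar>\<omega> s - \<omega>' s\<bar>) \<le> C * (card F * d)" using *(5) by (intro mult_left_mono) auto
    also have "\<dots> < C * ((card F + 1) * d)" using *(5) d by (simp add: algebra_simps)
    also have "\<dots> = e" using *(5) by (simp add: d_def)
    finally show "\<bar>X \<omega> - X \<omega>'\<bar> < e" using *(6)[of \<omega> \<omega>'] by linarith
  qed
qed

lemma L2_set_member: "finite A \<Longrightarrow> i \<in> A \<Longrightarrow> \<bar>f i\<bar> \<le> L2_set f A"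
  using member_le_L2_set[of A i "\<lambda>i. \<bar>f i\<bar>"] by (simp add: L2_set_def)

text \<open>The grid-free description of \<open>L_ip\<close> makes it evident that it is a vector lattice.\<close>

lemma L_ip_eq:
  assumes T: "0 \<le> T"
  shows "L_ip T = Collect (cylinder {0..T})"
proof (intro equalityI subsetI CollectI)
  fix X assume "X \<in> L_ip T"
  then obtain n t \<phi> where X: "X = (\<lambda>\<omega>. \<phi> (increment t \<omega>))" and t: "time_grid T n t" and \<phi>: "bounded_Lipschitz n \<phi>"
    by (auto simp: L_ip_def)
  obtain K C where K: "\<And>x. \<bar>\<phi> x\<bar> \<le> K" and C: "\<And>x y. \<bar>\<phi> x - \<phi> y\<bar> \<le> C * L2_set (\<lambda>i. x i - y i) {..<n}"
    using \<phi> by (auto simp: bounded_Lipschitz_def)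
  have t_in: "t i \<in> {0..T}" if "i < n" for i
  proof -
    have "t 0 \<le> t i" "t i \<le> t (n - 1)"
      using t that by (auto simp: time_grid_def intro!: strict_mono_on_leD[of "{..<n}" t])
    then show ?thesis using t by (auto simp: time_grid_def)
  qed
  show "cylinder {0..T} X"
  proof (rule cylinderI[of _ K "t ` {..<n}" _ "\<bar>C\<bar> * (n * 2)"])
    fix \<omega> \<omega>' :: "real \<Rightarrow> real"
    let ?S = "\<Sum>s\<in>t ` {..<n}. \<bar>\<omega> s - \<omega>' s\<bar>"
    have term_le: "\<bar>\<omega> (t i) - \<omega>' (t i)\<bar> \<le> ?S" if "i < n" for i
      using that by (intro member_le_sum) auto
    have "\<bar>increment t \<omega> i - increment t \<omega>' i\<bar> \<le> 2 * ?S" if i: "i < n" for i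
    proof (cases "i = 0")
      case True
      then show ?thesis using term_le[of 0] i by (simp add: increment_def)
    next
      case False
      have "i - 1 < n" using i by simp
      have "\<bar>\<omega> (t i) - \<omega> (t (i - 1)) - (\<omega>' (t i) - \<omega>' (t (i - 1)))\<bar> \<le> 2 * ?S"
        using term_le[OF i] term_le[OF \<open>i - 1 < n\<close>] by linarith
      then show ?thesis using False by (simp add: increment_def)
    qed
    then have "(\<Sum>i<n. \<bar>increment t \<omega> i - increment t \<omega>' i\<bar>) \<le> (\<Sum>i<n. 2 * ?S)" by (intro sum_mono) auto
    then have le: "(\<Sum>i<n. \<bar>increment t \<omega> i - increment t \<omega>' i\<bar>) \<le> n * 2 * ?S" by simp
    have "\<bar>X \<omega> - X \<omega>'\<bar> \<le> C * L2_set (\<lambda>i. increment t \<omega> i - increment t \<omega>' i) {..<n}" unfolding X by (rule C)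
    also have "\<dots> \<le> \<bar>C\<bar> * (\<Sum>i<n. \<bar>increment t \<omega> i - increment t \<omega>' i\<bar>)"
      using L2_set_le_sum_abs by (intro mult_mono) auto
    also have "\<dots> \<le> \<bar>C\<bar> * (n * 2 * ?S)" by (intro mult_left_mono le) auto
    finally show "\<bar>X \<omega> - X \<omega>'\<bar> \<le> \<bar>C\<bar> * (n * 2) * ?S" by (simp add: algebra_simps)
  qed (use K t_in X in auto)
next
  fix X assume "X \<in> Collect (cylinder {0..T})"
  then obtain K F0 C where K: "\<And>\<omega>. \<bar>X \<omega>\<bar> \<le> K" and F0: "finite F0" "F0 \<subseteq> {0..T}" and C: "1 \<le> C"
    "\<And>\<omega> \<omega>'. \<bar>X \<omega> - X \<omega>'\<bar> \<le> C * (\<Sum>s\<in>F0. \<bar>\<omega> s - \<omega>' s\<bar>)" by (auto elim!: cylinderE)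
  \<comment> \<open>\<open>time_grid\<close> demands at least one time, while \<open>F0\<close> may
    be empty.\<close>
  define F where "F = insert 0 F0"
  have F: "finite F" "F \<subseteq> {0..T}" "F \<noteq> {}" using F0 T by (auto simp: F_def)
  have CF: "\<bar>X \<omega> - X \<omega>'\<bar> \<le> C * (\<Sum>s\<in>F. \<bar>\<omega> s - \<omega>' s\<bar>)" for \<omega> \<omega>'
    using C(1) F0 by (intro order.trans[OF C(2)] mult_left_mono sum_mono2) (auto simp: F_def)
  define n where "n = card F"
  define t where "t i = sorted_list_of_set F ! i" for i
  define idx where "idx = inv_into {..<n} t"
  have n: "n \<ge> 1" using F by (simp add: n_def card_gt_0_iff Suc_le_eq)
  have t_img: "t ` {..<n} = F"
  proof -
    have "t ` {..<n} = set (sorted_list_of_set F)"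
      unfolding t_def n_def by (auto simp: set_conv_nth)
    then show ?thesis using F(1) by simp
  qed
  have t_mono: "strict_mono_on {..<n} t"
    unfolding strict_mono_on_def t_def n_def
    using sorted_wrt_nth_less[OF strict_sorted_list_of_set[of F]] by auto
  have idx: "idx s < n" "t (idx s) = s" if "s \<in> F" for s
    using that t_img inv_into_into[of s t "{..<n}"] f_inv_into_f[of s t "{..<n}"] by (auto simp: idx_def)
  have t_in: "t i \<in> {0..T}" if "i < n" for i using that t_img F(2) by auto
  have grid: "time_grid T n t"
    unfolding time_grid_def using n t_mono t_in[of 0] t_in[of "n - 1"] by auto
  \<comment> \<open>Partial sums turn increments back into values, because the increment with index
    0 is the value at the first time.\<close>
  define \<phi> where "\<phi> x = X (\<lambda>s. \<Sum>j\<le>idx s. x j)" for x :: "nat \<Rightarrow> real"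
  have tele: "(\<Sum>j\<le>i. increment t \<omega> j) = \<omega> (t i)" for \<omega> i
    by (induction i) (auto simp: increment_def)
  have rep: "X \<omega> = \<phi> (increment t \<omega>)" for \<omega>
  proof -
    have "\<bar>X \<omega> - \<phi> (increment t \<omega>)\<bar> \<le> C * (\<Sum>s\<in>F. \<bar>\<omega> s - \<omega> (t (idx s))\<bar>)"
      unfolding \<phi>_def tele by (rule CF)
    also have "\<dots> = 0" using idx by (simp add: sum.neutral)
    finally show ?thesis by simp
  qed
  have "bounded_Lipschitz n \<phi>"
    unfolding bounded_Lipschitz_def
  proof (intro conjI exI allI)
    show "\<bar>\<phi> x\<bar> \<le> K" for x unfolding \<phi>_def by (rule K)
    fix x y :: "nat \<Rightarrow> real"
    let ?L = "L2_set (\<lambda>i. x i - y i) {..<n}"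
    have "\<bar>(\<Sum>j\<le>idx s. x j) - (\<Sum>j\<le>idx s. y j)\<bar> \<le> n * ?L" if s: "s \<in> F" for s
    proof -
      have "\<bar>(\<Sum>j\<le>idx s. x j) - (\<Sum>j\<le>idx s. y j)\<bar> \<le> (\<Sum>j\<le>idx s. \<bar>x j - y j\<bar>)"
        unfolding sum_subtractf[symmetric] by (rule sum_abs)
      also have "\<dots> \<le> (\<Sum>j<n. \<bar>x j - y j\<bar>)"
        using idx(1)[OF s] by (intro sum_mono2) auto
      also have "\<dots> \<le> (\<Sum>j<n. ?L)"
        using L2_set_member[of "{..<n}" _ "\<lambda>i. x i - y i"] by (intro sum_mono) auto
      finally show ?thesis by simp
    qed
    then have le: "(\<Sum>s\<in>F. \<bar>(\<Sum>j\<le>idx s. x j) - (\<Sum>j\<le>idx s. y j)\<bar>) \<le> (\<Sum>s\<in>F. n * ?L)"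
      by (intro sum_mono)
    have "\<bar>\<phi> x - \<phi> y\<bar> \<le> C * (\<Sum>s\<in>F. \<bar>(\<Sum>j\<le>idx s. x j) - (\<Sum>j\<le>idx s. y j)\<bar>)"
      unfolding \<phi>_def by (rule CF)
    also have "\<dots> \<le> C * (\<Sum>s\<in>F. n * ?L)" using C(1) by (intro mult_left_mono le) auto
    finally show "\<bar>\<phi> x - \<phi> y\<bar> \<le> C * (card F * n) * ?L" by (simp add: algebra_simps)
  qed
  then show "X \<in> L_ip T" unfolding L_ip_def using grid rep by blast
qed

lemma dominated_eq:
  assumes "0 \<le> T"
  shows "dominated_on_L_ip T Ehat =
    {P. prob_space P \<and> sets P = sets (path_borel T) \<and> (\<forall>X. cylinder {0..T} X \<longrightarrow> integral\<^sup>L P X \<le> Ehat X)}"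
  unfolding dominated_on_L_ip_def L_ip_eq[OF assms] by auto

lemma upper_expectation_ge: "P \<in> Q \<Longrightarrow> (\<integral>\<^sup>+\<omega>. ennreal (X \<omega>) \<partial>P) \<le> upper_expectation Q X"
  unfolding upper_expectation_def by (rule SUP_upper)

lemma cylinder_integrable:
  assumes "0 \<le> T" "prob_space P" "sets P = sets (path_borel T)" "cylinder {0..T} X"
  shows "integrable P X"
proof -
  interpret prob_space P by fact
  obtain K where "\<And>\<omega>. \<bar>X \<omega>\<bar> \<le> K" using assms(4) by (auto simp: cylinder_def)
  moreover have "X \<in> borel_measurable P"
    using cylinder_measurable[OF assms(1,4)] measurable_cong_sets[OF assms(3) refl] by auto
  ultimately show ?thesis by (intro integrable_const_bound[where B=K]) auto
qed

text \<open>A cylinder function is represented by the constant sequence at itself, which gives one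
  inclusion. Conversely, \<open>LG_represents\<close> bounds the mean of \<open>|X - Xs n|\<close>
  under every dominated measure, in particular under \<open>P\<close>, so the inequality for
  \<open>Xs n\<close> passes to the limit whatever the representing sequence is.\<close>

lemma G_measures_eq:
  assumes T: "0 \<le> T" and E0: "Ehat (\<lambda>_. 0) = 0"
  shows "G_measures T Ehat = dominated_on_L_ip T Ehat"
proof (intro equalityI subsetI)
  fix P assume P: "P \<in> G_measures T Ehat"
  have "integral\<^sup>L P X \<le> Ehat X" if X: "cylinder {0..T} X" for X
  proof -
    have "LG_represents T Ehat 1 X (\<lambda>_. X)"
      unfolding LG_represents_def
    proof -
      have "(SUP P\<in>Q. (0::ennreal)) = 0" for Q :: "(real \<Rightarrow> real) measure set"
        by (cases "Q = {}") (auto simp: bot_ennreal)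
      then show "X \<in> borel_measurable (path_borel T) \<and> (\<forall>n::nat. X \<in> L_ip T) \<and>
          (\<forall>e>0. \<exists>N. \<forall>m\<ge>N::nat. \<forall>n\<ge>N::nat. root 1 (Ehat (\<lambda>\<omega>. \<bar>X \<omega> - X \<omega>\<bar> ^ 1)) < e) \<and>
          (\<lambda>n. upper_expectation (dominated_on_L_ip T Ehat) (\<lambda>\<omega>. \<bar>X \<omega> - X \<omega>\<bar> ^ 1)) \<longlonglongrightarrow> 0"
        using cylinder_measurable[OF T X] X E0 by (simp add: L_ip_eq[OF T] upper_expectation_def)
    qed
    then have "X \<in> LG T Ehat 1" "Ehat_extension T Ehat X (Ehat X)"
      unfolding LG_def Ehat_extension_def by auto
    then show ?thesis using P unfolding G_measures_def by blast
  qed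
  then show "P \<in> dominated_on_L_ip T Ehat" using P unfolding dominated_eq[OF T] G_measures_def by auto
next
  fix P assume P: "P \<in> dominated_on_L_ip T Ehat"
  then have pP: "prob_space P" and sP[measurable_cong]: "sets P = sets (path_borel T)"
    and dP: "\<And>X. cylinder {0..T} X \<Longrightarrow> integral\<^sup>L P X \<le> Ehat X"
    by (auto simp: dominated_eq[OF T])
  have "integral\<^sup>L P X \<le> r" if "Ehat_extension T Ehat X r" for X r
  proof -
    obtain Xs where X[measurable]: "X \<in> borel_measurable (path_borel T)"
      and Xs: "\<And>n. cylinder {0..T} (Xs n)"
      and u: "(\<lambda>n. upper_expectation (dominated_on_L_ip T Ehat) (\<lambda>\<omega>. \<bar>X \<omega> - Xs n \<omega>\<bar> ^ 1)) \<longlonglongrightarrow> 0"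
      and r: "(\<lambda>n. Ehat (Xs n)) \<longlonglongrightarrow> r"
      using \<open>Ehat_extension T Ehat X r\<close> unfolding Ehat_extension_def LG_represents_def L_ip_eq[OF T] by auto
    define v where "v n = upper_expectation (dominated_on_L_ip T Ehat) (\<lambda>\<omega>. \<bar>X \<omega> - Xs n \<omega>\<bar>)" for n
    have v: "v \<longlonglongrightarrow> 0" using u by (simp add: v_def[abs_def])
    \<comment> \<open>The conversion to reals sends infinity to 0, so finiteness has to be recorded
      separately.\<close>
    have vfin: "\<forall>\<^sub>F n in sequentially. v n < \<top>" using v by (rule order_tendstoD) simp
    have v': "(\<lambda>n. enn2real (v n)) \<longlonglongrightarrow> 0" by (rule tendsto_enn2real) (use v in simp_all)
    have Xs_m[measurable]: "Xs n \<in> borel_measurable (path_borel T)" for n by (rule cylinder_measurable[OF T Xs])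
    show ?thesis
    proof (rule tendsto_lowerbound)
      show "(\<lambda>n. Ehat (Xs n) + enn2real (v n)) \<longlonglongrightarrow> r" using tendsto_add[OF r v'] by simp
      show "\<forall>\<^sub>F n in sequentially. integral\<^sup>L P X \<le> Ehat (Xs n) + enn2real (v n)"
        using vfin
      proof eventually_elim
        case (elim n)
        have le: "(\<integral>\<^sup>+\<omega>. ennreal \<bar>X \<omega> - Xs n \<omega>\<bar> \<partial>P) \<le> v n"
          unfolding v_def by (rule upper_expectation_ge[OF P])
        have i1: "integrable P (\<lambda>\<omega>. X \<omega> - Xs n \<omega>)"
          by (rule integrableI_bounded) (use le elim in \<open>auto intro: le_less_trans\<close>)
        have i2: "integrable P (Xs n)" by (rule cylinder_integrable[OF T pP sP Xs])
        have i3: "integrable P X" using Bochner_Integration.integrable_add[OF i1 i2] by simp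
        have "integral\<^sup>L P X = (\<integral>\<omega>. X \<omega> - Xs n \<omega> \<partial>P) + integral\<^sup>L P (Xs n)"
          using i1 i2 i3 by (subst Bochner_Integration.integral_diff) auto
        also have "(\<integral>\<omega>. X \<omega> - Xs n \<omega> \<partial>P) \<le> (\<integral>\<omega>. \<bar>X \<omega> - Xs n \<omega>\<bar> \<partial>P)"
          using i1 by (intro integral_mono) auto
        also have "\<dots> \<le> enn2real (v n)"
          using le elim i1 by (subst integral_eq_nn_integral) (auto intro!: enn2real_mono)
        finally show ?case using dP[OF Xs[of n]] by linarith
      qed
    qed simp
  qed
  then show "P \<in> G_measures T Ehat" using pP sP unfolding G_measures_def by auto
qed

section \<open>Fourth moments of increments under the G-expectation\<close>

lemma power4_diff:
  fixes a b :: real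
  assumes "0 \<le> a" "0 \<le> b"
  shows "\<bar>a ^ 4 - b ^ 4\<bar> \<le> 4 * (a ^ 3 + b ^ 3) * \<bar>a - b\<bar>"
proof -
  have "(a + b) * (a\<^sup>2 + b\<^sup>2) \<le> 4 * (a ^ 3 + b ^ 3)"
  proof (cases "a \<le> b")
    case True
    then have "(a + b) * (a\<^sup>2 + b\<^sup>2) \<le> (b + b) * (b\<^sup>2 + b\<^sup>2)"
      using assms by (intro mult_mono add_mono power_mono) auto
    also have "\<dots> = 4 * b ^ 3" by (simp add: power2_eq_square power3_eq_cube)
    also have "\<dots> \<le> 4 * (a ^ 3 + b ^ 3)" using zero_le_power[OF assms(1), of 3] by simp
    finally show ?thesis .
  next
    case False
    then have "(a + b) * (a\<^sup>2 + b\<^sup>2) \<le> (a + a) * (a\<^sup>2 + a\<^sup>2)"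
      using assms by (intro mult_mono add_mono power_mono) auto
    also have "\<dots> = 4 * a ^ 3" by (simp add: power2_eq_square power3_eq_cube)
    also have "\<dots> \<le> 4 * (a ^ 3 + b ^ 3)" using zero_le_power[OF assms(2), of 3] by simp
    finally show ?thesis .
  qed
  moreover have "a ^ 4 - b ^ 4 = (a + b) * (a\<^sup>2 + b\<^sup>2) * (a - b)" by algebra
  moreover have "0 \<le> (a + b) * (a\<^sup>2 + b\<^sup>2)" using assms by auto
  ultimately show ?thesis by (simp add: abs_mult mult_right_mono)
qed

lemma truncated_power4_Lipschitz:
  fixes u v :: real
  assumes "0 \<le> K"
  shows "\<bar>(min K \<bar>u\<bar>) ^ 4 - (min K \<bar>v\<bar>) ^ 4\<bar> \<le> 8 * K ^ 3 * \<bar>u - v\<bar>"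
proof -
  have "(min K \<bar>u\<bar>) ^ 3 \<le> K ^ 3" "(min K \<bar>v\<bar>) ^ 3 \<le> K ^ 3" using assms by (auto intro!: power_mono)
  then have "4 * ((min K \<bar>u\<bar>) ^ 3 + (min K \<bar>v\<bar>) ^ 3) \<le> 4 * (K ^ 3 + K ^ 3)"
    by (intro mult_left_mono add_mono) auto
  also have "\<dots> = 8 * K ^ 3" by simp
  finally have "4 * ((min K \<bar>u\<bar>) ^ 3 + (min K \<bar>v\<bar>) ^ 3) \<le> 8 * K ^ 3" .
  then have "4 * ((min K \<bar>u\<bar>) ^ 3 + (min K \<bar>v\<bar>) ^ 3) * \<bar>min K \<bar>u\<bar> - min K \<bar>v\<bar>\<bar> \<le> 8 * K ^ 3 * \<bar>u - v\<bar>"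
  proof (rule mult_mono)
    show "\<bar>min K \<bar>u\<bar> - min K \<bar>v\<bar>\<bar> \<le> \<bar>u - v\<bar>" by (auto simp: min_def)
  qed (use assms in auto)
  then show ?thesis by (rule order.trans[OF power4_diff, rotated 2]) (use assms in auto)
qed

lemma sublinear_mono:
  assumes "sublinear_expectation S H E" "X \<in> H" "Y \<in> H" "\<And>w. w \<in> S \<Longrightarrow> X w \<le> Y w"
  shows "E X \<le> E Y"
proof -
  have "\<forall>X\<in>H. \<forall>Y\<in>H. (\<forall>w\<in>S. X w \<le> Y w) \<longrightarrow> E X \<le> E Y"
    using assms(1) unfolding sublinear_expectation_def by (elim conjE)
  from bspec[OF bspec[OF this assms(2)] assms(3)] show ?thesis
    by (rule mp) (rule ballI, rule assms(4))
qed

lemma sublinear_const: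
  assumes "sublinear_expectation S H E"
  shows "E (\<lambda>_. c) = c"
proof -
  have "\<forall>c. E (\<lambda>_. c) = c" using assms unfolding sublinear_expectation_def by (elim conjE)
  then show ?thesis ..
qed

lemma sublinear_add:
  assumes "sublinear_expectation S H E" "X \<in> H" "Y \<in> H"
  shows "E (\<lambda>w. X w + Y w) \<le> E X + E Y"
proof -
  have "\<forall>X\<in>H. \<forall>Y\<in>H. E (\<lambda>w. X w + Y w) \<le> E X + E Y"
    using assms(1) unfolding sublinear_expectation_def by (elim conjE)
  from bspec[OF bspec[OF this assms(2)] assms(3)] show ?thesis .
qed

lemma sublinear_scale:
  assumes "sublinear_expectation S H E" "X \<in> H" "0 \<le> a"
  shows "E (\<lambda>w. a * X w) = a * E X"
proof -
  have "\<forall>X\<in>H. \<forall>a\<ge>0. E (\<lambda>w. a * X w) = a * E X"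
    using assms(1) unfolding sublinear_expectation_def by (elim conjE)
  from spec[OF bspec[OF this assms(2)], of a] show ?thesis using assms(3) by (rule mp)
qed

text \<open>The properties of the G-expectation on which existence and compactness rest.
  \<open>moment_value\<close> gives tightness at a fixed time and \<open>moment_increment\<close>
  feeds Kolmogorov's criterion; the squares are Brownian scaling, as the fourth moment of
  \<open>sqrt a\<close> times a variable is \<open>a^2\<close> times that of the variable.\<close>

locale moment_expectation =
  fixes T :: real and Ehat :: "((real \<Rightarrow> real) \<Rightarrow> real) \<Rightarrow> real" and C :: real
  assumes T: "0 < T" and C: "0 \<le> C"
    and sublinear: "sublinear_expectation (mspace (path_metric T)) (Collect (cylinder {0..T})) Ehat"
    and moment_increment: "\<And>s t K. s \<in> {0..T} \<Longrightarrow> t \<in> {0..T} \<Longrightarrow> 0 \<le> K \<Longrightarrow>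
      Ehat (\<lambda>\<omega>. (min K \<bar>\<omega> t - \<omega> s\<bar>) ^ 4) \<le> C * (t - s)\<^sup>2"
    and moment_value: "\<And>t K. t \<in> {0..T} \<Longrightarrow> 0 \<le> K \<Longrightarrow> Ehat (\<lambda>\<omega>. (min K \<bar>\<omega> t\<bar>) ^ 4) \<le> C * t\<^sup>2"

text \<open>The fourth power belongs to the class of test functions, so its expectation is a real
  number; the value need not be computed. The truncated moment is compared with it by monotonicity
  and positive homogeneity.\<close>

lemma scaled_moment_bound:
  fixes x :: "nat \<Rightarrow> 'w \<Rightarrow> real"
  assumes sp: "sublinear_expectation_space H E" and x: "\<And>i. i \<le> j \<Longrightarrow> x i \<in> H"
    and a: "0 \<le> a" and K: "0 \<le> K"
  shows "E (\<lambda>w. (min K \<bar>sqrt a * x j w\<bar>) ^ 4) \<le> E (\<lambda>w. (x j w) ^ 4) * a\<^sup>2"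
proof -
  have closed: "\<And>n \<phi> X. local_Lipschitz_poly n \<phi> \<Longrightarrow> (\<And>i. i < n \<Longrightarrow> X i \<in> H) \<Longrightarrow> (\<lambda>w. \<phi> (\<lambda>i. X i w)) \<in> H"
    and sub: "sublinear_expectation UNIV H E"
    using sp unfolding sublinear_expectation_space_def by auto
  have mem: "\<bar>y j - z j\<bar> \<le> L2_set (\<lambda>i. y i - z i) {..<Suc j}" "\<bar>y j\<bar> \<le> L2_set y {..<Suc j}" for y z :: "nat \<Rightarrow> real"
    by (intro L2_set_member[of _ j "\<lambda>i. y i - z i"] L2_set_member[of _ j y]; simp)+
  have q: "local_Lipschitz_poly (Suc j) (\<lambda>y. (y j) ^ 4)"
    unfolding local_Lipschitz_poly_def
  proof (intro exI allI)
    fix y z :: "nat \<Rightarrow> real"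
    let ?n = "\<lambda>y. L2_set y {..<Suc j}"
    have "\<bar>(y j) ^ 4 - (z j) ^ 4\<bar> = \<bar>\<bar>y j\<bar> ^ 4 - \<bar>z j\<bar> ^ 4\<bar>" by simp
    also have "\<dots> \<le> 4 * (\<bar>y j\<bar> ^ 3 + \<bar>z j\<bar> ^ 3) * \<bar>\<bar>y j\<bar> - \<bar>z j\<bar>\<bar>" by (rule power4_diff) auto
    also have "\<dots> \<le> 4 * (1 + ?n y ^ 3 + ?n z ^ 3) * ?n (\<lambda>i. y i - z i)"
    proof (intro mult_mono mult_left_mono)
      show "\<bar>y j\<bar> ^ 3 + \<bar>z j\<bar> ^ 3 \<le> 1 + ?n y ^ 3 + ?n z ^ 3"
        using power_mono[OF mem(2), of y 3] power_mono[OF mem(2), of z 3] by linarith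
      show "\<bar>\<bar>y j\<bar> - \<bar>z j\<bar>\<bar> \<le> ?n (\<lambda>i. y i - z i)" using mem(1)[of y z] by linarith
    qed (auto intro!: add_nonneg_nonneg zero_le_power L2_set_nonneg)
    finally show "\<bar>(y j) ^ 4 - (z j) ^ 4\<bar> \<le> 4 * (1 + ?n y ^ 3 + ?n z ^ 3) * ?n (\<lambda>i. y i - z i)" .
  qed
  have tr: "local_Lipschitz_poly (Suc j) (\<lambda>y. (min K \<bar>sqrt a * y j\<bar>) ^ 4)"
    unfolding local_Lipschitz_poly_def
  proof (intro exI allI)
    fix y z :: "nat \<Rightarrow> real"
    let ?n = "\<lambda>y. L2_set y {..<Suc j}"
    have "\<bar>(min K \<bar>sqrt a * y j\<bar>) ^ 4 - (min K \<bar>sqrt a * z j\<bar>) ^ 4\<bar> \<le> 8 * K ^ 3 * \<bar>sqrt a * y j - sqrt a * z j\<bar>"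
      by (rule truncated_power4_Lipschitz[OF K])
    also have "\<dots> = 8 * K ^ 3 * sqrt a * \<bar>y j - z j\<bar>"
      using a by (simp add: abs_mult right_diff_distrib[symmetric])
    \<comment> \<open>The factor 3 is the growth weight of \<open>local_Lipschitz_poly\<close> with
      exponent 0.\<close>
    also have "\<dots> \<le> 8 * K ^ 3 * sqrt a * (3 * ?n (\<lambda>i. y i - z i))"
      using a K mem(1)[of y z] L2_set_nonneg[of "\<lambda>i. y i - z i" "{..<Suc j}"] by (intro mult_left_mono) auto
    finally show "\<bar>(min K \<bar>sqrt a * y j\<bar>) ^ 4 - (min K \<bar>sqrt a * z j\<bar>) ^ 4\<bar> \<le>
        8 * K ^ 3 * sqrt a * (1 + ?n y ^ 0 + ?n z ^ 0) * ?n (\<lambda>i. y i - z i)" by simp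
  qed
  have qH: "(\<lambda>w. (x j w) ^ 4) \<in> H" using closed[OF q, of x] x by simp
  have trH: "(\<lambda>w. (min K \<bar>sqrt a * x j w\<bar>) ^ 4) \<in> H" using closed[OF tr, of x] x by simp
  have q': "local_Lipschitz_poly 1 (\<lambda>y. a\<^sup>2 * y 0)"
    unfolding local_Lipschitz_poly_def
  proof (intro exI allI)
    fix y z :: "nat \<Rightarrow> real"
    have "\<bar>a\<^sup>2 * y 0 - a\<^sup>2 * z 0\<bar> = a\<^sup>2 * \<bar>y 0 - z 0\<bar>" by (simp add: abs_mult right_diff_distrib[symmetric])
    also have "\<dots> \<le> a\<^sup>2 * (3 * L2_set (\<lambda>i. y i - z i) {..<1})"
      using L2_set_member[of "{..<1}" 0 "\<lambda>i. y i - z i"] by (intro mult_left_mono) auto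
    finally show "\<bar>a\<^sup>2 * y 0 - a\<^sup>2 * z 0\<bar> \<le> a\<^sup>2 * (1 + L2_set y {..<1} ^ 0 + L2_set z {..<1} ^ 0) * L2_set (\<lambda>i. y i - z i) {..<1}"
      by simp
  qed
  have aqH: "(\<lambda>w. a\<^sup>2 * (x j w) ^ 4) \<in> H" using closed[OF q', of "\<lambda>_ w. (x j w) ^ 4"] qH by simp
  have "E (\<lambda>w. (min K \<bar>sqrt a * x j w\<bar>) ^ 4) \<le> E (\<lambda>w. a\<^sup>2 * (x j w) ^ 4)"
  proof -
    have "(min K \<bar>sqrt a * x j w\<bar>) ^ 4 \<le> a\<^sup>2 * (x j w) ^ 4" for w
    proof -
      have "(min K \<bar>sqrt a * x j w\<bar>) ^ 4 \<le> \<bar>sqrt a * x j w\<bar> ^ 4" using K by (intro power_mono) auto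
      also have "\<dots> = (sqrt a ^ 2) ^ 2 * (x j w) ^ 4"
        by (simp add: power_mult_distrib power_even_abs power_mult[symmetric])
      finally show ?thesis using a by simp
    qed
    then show ?thesis by (intro sublinear_mono[OF sub trH aqH])
  qed
  also have "\<dots> = a\<^sup>2 * E (\<lambda>w. (x j w) ^ 4)"
    by (rule sublinear_scale[OF sub qH]) simp
  finally show ?thesis by (simp add: mult.commute)
qed

text \<open>A value is coordinate 0 on the grid with the single time \<open>t\<close>, an increment
  is coordinate 1 on the grid \<open>s < t\<close>; hence the constant is a maximum of two fourth
  moments, and 0 is added to make it nonnegative.\<close>

lemma G_expectation_moments:
  assumes T: "0 < T" and G: "G_expectation T \<sigma>lo \<sigma>hi H E x Ehat"
  shows "\<exists>C. moment_expectation T Ehat C"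
proof -
  note G' = G[unfolded G_expectation_def]
  have sp: "sublinear_expectation_space H E" using G' by (elim conjE)
  have "\<forall>i. G_normal H E \<sigma>lo \<sigma>hi (x i)" using G' by (elim conjE)
  then have x: "x i \<in> H" for i unfolding G_normal_def by blast
  have sub: "sublinear_expectation (mspace (path_metric T)) (L_ip T) Ehat" using G' by (elim conjE)
  have Eh': "\<forall>n t \<phi>. time_grid T n t \<longrightarrow> bounded_Lipschitz n \<phi> \<longrightarrow>
        Ehat (\<lambda>\<omega>. \<phi> (increment t \<omega>)) = E (\<lambda>w. \<phi> (\<lambda>i. sqrt (time_step t i) * x i w))"
    using G' by (elim conjE)
  have Eh: "Ehat (\<lambda>\<omega>. \<phi> (increment t \<omega>)) = E (\<lambda>w. \<phi> (\<lambda>i. sqrt (time_step t i) * x i w))"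
    if "time_grid T n t" "bounded_Lipschitz n \<phi>" for n t \<phi>
    using Eh' that by blast
  define C where "C = max 0 (max (E (\<lambda>w. x 0 w ^ 4)) (E (\<lambda>w. x 1 w ^ 4)))"
  have C: "0 \<le> C" by (simp add: C_def)
  have lip: "bounded_Lipschitz (Suc j) (\<lambda>y. (min K \<bar>y j\<bar>) ^ 4)" if K: "0 \<le> K" for j K
    unfolding bounded_Lipschitz_def
  proof (intro conjI exI allI)
    fix y z :: "nat \<Rightarrow> real"
    show "\<bar>(min K \<bar>y j\<bar>) ^ 4\<bar> \<le> K ^ 4" using K by (auto intro!: power_mono)
    have "\<bar>(min K \<bar>y j\<bar>) ^ 4 - (min K \<bar>z j\<bar>) ^ 4\<bar> \<le> 8 * K ^ 3 * \<bar>y j - z j\<bar>"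
      by (rule truncated_power4_Lipschitz[OF K])
    also have "\<dots> \<le> 8 * K ^ 3 * L2_set (\<lambda>i. y i - z i) {..<Suc j}"
      using K L2_set_member[of "{..<Suc j}" j "\<lambda>i. y i - z i"] by (intro mult_left_mono) auto
    finally show "\<bar>(min K \<bar>y j\<bar>) ^ 4 - (min K \<bar>z j\<bar>) ^ 4\<bar> \<le> 8 * K ^ 3 * L2_set (\<lambda>i. y i - z i) {..<Suc j}" .
  qed
  have val: "Ehat (\<lambda>\<omega>. (min K \<bar>\<omega> t\<bar>) ^ 4) \<le> C * t\<^sup>2" if t: "t \<in> {0..T}" and K: "0 \<le> K" for t K
  proof -
    have "time_grid T 1 (\<lambda>_. t)" using t by (auto simp: time_grid_def strict_mono_on_def)
    from Eh[OF this, of "\<lambda>y. (min K \<bar>y 0\<bar>) ^ 4"] lip[OF K, of 0]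
    have "Ehat (\<lambda>\<omega>. (min K \<bar>\<omega> t\<bar>) ^ 4) = E (\<lambda>w. (min K \<bar>sqrt t * x 0 w\<bar>) ^ 4)"
      by (simp add: increment_def time_step_def)
    also have "\<dots> \<le> E (\<lambda>w. x 0 w ^ 4) * t\<^sup>2" using t K x by (intro scaled_moment_bound[OF sp]) auto
    also have "\<dots> \<le> C * t\<^sup>2" by (intro mult_right_mono) (auto simp: C_def)
    finally show ?thesis .
  qed
  have inc': "Ehat (\<lambda>\<omega>. (min K \<bar>\<omega> t - \<omega> s\<bar>) ^ 4) \<le> C * (t - s)\<^sup>2"
    if st: "s \<in> {0..T}" "t \<in> {0..T}" "s < t" and K: "0 \<le> K" for s t K
  proof -
    have "time_grid T 2 (\<lambda>i. if i = 0 then s else t)" using st by (auto simp: time_grid_def strict_mono_on_def)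
    from Eh[OF this, of "\<lambda>y. (min K \<bar>y 1\<bar>) ^ 4"] lip[OF K, of 1]
    have "Ehat (\<lambda>\<omega>. (min K \<bar>\<omega> t - \<omega> s\<bar>) ^ 4) = E (\<lambda>w. (min K \<bar>sqrt (t - s) * x 1 w\<bar>) ^ 4)"
      by (simp add: increment_def time_step_def numeral_2_eq_2)
    also have "\<dots> \<le> E (\<lambda>w. x 1 w ^ 4) * (t - s)\<^sup>2" using st K x by (intro scaled_moment_bound[OF sp]) auto
    also have "\<dots> \<le> C * (t - s)\<^sup>2" by (intro mult_right_mono) (auto simp: C_def)
    finally show ?thesis .
  qed
  have inc: "Ehat (\<lambda>\<omega>. (min K \<bar>\<omega> t - \<omega> s\<bar>) ^ 4) \<le> C * (t - s)\<^sup>2"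
    if st: "s \<in> {0..T}" "t \<in> {0..T}" and K: "0 \<le> K" for s t K
  proof (cases s t rule: linorder_cases)
    case less then show ?thesis using inc' st K by blast
  next
    case equal
    have "Ehat (\<lambda>_. 0) = 0" by (rule sublinear_const[OF sub])
    then show ?thesis using equal K by simp
  next
    case greater
    have "Ehat (\<lambda>\<omega>. (min K \<bar>\<omega> s - \<omega> t\<bar>) ^ 4) \<le> C * (s - t)\<^sup>2" using inc' st K greater by blast
    then show ?thesis by (simp add: abs_minus_commute power2_commute)
  qed
  have "moment_expectation T Ehat C"
  proof
    show "sublinear_expectation (mspace (path_metric T)) (Collect (cylinder {0..T})) Ehat"
      using sub L_ip_eq[of T] T by simp
  qed (use T C val inc in auto)
  then show ?thesis ..
qed

section \<open>Dyadic approximation of cylinder functions under the sublinear expectation\<close>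

context moment_expectation
begin

lemma T0: "0 \<le> T" using T by simp

lemma E_mono: "cylinder {0..T} X \<Longrightarrow> cylinder {0..T} Y \<Longrightarrow> (\<And>\<omega>. \<omega> \<in> mspace (path_metric T) \<Longrightarrow> X \<omega> \<le> Y \<omega>) \<Longrightarrow> Ehat X \<le> Ehat Y"
  by (rule sublinear_mono[OF sublinear]) auto

lemma E_const: "Ehat (\<lambda>_. c) = c"
  by (rule sublinear_const[OF sublinear])

lemma E_add: "cylinder {0..T} X \<Longrightarrow> cylinder {0..T} Y \<Longrightarrow> Ehat (\<lambda>\<omega>. X \<omega> + Y \<omega>) \<le> Ehat X + Ehat Y"
  by (rule sublinear_add[OF sublinear]) auto

lemma E_scale: "cylinder {0..T} X \<Longrightarrow> 0 \<le> a \<Longrightarrow> Ehat (\<lambda>\<omega>. a * X \<omega>) = a * Ehat X"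
  by (rule sublinear_scale[OF sublinear]) auto

lemma E_sum:
  assumes "\<And>i. i \<in> I \<Longrightarrow> cylinder {0..T} (X i)"
  shows "Ehat (\<lambda>\<omega>. \<Sum>i\<in>I. X i \<omega>) \<le> (\<Sum>i\<in>I. Ehat (X i))"
  using assms
proof (induction I rule: infinite_finite_induct)
  case (insert i I)
  have "Ehat (\<lambda>\<omega>. X i \<omega> + (\<Sum>i\<in>I. X i \<omega>)) \<le> Ehat (X i) + Ehat (\<lambda>\<omega>. \<Sum>i\<in>I. X i \<omega>)"
    using insert by (intro E_add cylinder_sum) auto
  then show ?case using insert by fastforce
qed (simp_all add: E_const)

lemma E_le_add_abs:
  assumes "cylinder {0..T} X" "cylinder {0..T} Y"
  shows "Ehat X \<le> Ehat Y + Ehat (\<lambda>\<omega>. \<bar>X \<omega> - Y \<omega>\<bar>)"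
proof -
  have "Ehat X \<le> Ehat (\<lambda>\<omega>. Y \<omega> + \<bar>X \<omega> - Y \<omega>\<bar>)"
    using assms by (intro E_mono cylinder_add cylinder_abs cylinder_diff) auto
  also have "\<dots> \<le> Ehat Y + Ehat (\<lambda>\<omega>. \<bar>X \<omega> - Y \<omega>\<bar>)"
    using assms by (intro E_add cylinder_abs cylinder_diff)
  finally show ?thesis .
qed

text \<open>Splitting at \<open>e\<close> bounds \<open>m\<close> by
  \<open>e + m ^ 4 / e ^ 3\<close>. This brings the first moment down to the fourth by subadditivity
  and homogeneity, without a Hoelder inequality for \<open>Ehat\<close>.\<close>

lemma E_increment_small:
  assumes st: "s \<in> {0..T}" "t \<in> {0..T}" and K: "0 \<le> K" and e: "0 < e"
  shows "Ehat (\<lambda>\<omega>. min K \<bar>\<omega> t - \<omega> s\<bar>) \<le> e + C * (t - s)\<^sup>2 / e ^ 3"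
proof -
  have c: "cylinder {0..T} (\<lambda>\<omega>. (1 / e ^ 3) * (min K \<bar>\<omega> t - \<omega> s\<bar>) ^ 4)"
    using st K by (intro cylinder_cmult cylinder_power cylinder_increment)
  have le: "m \<le> e + (1 / e ^ 3) * m ^ 4" if "0 \<le> m" for m
  proof (cases "m \<le> e")
    case False
    then have "1 \<le> (m / e) ^ 3" using e by (intro one_le_power) auto
    then have "m * 1 \<le> m * (m / e) ^ 3" using that by (intro mult_left_mono) auto
    also have "\<dots> = (1 / e ^ 3) * m ^ 4" by (simp add: power_divide power4_eq_xxxx power3_eq_cube)
    finally show ?thesis using e by linarith
  qed (use e that in \<open>auto intro: add_increasing2\<close>)
  have "Ehat (\<lambda>\<omega>. min K \<bar>\<omega> t - \<omega> s\<bar>) \<le> Ehat (\<lambda>\<omega>. e + (1 / e ^ 3) * (min K \<bar>\<omega> t - \<omega> s\<bar>) ^ 4)"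
    using st K by (intro E_mono cylinder_add cylinder_const c cylinder_increment le) auto
  also have "\<dots> \<le> e + Ehat (\<lambda>\<omega>. (1 / e ^ 3) * (min K \<bar>\<omega> t - \<omega> s\<bar>) ^ 4)"
    using E_add[OF cylinder_const c, of e] by (simp add: E_const)
  also have "\<dots> = e + (1 / e ^ 3) * Ehat (\<lambda>\<omega>. (min K \<bar>\<omega> t - \<omega> s\<bar>) ^ 4)"
    using st K e by (subst E_scale) (auto intro!: cylinder_power cylinder_increment)
  also have "\<dots> \<le> e + (1 / e ^ 3) * (C * (t - s)\<^sup>2)"
    using st K e by (intro add_left_mono mult_left_mono moment_increment) auto
  finally show ?thesis by simp
qed

text \<open>The function is evaluated at a step path, which is outside the path space; this is
  legitimate because cylinder functions are Lipschitz on all functions.\<close>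

definition dyadic_version :: "nat \<Rightarrow> ((real \<Rightarrow> real) \<Rightarrow> real) \<Rightarrow> (real \<Rightarrow> real) \<Rightarrow> real" where
  "dyadic_version m X \<omega> = X (\<lambda>s. \<omega> (dyadic_floor T m s))"

lemma cylinder_dyadic_version:
  assumes X: "cylinder {0..T} X"
  shows "cylinder (dyadics T) (dyadic_version m X)"
proof -
  obtain K F C where *: "0 \<le> K" "\<And>\<omega>. \<bar>X \<omega>\<bar> \<le> K" "finite F" "F \<subseteq> {0..T}" "1 \<le> C"
    "\<And>\<omega> \<omega>'. \<bar>X \<omega> - X \<omega>'\<bar> \<le> C * (\<Sum>s\<in>F. \<bar>\<omega> s - \<omega>' s\<bar>)" using X by (rule cylinderE) blast
  show ?thesis
  proof (rule cylinderI[of _ K "dyadic_floor T m ` F" _ "C * card F"])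
    fix \<omega> \<omega>' :: "real \<Rightarrow> real"
    let ?S = "\<Sum>s\<in>dyadic_floor T m ` F. \<bar>\<omega> s - \<omega>' s\<bar>"
    have "(\<Sum>s\<in>F. \<bar>\<omega> (dyadic_floor T m s) - \<omega>' (dyadic_floor T m s)\<bar>) \<le> (\<Sum>s\<in>F. ?S)"
      using *(3) by (intro sum_mono member_le_sum) auto
    then have "C * (\<Sum>s\<in>F. \<bar>\<omega> (dyadic_floor T m s) - \<omega>' (dyadic_floor T m s)\<bar>) \<le> C * (card F * ?S)"
      using *(5) by (intro mult_left_mono) auto
    then show "\<bar>dyadic_version m X \<omega> - dyadic_version m X \<omega>'\<bar> \<le> C * card F * ?S"
      unfolding dyadic_version_def
      using *(6)[of "\<lambda>s. \<omega> (dyadic_floor T m s)" "\<lambda>s. \<omega>' (dyadic_floor T m s)"] by (simp add: mult.assoc)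
  qed (use * dyadic_floor_in[OF T] in \<open>auto simp: dyadic_version_def\<close>)
qed

lemma cylinder_dyadics: "cylinder (dyadics T) X \<Longrightarrow> cylinder {0..T} X"
  by (erule cylinder_mono) (rule dyadics_subset[OF T])

lemma dyadic_version_tendsto:
  assumes X: "cylinder {0..T} X" and w: "\<omega> \<in> mspace (path_metric T)"
  shows "(\<lambda>m. dyadic_version m X \<omega>) \<longlonglongrightarrow> X \<omega>"
proof -
  obtain K F C where *: "0 \<le> K" "\<And>\<omega>. \<bar>X \<omega>\<bar> \<le> K" "finite F" "F \<subseteq> {0..T}" "1 \<le> C"
    "\<And>\<omega> \<omega>'. \<bar>X \<omega> - X \<omega>'\<bar> \<le> C * (\<Sum>s\<in>F. \<bar>\<omega> s - \<omega>' s\<bar>)" using X by (rule cylinderE) blast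
  have c: "continuous_on {0..T} \<omega>" using w by (simp add: paths_iff)
  have "(\<lambda>m. \<omega> (dyadic_floor T m s)) \<longlonglongrightarrow> \<omega> s" if "s \<in> F" for s
  proof (rule continuous_on_tendsto_compose[OF c dyadic_floor_tendsto[OF T]])
    show "s \<in> {0..T}" using that *(4) by auto
    then show "\<forall>\<^sub>F m in sequentially. dyadic_floor T m s \<in> {0..T}"
      using dyadic_floor_in[OF T] dyadics_subset[OF T] by (intro always_eventually) blast
  qed
  then have "(\<lambda>m. C * (\<Sum>s\<in>F. \<bar>\<omega> (dyadic_floor T m s) - \<omega> s\<bar>)) \<longlonglongrightarrow> C * (\<Sum>s\<in>F. \<bar>\<omega> s - \<omega> s\<bar>)"
    by (intro tendsto_intros)
  then have lim0: "(\<lambda>m. C * (\<Sum>s\<in>F. \<bar>\<omega> (dyadic_floor T m s) - \<omega> s\<bar>)) \<longlonglongrightarrow> 0" by simp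
  have "(\<lambda>m. dyadic_version m X \<omega> - X \<omega>) \<longlonglongrightarrow> 0"
    by (rule Lim_null_comparison[OF _ lim0]) (auto intro!: always_eventually simp: dyadic_version_def *(6))
  then show ?thesis by (rule LIM_zero_cancel)
qed

text \<open>The difference is at most \<open>2 * K\<close> and at most \<open>L\<close> times a sum
  of increments over short time intervals. Truncating each increment at \<open>2 * K\<close> keeps
  both bounds, and \<open>E_increment_small\<close> applies to the truncations.\<close>

lemma dyadic_version_approx:
  assumes X: "cylinder {0..T} X" and e: "0 < e"
  shows "\<forall>\<^sub>F m in sequentially. Ehat (\<lambda>\<omega>. \<bar>X \<omega> - dyadic_version m X \<omega>\<bar>) \<le> e"
proof -
  obtain K F L where *: "0 \<le> K" "\<And>\<omega>. \<bar>X \<omega>\<bar> \<le> K" "finite F" "F \<subseteq> {0..T}" "1 \<le> L"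
    "\<And>\<omega> \<omega>'. \<bar>X \<omega> - X \<omega>'\<bar> \<le> L * (\<Sum>s\<in>F. \<bar>\<omega> s - \<omega>' s\<bar>)" using X by (rule cylinderE) blast
  \<comment> \<open>With this choice the terms \<open>d\<close>, one for each time in
    \<open>F\<close>, contribute at most \<open>e / 2\<close> after multiplication by
    \<open>L\<close>; the summand 1 covers an empty \<open>F\<close>.\<close>
  define d where "d = e / (2 * (L * (card F + 1)))"
  have d: "0 < d" using e *(5) by (simp add: d_def)
  let ?f = "dyadic_floor T"
  have fl: "?f m s \<in> {0..T}" if "s \<in> F" for s m
    using that *(4) dyadic_floor_in[OF T] dyadics_subset[OF T] by blast
  have cyl: "cylinder {0..T} (\<lambda>\<omega>. min (2 * K) \<bar>\<omega> s - \<omega> (?f m s)\<bar>)" if "s \<in> F" for s m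
    using that fl *(1,4) by (intro cylinder_increment) auto
  have bound: "Ehat (\<lambda>\<omega>. \<bar>X \<omega> - dyadic_version m X \<omega>\<bar>) \<le> L * (\<Sum>s\<in>F. d + C * (s - ?f m s)\<^sup>2 / d ^ 3)" for m
  proof -
    have "\<bar>X \<omega> - dyadic_version m X \<omega>\<bar> \<le> L * (\<Sum>s\<in>F. min (2 * K) \<bar>\<omega> s - \<omega> (?f m s)\<bar>)" for \<omega>
    proof (cases "\<exists>s\<in>F. 2 * K \<le> \<bar>\<omega> s - \<omega> (?f m s)\<bar>")
      case True
      then obtain s where s: "s \<in> F" "2 * K \<le> \<bar>\<omega> s - \<omega> (?f m s)\<bar>" by blast
      have "\<bar>X \<omega> - dyadic_version m X \<omega>\<bar> \<le> 2 * K"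
        using *(2)[of \<omega>] *(2)[of "\<lambda>s. \<omega> (?f m s)"] by (simp add: dyadic_version_def)
      also have "\<dots> = min (2 * K) \<bar>\<omega> s - \<omega> (?f m s)\<bar>" using s by simp
      also have "\<dots> \<le> (\<Sum>s\<in>F. min (2 * K) \<bar>\<omega> s - \<omega> (?f m s)\<bar>)"
        using s *(1,3) by (intro member_le_sum) auto
      also have "\<dots> \<le> L * \<dots>"
        using *(1,5) sum_nonneg[of F "\<lambda>s. min (2 * K) \<bar>\<omega> s - \<omega> (?f m s)\<bar>"] by (simp add: mult_le_cancel_right1)
      finally show ?thesis .
    next
      case False
      then have "(\<Sum>s\<in>F. min (2 * K) \<bar>\<omega> s - \<omega> (?f m s)\<bar>) = (\<Sum>s\<in>F. \<bar>\<omega> s - \<omega> (?f m s)\<bar>)"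
        by (intro sum.cong) (auto simp: min_def)
      then show ?thesis using *(6)[of \<omega> "\<lambda>s. \<omega> (?f m s)"] by (simp add: dyadic_version_def)
    qed
    then have "Ehat (\<lambda>\<omega>. \<bar>X \<omega> - dyadic_version m X \<omega>\<bar>)
        \<le> Ehat (\<lambda>\<omega>. L * (\<Sum>s\<in>F. min (2 * K) \<bar>\<omega> s - \<omega> (?f m s)\<bar>))"
      by (intro E_mono cylinder_abs cylinder_diff X cylinder_dyadics[OF cylinder_dyadic_version]
            cylinder_cmult cylinder_sum cyl) auto
    also have "\<dots> = L * Ehat (\<lambda>\<omega>. \<Sum>s\<in>F. min (2 * K) \<bar>\<omega> s - \<omega> (?f m s)\<bar>)"
      using *(5) by (intro E_scale cylinder_sum cyl) auto
    also have "\<dots> \<le> L * (\<Sum>s\<in>F. Ehat (\<lambda>\<omega>. min (2 * K) \<bar>\<omega> s - \<omega> (?f m s)\<bar>))"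
      using *(5) by (intro mult_left_mono E_sum cyl) auto
    also have "\<dots> \<le> L * (\<Sum>s\<in>F. d + C * (s - ?f m s)\<^sup>2 / d ^ 3)"
      using *(1,4,5) fl d by (intro mult_left_mono sum_mono E_increment_small) auto
    finally show ?thesis .
  qed
  have "(\<lambda>m. L * (\<Sum>s\<in>F. d + C * (s - ?f m s)\<^sup>2 / d ^ 3)) \<longlonglongrightarrow> L * (\<Sum>s\<in>F. d + C * (s - s)\<^sup>2 / d ^ 3)"
    using d by (intro tendsto_intros dyadic_floor_tendsto[OF T]) auto
  moreover have "L * (\<Sum>s\<in>F. d + C * (s - s)\<^sup>2 / d ^ 3) < e"
  proof -
    have "L * (card F * d) \<le> L * (card F + 1) * d" using *(5) d by (simp add: algebra_simps)
    also have "\<dots> = e / 2"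
    proof -
      have "L * (real (card F) + 1) \<noteq> 0" using *(5) by auto
      then show ?thesis by (simp add: d_def field_simps)
    qed
    finally show ?thesis using e by simp
  qed
  ultimately have "\<forall>\<^sub>F m in sequentially. L * (\<Sum>s\<in>F. d + C * (s - ?f m s)\<^sup>2 / d ^ 3) < e"
    by (rule order_tendstoD)
  then show ?thesis by eventually_elim (use bound in \<open>auto intro: order.trans less_imp_le\<close>)
qed

end

section \<open>Compactness of the dominated measures\<close>

lemma cylinder_cong: "cylinder D X \<Longrightarrow> (\<And>s. s \<in> D \<Longrightarrow> \<omega> s = \<omega>' s) \<Longrightarrow> X \<omega> = X \<omega>'"
proof -
  assume X: "cylinder D X" and eq: "\<And>s. s \<in> D \<Longrightarrow> \<omega> s = \<omega>' s"
  obtain K F C where *: "0 \<le> K" "\<And>\<omega>. \<bar>X \<omega>\<bar> \<le> K" "finite F" "F \<subseteq> D" "1 \<le> C"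
    "\<And>\<omega> \<omega>'. \<bar>X \<omega> - X \<omega>'\<bar> \<le> C * (\<Sum>s\<in>F. \<bar>\<omega> s - \<omega>' s\<bar>)" using X by (rule cylinderE) blast
  have "(\<Sum>s\<in>F. \<bar>\<omega> s - \<omega>' s\<bar>) = 0" using eq *(4) by (intro sum.neutral) auto
  then show "X \<omega> = X \<omega>'" using *(6)[of \<omega> \<omega>'] by simp
qed

section \<open>Paths as sequences indexed by the dyadic times\<close>

lemma dyadics_nonempty: "dyadics T \<noteq> {}"
proof -
  have "T * real 0 / 2 ^ 0 \<in> dyadics T" unfolding dyadics_def by blast
  then show ?thesis by blast
qed

definition dyadic_enum :: "real \<Rightarrow> nat \<Rightarrow> real" where
  "dyadic_enum T = from_nat_into (dyadics T)"

lemma range_dyadic_enum: "range (dyadic_enum T) = dyadics T"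
  unfolding dyadic_enum_def by (rule range_from_nat_into[OF dyadics_nonempty countable_dyadics])

text \<open>\<open>from_nat_into\<close> repeats values on a finite set, hence the detour through
  infinity of the set. Injectivity is what allows \<open>dyadic_path\<close> to be read back
  coordinate by coordinate.\<close>

lemma inj_dyadic_enum:
  assumes "0 < T" shows "inj (dyadic_enum T)"
proof -
  have "inj (\<lambda>m. T / 2 ^ m)"
  proof (rule injI)
    fix m n assume "T / 2 ^ m = T / 2 ^ n"
    then have "(2::real) ^ m = 2 ^ n" using assms by (simp add: field_simps)
    then show "m = n" by simp
  qed
  then have "infinite (range (\<lambda>m. T / 2 ^ m))" by (rule range_inj_infinite)
  moreover have "T / 2 ^ m \<in> dyadics T" for m
  proof -
    have "T / 2 ^ m = T * real 1 / 2 ^ m" "1 \<le> (2::nat) ^ m" by auto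
    then show ?thesis unfolding dyadics_def by blast
  qed
  ultimately have "infinite (dyadics T)" by (meson finite_subset image_subsetI)
  from bij_betw_from_nat_into[OF countable_dyadics this]
  show ?thesis by (simp add: dyadic_enum_def bij_betw_def)
qed

definition dyadic_coords :: "real \<Rightarrow> (real \<Rightarrow> real) \<Rightarrow> nat \<Rightarrow> real" where
  "dyadic_coords T \<omega> = (\<lambda>i. \<omega> (dyadic_enum T i))"

text \<open>Away from the dyadic times the index is arbitrary, which no dyadic cylinder function can
  detect.\<close>

definition dyadic_path :: "real \<Rightarrow> (nat \<Rightarrow> real) \<Rightarrow> real \<Rightarrow> real" where
  "dyadic_path T y = (\<lambda>s. y (inv (dyadic_enum T) s))"

lemma dyadic_path_coords: "s \<in> dyadics T \<Longrightarrow> dyadic_path T (dyadic_coords T \<omega>) s = \<omega> s"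
  unfolding dyadic_path_def dyadic_coords_def
  using f_inv_into_f[of s "dyadic_enum T" UNIV] range_dyadic_enum[of T] by auto

lemma cylinder_dyadic_path: "cylinder (dyadics T) X \<Longrightarrow> X (dyadic_path T (dyadic_coords T \<omega>)) = X \<omega>"
  by (erule cylinder_cong) (rule dyadic_path_coords)

lemma dyadic_coords_measurable:
  assumes "0 < T"
  shows "dyadic_coords T \<in> measurable (path_borel T) RN"
proof -
  have "(\<lambda>\<omega>. \<lambda>i. \<omega> (dyadic_enum T i)) \<in> measurable (path_borel T) RN"
  proof (rule measurable_PiM_single')
    fix i
    have "dyadic_enum T i \<in> {0..T}" using range_dyadic_enum[of T] dyadics_subset[OF assms] by blast
    then show "(\<lambda>\<omega>. \<omega> (dyadic_enum T i)) \<in> borel_measurable (path_borel T)" by (rule path_eval_measurable)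
  qed (auto simp: space_PiM)
  then show ?thesis by (simp add: dyadic_coords_def[abs_def])
qed

text \<open>Only finitely many coordinates enter, so coordinatewise convergence is enough. The
  filter is general because the lemma serves both sequences and continuity at a point.\<close>

lemma cylinder_path_tendsto:
  assumes X: "cylinder D X" and lim: "\<And>i. ((\<lambda>x. ys x i) \<longlongrightarrow> y i) F"
  shows "((\<lambda>x. X (dyadic_path T (ys x))) \<longlongrightarrow> X (dyadic_path T y)) F"
proof -
  obtain K S C where *: "0 \<le> K" "\<And>\<omega>. \<bar>X \<omega>\<bar> \<le> K" "finite S" "S \<subseteq> D" "1 \<le> C"
    "\<And>\<omega> \<omega>'. \<bar>X \<omega> - X \<omega>'\<bar> \<le> C * (\<Sum>s\<in>S. \<bar>\<omega> s - \<omega>' s\<bar>)" using X by (rule cylinderE) blast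
  let ?i = "inv (dyadic_enum T)"
  have "((\<lambda>x. C * (\<Sum>s\<in>S. \<bar>ys x (?i s) - y (?i s)\<bar>)) \<longlongrightarrow> C * (\<Sum>s\<in>S. \<bar>y (?i s) - y (?i s)\<bar>)) F"
    by (intro tendsto_intros lim)
  then have lim0: "((\<lambda>x. C * (\<Sum>s\<in>S. \<bar>ys x (?i s) - y (?i s)\<bar>)) \<longlongrightarrow> 0) F" by simp
  have "((\<lambda>x. X (dyadic_path T (ys x)) - X (dyadic_path T y)) \<longlongrightarrow> 0) F"
  proof (rule Lim_null_comparison[OF _ lim0], rule always_eventually, rule allI)
    fix x
    show "norm (X (dyadic_path T (ys x)) - X (dyadic_path T y)) \<le> C * (\<Sum>s\<in>S. \<bar>ys x (?i s) - y (?i s)\<bar>)"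
      using *(6)[of "dyadic_path T (ys x)" "dyadic_path T y"] by (simp add: dyadic_path_def)
  qed
  then show ?thesis by (rule LIM_zero_cancel)
qed

lemma cylinder_path_measurable:
  assumes X: "cylinder D X"
  shows "(\<lambda>y. X (dyadic_path T y)) \<in> borel_measurable RN"
proof -
  have "continuous_on UNIV (\<lambda>y :: nat \<Rightarrow> real. X (dyadic_path T y))"
  proof (rule continuous_at_imp_continuous_on, rule ballI)
    fix y :: "nat \<Rightarrow> real"
    have "((\<lambda>y. y i) \<longlongrightarrow> y i) (at y)" for i
    proof -
      have "continuous_on UNIV (\<lambda>y :: nat \<Rightarrow> real. y i)" by (rule continuous_on_product_coordinates)
      then have "isCont (\<lambda>y. y i) y" by (simp only: continuous_on_eq_continuous_at[OF open_UNIV] ball_UNIV)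
      then show ?thesis unfolding isCont_def .
    qed
    then show "isCont (\<lambda>y. X (dyadic_path T y)) y"
      unfolding isCont_def by (rule cylinder_path_tendsto[OF X])
  qed
  then have "(\<lambda>y. X (dyadic_path T y)) \<in> borel_measurable borel" by (rule borel_measurable_continuous_onI)
  moreover have "sets RN = sets (borel :: (nat \<Rightarrow> real) measure)" by (rule sets_PiM_equal_borel)
  ultimately show ?thesis using measurable_cong_sets[OF _ refl] by blast
qed

context moment_expectation
begin

text \<open>Domination is required only in the limit and only on dyadic cylinder functions, so that
  the lemma applies both to sequences of dominated measures and to the approximately dominated
  measures of the existence proof. The conclusion keeps the convergent copies \<open>Y\<close> and
  \<open>Z\<close> because they provide the couplings needed later.\<close>

lemma sequential_compactness:
  fixes P :: "nat \<Rightarrow> (real \<Rightarrow> real) measure"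
  assumes prob: "\<And>n. prob_space (P n)" and setsP: "\<And>n. sets (P n) = sets (path_borel T)"
    and dom: "\<And>X e. cylinder (dyadics T) X \<Longrightarrow> 0 < e \<Longrightarrow> \<forall>\<^sub>F n in sequentially. integral\<^sup>L (P n) X \<le> Ehat X + e"
  obtains r P' and \<Omega> :: "real measure" and Y :: "nat \<Rightarrow> real \<Rightarrow> nat \<Rightarrow> real" and Z :: "real \<Rightarrow> nat \<Rightarrow> real"
  where "strict_mono r" "P' \<in> dominated_on_L_ip T Ehat"
    "prob_space \<Omega>" "\<And>n. Y n \<in> measurable \<Omega> RN" "Z \<in> measurable \<Omega> RN"
    "\<And>n. distr \<Omega> RN (Y n) = distr (P (r n)) RN (dyadic_coords T)"
    "distr \<Omega> RN Z = distr P' RN (dyadic_coords T)"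
    "AE w in \<Omega>. \<forall>i. (\<lambda>n. Y n w i) \<longlonglongrightarrow> Z w i"
proof -
  have coordsP[measurable]: "dyadic_coords T \<in> measurable (P n) RN" for n
    using dyadic_coords_measurable[OF T] measurable_cong_sets[OF setsP refl] by blast
  define \<mu> where "\<mu> n = distr (P n) RN (dyadic_coords T)" for n
  have spP: "space (P n) = mspace (path_metric T)" for n
    using sets_eq_imp_space_eq[OF setsP] by simp
  have tight: "\<exists>R. \<forall>\<^sub>F n in sequentially. measure (\<mu> n) {x. \<bar>x i\<bar> > R} \<le> e" if e: "0 < e" for i e
  proof -
    define t where "t = dyadic_enum T i"
    have tD: "t \<in> dyadics T" unfolding t_def range_dyadic_enum[symmetric] by blast
    then have t: "t \<in> {0..T}" using dyadics_subset[OF T] by blast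
    \<comment> \<open>Markov's inequality for the truncated fourth power: \<open>R \<ge> 1\<close>
      allows \<open>R ^ 4\<close> to be replaced by \<open>R\<close>, and then
      \<open>C * t^2 / R\<close> is at most \<open>e / 2\<close>. The other half absorbs the slack
      in the domination.\<close>
    define R where "R = max 1 (2 * (C * t\<^sup>2) / e)"
    have R: "1 \<le> R" "2 * (C * t\<^sup>2) / e \<le> R" by (auto simp: R_def)
    define X where "X \<omega> = 1 / R ^ 4 * (min R \<bar>\<omega> t\<bar>) ^ 4" for \<omega> :: "real \<Rightarrow> real"
    have X: "cylinder (dyadics T) X"
      unfolding X_def using R tD by (intro cylinder_cmult cylinder_power cylinder_coordinate) auto
    have "Ehat X = 1 / R ^ 4 * Ehat (\<lambda>\<omega>. (min R \<bar>\<omega> t\<bar>) ^ 4)"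
      unfolding X_def using R t by (intro E_scale cylinder_power cylinder_coordinate) auto
    also have "\<dots> \<le> 1 / R ^ 4 * (C * t\<^sup>2)"
      using R t by (intro mult_left_mono moment_value) auto
    also have "\<dots> \<le> 1 / R * (C * t\<^sup>2)"
      using R C power_increasing[of 1 4 R] by (intro mult_right_mono frac_le) auto
    also have "\<dots> \<le> e / 2" using R e by (simp add: field_simps)
    finally have EX: "Ehat X \<le> e / 2" .
    have "\<forall>\<^sub>F n in sequentially. integral\<^sup>L (P n) X \<le> Ehat X + e / 2" using e by (intro dom[OF X]) simp
    then have "\<forall>\<^sub>F n in sequentially. measure (\<mu> n) {x. \<bar>x i\<bar> > R} \<le> e"
    proof eventually_elim
      case (elim n)
      interpret prob_space "P n" by (rule prob)
      have "{x \<in> space RN. \<bar>x i\<bar> > R} \<in> sets RN" by measurable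
      then have A: "{x. \<bar>x i\<bar> > R} \<in> sets RN" by (simp add: space_PiM)
      have A': "dyadic_coords T -` {x. \<bar>x i\<bar> > R} \<inter> space (P n) \<in> sets (P n)"
        by (rule measurable_sets[OF coordsP A])
      have "measure (\<mu> n) {x. \<bar>x i\<bar> > R} = (\<integral>\<omega>. indicator (dyadic_coords T -` {x. \<bar>x i\<bar> > R} \<inter> space (P n)) \<omega> \<partial>P n)"
        unfolding \<mu>_def using A A' by (subst measure_distr) auto
      also have "\<dots> \<le> integral\<^sup>L (P n) X"
      proof (rule integral_mono)
        show "integrable (P n) X" by (rule cylinder_integrable[OF T0 prob setsP cylinder_dyadics[OF X]])
        show "integrable (P n) (\<lambda>\<omega>. indicator (dyadic_coords T -` {x. \<bar>x i\<bar> > R} \<inter> space (P n)) \<omega> :: real)"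
          using A' by (auto simp: emeasure_eq_measure)
        show "indicator (dyadic_coords T -` {x. \<bar>x i\<bar> > R} \<inter> space (P n)) \<omega> \<le> X \<omega>" for \<omega>
          using R unfolding X_def by (auto simp: indicator_def dyadic_coords_def t_def min_def)
      qed
      finally show ?case using elim EX by linarith
    qed
    then show ?thesis by blast
  qed
  have prob\<mu>: "prob_space (\<mu> n)" for n
    unfolding \<mu>_def by (rule prob_space.prob_space_distr[OF prob coordsP])
  have sets\<mu>: "sets (\<mu> n) = sets RN" for n by (simp add: \<mu>_def)
  obtain r \<Omega> and Y :: "nat \<Rightarrow> real \<Rightarrow> nat \<Rightarrow> real" and Z where r: "strict_mono r" and \<Omega>: "prob_space \<Omega>"
    and Y[measurable]: "\<And>n. Y n \<in> measurable \<Omega> RN" and Z[measurable]: "Z \<in> measurable \<Omega> RN"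
    and lawY: "\<And>n. distr \<Omega> RN (Y n) = \<mu> (r n)" and conv: "AE w in \<Omega>. \<forall>i. (\<lambda>n. Y n w i) \<longlonglongrightarrow> Z w i"
    by (rule skorokhod_sequence_space[OF prob\<mu> sets\<mu>], erule tight) (rule that)
  interpret \<Omega>: prob_space \<Omega> by (rule \<Omega>)
  have domZ: "(\<integral>w. X (dyadic_path T (Z w)) \<partial>\<Omega>) \<le> Ehat X" if X: "cylinder (dyadics T) X" for X
  proof (rule field_le_epsilon)
    fix e :: real assume e: "0 < e"
    note [measurable] = cylinder_path_measurable[OF X]
    obtain K where K: "\<And>\<omega>. \<bar>X \<omega>\<bar> \<le> K" using X by (auto simp: cylinder_def)
    have "(\<lambda>n. \<integral>w. X (dyadic_path T (Y n w)) \<partial>\<Omega>) \<longlonglongrightarrow> (\<integral>w. X (dyadic_path T (Z w)) \<partial>\<Omega>)"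
    proof (rule integral_dominated_convergence[where w="\<lambda>_. K"])
      show "AE w in \<Omega>. (\<lambda>n. X (dyadic_path T (Y n w))) \<longlonglongrightarrow> X (dyadic_path T (Z w))"
        using conv by eventually_elim (rule cylinder_path_tendsto[OF X], blast)
    qed (use K in auto)
    moreover have "(\<integral>w. X (dyadic_path T (Y n w)) \<partial>\<Omega>) = integral\<^sup>L (P (r n)) X" for n
    proof -
      have "(\<integral>w. X (dyadic_path T (Y n w)) \<partial>\<Omega>) = (\<integral>y. X (dyadic_path T y) \<partial>distr \<Omega> RN (Y n))"
        by (subst integral_distr) auto
      also have "\<dots> = (\<integral>\<omega>. X (dyadic_path T (dyadic_coords T \<omega>)) \<partial>P (r n))"
        unfolding lawY \<mu>_def by (subst integral_distr) auto
      finally show ?thesis by (simp add: cylinder_dyadic_path[OF X])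
    qed
    ultimately have "(\<lambda>n. integral\<^sup>L (P (r n)) X) \<longlonglongrightarrow> (\<integral>w. X (dyadic_path T (Z w)) \<partial>\<Omega>)" by simp
    moreover have "\<forall>\<^sub>F n in sequentially. integral\<^sup>L (P (r n)) X \<le> Ehat X + e"
      by (rule eventually_subseq[OF r dom[OF X e]])
    ultimately show "(\<integral>w. X (dyadic_path T (Z w)) \<partial>\<Omega>) \<le> Ehat X + e" by (rule tendsto_upperbound) simp
  qed
  have Zm[measurable]: "(\<lambda>w. dyadic_path T (Z w) s) \<in> borel_measurable \<Omega>" for s
    unfolding dyadic_path_def by measurable
  have mom: "(\<integral>\<^sup>+w. ennreal (\<bar>dyadic_path T (Z w) t - dyadic_path T (Z w) s\<bar> ^ 4) \<partial>\<Omega>) \<le> ennreal (C * (t - s)\<^sup>2)"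
    if st: "s \<in> dyadics T" "t \<in> dyadics T" for s t
  proof -
    \<comment> \<open>Domination reaches only truncated powers; Fatou's lemma removes the truncation
      under the limit measure.\<close>
    define u where "u n w = (min (real n) \<bar>dyadic_path T (Z w) t - dyadic_path T (Z w) s\<bar>) ^ 4" for n w
    have [measurable]: "u n \<in> borel_measurable \<Omega>" for n unfolding u_def by measurable
    have un: "(\<integral>\<^sup>+w. ennreal (u n w) \<partial>\<Omega>) \<le> ennreal (C * (t - s)\<^sup>2)" for n
    proof -
      have X: "cylinder (dyadics T) (\<lambda>\<omega>. (min (real n) \<bar>\<omega> t - \<omega> s\<bar>) ^ 4)"
        using st by (intro cylinder_power cylinder_increment) auto
      have ub: "\<bar>u n w\<bar> \<le> real n ^ 4" for w unfolding u_def by (auto intro!: power_mono)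
      have "(\<integral>w. u n w \<partial>\<Omega>) \<le> Ehat (\<lambda>\<omega>. (min (real n) \<bar>\<omega> t - \<omega> s\<bar>) ^ 4)"
        using domZ[OF X] by (simp add: u_def)
      also have "\<dots> \<le> C * (t - s)\<^sup>2" using st dyadics_subset[OF T] by (intro moment_increment) auto
      finally have "(\<integral>w. u n w \<partial>\<Omega>) \<le> C * (t - s)\<^sup>2" .
      moreover have "(\<integral>\<^sup>+w. ennreal (u n w) \<partial>\<Omega>) = ennreal (\<integral>w. u n w \<partial>\<Omega>)"
        using ub by (intro nn_integral_eq_integral \<Omega>.integrable_const_bound[where B="real n ^ 4"]) (auto simp: u_def)
      ultimately show ?thesis by (simp add: ennreal_leI)
    qed
    have "(\<integral>\<^sup>+w. ennreal (\<bar>dyadic_path T (Z w) t - dyadic_path T (Z w) s\<bar> ^ 4) \<partial>\<Omega>) = (\<integral>\<^sup>+w. liminf (\<lambda>n. ennreal (u n w)) \<partial>\<Omega>)"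
    proof (rule nn_integral_cong)
      fix w
      obtain N :: nat where N: "\<bar>dyadic_path T (Z w) t - dyadic_path T (Z w) s\<bar> \<le> real N"
        using real_arch_simple by blast
      have "(\<lambda>n. ennreal (u n w)) \<longlonglongrightarrow> ennreal (\<bar>dyadic_path T (Z w) t - dyadic_path T (Z w) s\<bar> ^ 4)"
      proof (rule tendsto_eventually, rule eventually_sequentiallyI[of N])
        fix n assume "N \<le> n"
        then have "min (real n) \<bar>dyadic_path T (Z w) t - dyadic_path T (Z w) s\<bar> = \<bar>dyadic_path T (Z w) t - dyadic_path T (Z w) s\<bar>"
          using N by auto
        then show "ennreal (u n w) = ennreal (\<bar>dyadic_path T (Z w) t - dyadic_path T (Z w) s\<bar> ^ 4)" by (simp add: u_def)
      qed
      then show "ennreal (\<bar>dyadic_path T (Z w) t - dyadic_path T (Z w) s\<bar> ^ 4) = liminf (\<lambda>n. ennreal (u n w))"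
        by (intro lim_imp_Liminf[symmetric]) auto
    qed
    also have "\<dots> \<le> liminf (\<lambda>n. \<integral>\<^sup>+w. ennreal (u n w) \<partial>\<Omega>)" by (rule nn_integral_liminf) measurable
    also have "\<dots> \<le> limsup (\<lambda>n. \<integral>\<^sup>+w. ennreal (u n w) \<partial>\<Omega>)" by (rule Liminf_le_Limsup) simp
    also have "\<dots> \<le> ennreal (C * (t - s)\<^sup>2)" using un by (intro Limsup_bounded always_eventually) auto
    finally show ?thesis .
  qed
  obtain \<Phi> where \<Phi>[measurable]: "\<Phi> \<in> measurable \<Omega> (path_borel T)"
    and \<Phi>Z: "AE w in \<Omega>. \<forall>s\<in>dyadics T. \<Phi> w s = dyadic_path T (Z w) s"
    by (rule dyadic_Kolmogorov_continuity[OF T C Zm], erule (1) mom) (rule that)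
  define P' where "P' = distr \<Omega> (path_borel T) \<Phi>"
  have dyad: "(\<integral>w. X (\<Phi> w) \<partial>\<Omega>) \<le> Ehat X" if X: "cylinder (dyadics T) X" for X
  proof -
    note [measurable] = cylinder_measurable[OF T0 cylinder_dyadics[OF X]] cylinder_path_measurable[OF X]
    have "(\<integral>w. X (\<Phi> w) \<partial>\<Omega>) = (\<integral>w. X (dyadic_path T (Z w)) \<partial>\<Omega>)"
    proof (rule integral_cong_AE)
      show "AE w in \<Omega>. X (\<Phi> w) = X (dyadic_path T (Z w))"
        using \<Phi>Z by eventually_elim (rule cylinder_cong[OF X], blast)
    qed measurable
    then show ?thesis using domZ[OF X] by simp
  qed
  \<comment> \<open>So far domination is known for dyadic cylinder functions. A general one is the
    limit of its dyadic versions in two senses: along continuous paths, which \<open>\<Phi>\<close>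
    takes as values, and under \<open>Ehat\<close>.\<close>
  have "integral\<^sup>L P' X \<le> Ehat X" if X: "cylinder {0..T} X" for X
  proof -
    note [measurable] = cylinder_measurable[OF T0 X]
      cylinder_measurable[OF T0 cylinder_dyadics[OF cylinder_dyadic_version[OF X]]]
    obtain K where K: "\<And>\<omega>. \<bar>X \<omega>\<bar> \<le> K" using X by (auto simp: cylinder_def)
    have Kd: "\<bar>dyadic_version m X \<omega>\<bar> \<le> K" for m \<omega> by (simp add: dyadic_version_def K)
    have lim: "(\<lambda>m. \<integral>w. dyadic_version m X (\<Phi> w) \<partial>\<Omega>) \<longlonglongrightarrow> (\<integral>w. X (\<Phi> w) \<partial>\<Omega>)"
    proof (rule integral_dominated_convergence[where w="\<lambda>_. K"])
      show "AE w in \<Omega>. (\<lambda>m. dyadic_version m X (\<Phi> w)) \<longlonglongrightarrow> X (\<Phi> w)"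
        using measurable_space[OF \<Phi>] by (intro AE_I2 dyadic_version_tendsto[OF X]) simp
    qed (use K Kd in auto)
    have "(\<integral>w. X (\<Phi> w) \<partial>\<Omega>) \<le> Ehat X"
    proof (rule field_le_epsilon)
      fix e :: real assume e: "0 < e"
      have "\<forall>\<^sub>F m in sequentially. (\<integral>w. dyadic_version m X (\<Phi> w) \<partial>\<Omega>) \<le> Ehat X + e"
        using dyadic_version_approx[OF X e]
      proof eventually_elim
        case (elim m)
        have "(\<integral>w. dyadic_version m X (\<Phi> w) \<partial>\<Omega>) \<le> Ehat (dyadic_version m X)"
          by (rule dyad[OF cylinder_dyadic_version[OF X]])
        also have "\<dots> \<le> Ehat X + Ehat (\<lambda>\<omega>. \<bar>dyadic_version m X \<omega> - X \<omega>\<bar>)"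
          by (intro E_le_add_abs X cylinder_dyadics cylinder_dyadic_version)
        finally show ?case using elim by (simp add: abs_minus_commute)
      qed
      then show "(\<integral>w. X (\<Phi> w) \<partial>\<Omega>) \<le> Ehat X + e" by (rule tendsto_upperbound[OF lim]) simp
    qed
    then show ?thesis unfolding P'_def by (subst integral_distr) auto
  qed
  then have P': "P' \<in> dominated_on_L_ip T Ehat"
    unfolding dominated_eq[OF T0] by (auto simp: P'_def intro!: \<Omega>.prob_space_distr)
  \<comment> \<open>Almost surely \<open>\<Phi>\<close> has the coordinates \<open>Z\<close> at the
    dyadic times, so passing to continuous paths has not changed their law.\<close>
  have "distr P' RN (dyadic_coords T) = distr \<Omega> RN (\<lambda>w. dyadic_coords T (\<Phi> w))"
    unfolding P'_def using dyadic_coords_measurable[OF T] by (subst distr_distr) (auto simp: comp_def)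
  also have "\<dots> = distr \<Omega> RN Z"
  proof (rule distr_cong_AE[OF refl refl])
    show "AE w in \<Omega>. dyadic_coords T (\<Phi> w) = Z w"
      using \<Phi>Z
    proof eventually_elim
      case (elim w)
      have "\<Phi> w (dyadic_enum T i) = Z w i" for i
      proof -
        have "dyadic_enum T i \<in> dyadics T" unfolding range_dyadic_enum[symmetric] by blast
        then have "\<Phi> w (dyadic_enum T i) = Z w (inv (dyadic_enum T) (dyadic_enum T i))"
          using elim unfolding dyadic_path_def by blast
        then show ?thesis by (simp add: inv_f_f[OF inj_dyadic_enum[OF T]])
      qed
      then show ?case by (auto simp: dyadic_coords_def)
    qed
  qed (use dyadic_coords_measurable[OF T] in \<open>auto intro: measurable_compose[OF \<Phi>]\<close>)
  finally show ?thesis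
    using that[OF r P' \<Omega> Y Z _ _ conv] lawY by (simp add: \<mu>_def)
qed

end

section \<open>Existence of dominated measures\<close>

lemma le_foldr_min: "(y::real) \<le> foldr (\<lambda>p. min (h p)) ps K \<longleftrightarrow> y \<le> K \<and> (\<forall>p\<in>set ps. y \<le> h p)"
  by (induction ps) auto

lemma foldr_min_le: "p \<in> set ps \<Longrightarrow> foldr (\<lambda>p. min (h p)) ps (K::real) \<le> h p"
  using le_foldr_min[of "foldr (\<lambda>p. min (h p)) ps K" h ps K] by blast

lemma foldr_min_Lipschitz:
  fixes h h' :: "'b \<Rightarrow> real"
  assumes "\<And>p. \<bar>h p - h' p\<bar> \<le> d" "0 \<le> d"
  shows "\<bar>foldr (\<lambda>p. min (h p)) ps K - foldr (\<lambda>p. min (h' p)) ps K\<bar> \<le> d"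
proof (induction ps)
  case (Cons p ps)
  then show ?case using assms(1)[of p] by (auto simp: min_def)
qed (use assms in simp)

definition dyadic_time :: "real \<Rightarrow> nat \<Rightarrow> nat \<Rightarrow> real" where
  "dyadic_time T m k = T * real k / 2 ^ m"

lemma dyadic_time_in: "k \<le> 2 ^ m \<Longrightarrow> dyadic_time T m k \<in> dyadics T"
  by (auto simp: dyadics_def dyadic_time_def)

text \<open>
  Minima of finitely many cones with rational data: a countable family that approximates every
  dyadic cylinder function from above.
\<close>

definition cone_min :: "real \<Rightarrow> nat \<times> nat \<times> nat \<times> nat \<times> (int list \<times> int) list \<Rightarrow> (real \<Rightarrow> real) \<Rightarrow> real" where
  "cone_min T = (\<lambda>(m, L, K, N, ps) \<omega>. max (- real K)
     (foldr (\<lambda>p. min (real_of_int (snd p) / real (Suc N) +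
        real L * (\<Sum>k\<le>2^m. \<bar>\<omega> (dyadic_time T m k) - real_of_int (fst p ! k) / real (Suc N)\<bar>))) ps (real K)))"

text \<open>Minima and truncations preserve a common Lipschitz constant, so the number of cones does
  not enter.\<close>

lemma cylinder_cone_min: "cylinder (dyadics T) (cone_min T p)"
proof (cases p)
  case (fields m L K N ps)
  define h where "h \<omega> p = real_of_int (snd p) / real (Suc N) +
        real L * (\<Sum>k\<le>2^m. \<bar>\<omega> (dyadic_time T m k) - real_of_int (fst p ! k) / real (Suc N)\<bar>)"
    for \<omega> :: "real \<Rightarrow> real" and p :: "int list \<times> int"
  have eq: "cone_min T p \<omega> = max (- real K) (foldr (\<lambda>p. min (h \<omega> p)) ps (real K))" for \<omega>
    by (simp add: fields cone_min_def h_def[abs_def])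
  let ?F = "dyadic_time T m ` {..2^m}"
  show ?thesis
  proof (rule cylinderI[of _ "real K" ?F _ "real L * real (2^m + 1)"])
    have "foldr (\<lambda>p. min (h \<omega> p)) ps (real K) \<le> real K" for \<omega>
      using le_foldr_min[of "foldr (\<lambda>p. min (h \<omega> p)) ps (real K)" "h \<omega>" ps "real K"] by blast
    then show "\<bar>cone_min T p \<omega>\<bar> \<le> real K" for \<omega> unfolding eq by (auto simp: abs_le_iff max_def)
    fix \<omega> \<omega>' :: "real \<Rightarrow> real"
    let ?S = "\<Sum>k\<le>2^m. \<bar>\<omega> (dyadic_time T m k) - \<omega>' (dyadic_time T m k)\<bar>"
    have "\<bar>h \<omega> p - h \<omega>' p\<bar> \<le> real L * ?S" for p
    proof -
      have "\<bar>h \<omega> p - h \<omega>' p\<bar> = real L * \<bar>\<Sum>k\<le>2^m. (\<bar>\<omega> (dyadic_time T m k) - real_of_int (fst p ! k) / real (Suc N)\<bar>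
          - \<bar>\<omega>' (dyadic_time T m k) - real_of_int (fst p ! k) / real (Suc N)\<bar>)\<bar>"
        unfolding h_def sum_subtractf by (simp add: right_diff_distrib[symmetric] abs_mult del: of_nat_Suc)
      also have "\<dots> \<le> real L * (\<Sum>k\<le>2^m. \<bar>\<bar>\<omega> (dyadic_time T m k) - real_of_int (fst p ! k) / real (Suc N)\<bar>
          - \<bar>\<omega>' (dyadic_time T m k) - real_of_int (fst p ! k) / real (Suc N)\<bar>\<bar>)"
        by (intro mult_left_mono sum_abs) simp
      also have "\<dots> \<le> real L * ?S" by (intro mult_left_mono sum_mono) auto
      finally show ?thesis .
    qed
    then have "\<bar>foldr (\<lambda>p. min (h \<omega> p)) ps (real K) - foldr (\<lambda>p. min (h \<omega>' p)) ps (real K)\<bar> \<le> real L * ?S"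
      by (rule foldr_min_Lipschitz) (auto intro!: mult_nonneg_nonneg sum_nonneg)
    then have "\<bar>cone_min T p \<omega> - cone_min T p \<omega>'\<bar> \<le> real L * ?S"
      unfolding eq by (auto simp: max_def)
    also have "real L * ?S \<le> real L * (\<Sum>k\<le>(2::nat)^m. \<Sum>s\<in>?F. \<bar>\<omega> s - \<omega>' s\<bar>)"
      by (intro mult_left_mono sum_mono member_le_sum) auto
    finally show "\<bar>cone_min T p \<omega> - cone_min T p \<omega>'\<bar> \<le> real L * real (2^m + 1) * (\<Sum>s\<in>?F. \<bar>\<omega> s - \<omega>' s\<bar>)"
      by (simp add: algebra_simps)
  qed (use dyadic_time_in in auto)
qed

lemma dyadic_time_cover:
  assumes "finite F" "F \<subseteq> dyadics T"
  shows "\<exists>m. F \<subseteq> dyadic_time T m ` {..2^m}"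
  using assms
proof (induction F)
  case (insert s F)
  have refine: "dyadic_time T m ` {..2^m} \<subseteq> dyadic_time T (m + j) ` {..2^(m + j)}" for m j
  proof
    fix u assume "u \<in> dyadic_time T m ` {..2^m}"
    then obtain k where k: "u = dyadic_time T m k" "k \<le> 2 ^ m" by blast
    have "u = dyadic_time T (m + j) (k * 2 ^ j)" by (simp add: k(1) dyadic_time_def power_add)
    moreover have "k * 2 ^ j \<le> 2 ^ (m + j)" using k(2) by (simp add: power_add)
    ultimately show "u \<in> dyadic_time T (m + j) ` {..2^(m + j)}" by blast
  qed
  obtain m where m: "F \<subseteq> dyadic_time T m ` {..2^m}" using insert by blast
  obtain k m' where s: "s = dyadic_time T m' k" "k \<le> 2 ^ m'"
    using insert.prems by (auto simp: dyadics_def dyadic_time_def)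
  have "F \<subseteq> dyadic_time T (m + m') ` {..2^(m + m')}" using m refine[of m m'] by blast
  moreover have "s \<in> dyadic_time T (m' + m) ` {..2^(m' + m)}" using s refine[of m' m] by blast
  ultimately show ?case by (intro exI[of _ "m + m'"]) (simp add: add.commute[of m' m])
qed simp

context moment_expectation
begin

text \<open>
  Blackwell's approachability strategy: at each step choose a path at which the combination of the
  functions, weighted with the positive parts of the accumulated excesses, is not above its
  expectation. The squared norm of the positive excess then grows only linearly.
\<close>

lemma finite_domination:
  fixes g :: "nat \<Rightarrow> (real \<Rightarrow> real) \<Rightarrow> real"
  assumes g: "\<And>i. cylinder {0..T} (g i)" and e: "0 < e"
  shows "\<exists>P. prob_space P \<and> sets P = sets (path_borel T) \<and> (\<forall>i<k. integral\<^sup>L P (g i) \<le> Ehat (g i) + e)"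
proof -
  define c where "c i = Ehat (g i)" for i
  obtain K where K: "\<And>i \<omega>. \<bar>g i \<omega>\<bar> \<le> K i"
    using g unfolding cylinder_def by metis
  define M where "M = (\<Sum>i<k. K i + \<bar>c i\<bar>)"
  have K0: "0 \<le> K i" for i using K[of i undefined] by linarith
  have M: "\<bar>g i \<omega> - c i\<bar> \<le> M" if "i < k" for i \<omega>
  proof -
    have "\<bar>g i \<omega> - c i\<bar> \<le> K i + \<bar>c i\<bar>" using K[of i \<omega>] by linarith
    also have "\<dots> \<le> M" unfolding M_def using that K0 by (intro member_le_sum) auto
    finally show ?thesis .
  qed
  \<comment> \<open>Otherwise monotonicity and sublinearity give \<open>1 + a \<le> a\<close> for
    the weighted sum \<open>a\<close> of the expectations. The slack 1 makes it unnecessary that an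
    infimum over paths be attained.\<close>
  have "\<exists>\<omega>\<in>mspace (path_metric T). (\<Sum>i<k. l i * (g i \<omega> - c i)) \<le> 1" if l: "\<And>i. 0 \<le> l i" for l :: "nat \<Rightarrow> real"
  proof (rule ccontr)
    assume "\<not> ?thesis"
    then have gt: "1 + (\<Sum>i<k. l i * c i) \<le> (\<Sum>i<k. l i * g i \<omega>)" if "\<omega> \<in> mspace (path_metric T)" for \<omega>
      using that by (force simp: right_diff_distrib sum_subtractf not_le)
    have cyl: "cylinder {0..T} (\<lambda>\<omega>. l i * g i \<omega>)" for i by (intro cylinder_cmult g)
    have "Ehat (\<lambda>_. 1 + (\<Sum>i<k. l i * c i)) \<le> Ehat (\<lambda>\<omega>. \<Sum>i<k. l i * g i \<omega>)"
      using gt by (intro E_mono cylinder_const cylinder_sum cyl)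
    also have "\<dots> \<le> (\<Sum>i<k. Ehat (\<lambda>\<omega>. l i * g i \<omega>))" by (intro E_sum cyl)
    also have "\<dots> = (\<Sum>i<k. l i * c i)" unfolding c_def using l g by (intro sum.cong refl E_scale)
    finally show False by (simp add: E_const)
  qed
  then obtain pick where pick: "\<And>l. (\<And>i. 0 \<le> l i) \<Longrightarrow> pick l \<in> mspace (path_metric T)"
      "\<And>l. (\<And>i. 0 \<le> l i) \<Longrightarrow> (\<Sum>i<k. l i * (g i (pick l) - c i)) \<le> 1"
    by metis
  define S :: "nat \<Rightarrow> nat \<Rightarrow> real" where
    "S = rec_nat (\<lambda>_. 0) (\<lambda>_ s i. s i + (g i (pick (\<lambda>i. max 0 (s i))) - c i))"
  define w where "w t = pick (\<lambda>i. max 0 (S t i))" for t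
  have S0: "S 0 i = 0" and SSuc: "S (Suc t) i = S t i + (g i (w t) - c i)" for t i
    by (simp_all add: S_def w_def)
  have wP: "w t \<in> mspace (path_metric T)" for t unfolding w_def by (rule pick(1)) simp
  \<comment> \<open>Growth of the squared positive excess per step: 2 bounds the cross term, by the
    choice of the path, and the rest bounds the squares of the new increments.\<close>
  define B where "B = 2 + real k * M\<^sup>2"
  have a: "(\<Sum>i<k. (max 0 (S t i))\<^sup>2) \<le> real t * B" for t
  proof (induction t)
    case 0 then show ?case by (simp add: S0)
  next
    case (Suc t)
    let ?v = "\<lambda>i. g i (w t) - c i"
    have pos: "(max 0 (s + v))\<^sup>2 \<le> (max 0 s)\<^sup>2 + 2 * (max 0 s * v) + v\<^sup>2" for s v :: real
    proof (cases "0 \<le> s")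
      case True
      have "(max 0 (s + v))\<^sup>2 \<le> (s + v)\<^sup>2" by (auto simp: max_def)
      then show ?thesis using True by (simp add: power2_eq_square algebra_simps)
    next
      case False
      then have "(max 0 (s + v))\<^sup>2 \<le> v\<^sup>2" by (auto simp: max_def intro!: power_mono)
      then show ?thesis using False by (simp add: max_def)
    qed
    have "(\<Sum>i<k. (max 0 (S (Suc t) i))\<^sup>2) \<le> (\<Sum>i<k. (max 0 (S t i))\<^sup>2 + 2 * (max 0 (S t i) * ?v i) + (?v i)\<^sup>2)"
      unfolding SSuc by (intro sum_mono pos)
    also have "\<dots> = (\<Sum>i<k. (max 0 (S t i))\<^sup>2) + 2 * (\<Sum>i<k. max 0 (S t i) * ?v i) + (\<Sum>i<k. (?v i)\<^sup>2)"
      by (simp add: sum.distrib sum_distrib_left)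
    also have "\<dots> \<le> real t * B + 2 * 1 + (\<Sum>i<k. M\<^sup>2)"
    proof (intro add_mono mult_left_mono Suc sum_mono)
      show "(\<Sum>i<k. max 0 (S t i) * ?v i) \<le> 1" unfolding w_def by (rule pick(2)) simp
      show "(?v i)\<^sup>2 \<le> M\<^sup>2" if "i \<in> {..<k}" for i
        using M[of i "w t"] that by (simp add: abs_le_square_iff[symmetric])
    qed simp
    also have "\<dots> = real (Suc t) * B" by (simp add: B_def algebra_simps)
    finally show ?case .
  qed
  have Ssum: "S t i = (\<Sum>s<t. g i (w s) - c i)" for t i by (induction t) (simp_all add: S0 SSuc)
  \<comment> \<open>After \<open>t\<close> steps each positive excess is at most
    \<open>sqrt (t * B)\<close>, so its average is at most \<open>sqrt (B / t)\<close>, which has to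
    be at most \<open>e\<close>.\<close>
  obtain t0 where t0: "B / e\<^sup>2 \<le> real t0" using real_arch_simple by blast
  define t where "t = Suc t0"
  have t: "B \<le> real t * e\<^sup>2" using t0 e by (simp add: t_def field_simps add_increasing)
  have avg: "(\<Sum>s<t. g i (w s)) / real t \<le> c i + e" if i: "i < k" for i
  proof -
    have "(max 0 (S t i))\<^sup>2 \<le> (\<Sum>i<k. (max 0 (S t i))\<^sup>2)" using i by (intro member_le_sum) auto
    also have "\<dots> \<le> real t * B" by (rule a)
    also have "\<dots> \<le> real t * (real t * e\<^sup>2)" using t by (intro mult_left_mono) auto
    also have "\<dots> = (real t * e)\<^sup>2" by (simp add: power2_eq_square)
    finally have "max 0 (S t i) \<le> real t * e" by (rule power2_le_imp_le) (use e in simp)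
    then have "(\<Sum>s<t. g i (w s)) \<le> real t * (c i + e)"
      unfolding Ssum by (simp add: sum_subtractf algebra_simps)
    then show ?thesis by (simp add: t_def divide_le_eq mult.commute)
  qed
  define P where "P = distr (measure_pmf (pmf_of_set {..<t})) (path_borel T) w"
  have wm: "w \<in> measurable (measure_pmf (pmf_of_set {..<t})) (path_borel T)"
    using wP by (auto simp: measurable_def)
  have "prob_space P" unfolding P_def by (rule measure_pmf.prob_space_distr[OF wm])
  moreover have "integral\<^sup>L P (g i) \<le> Ehat (g i) + e" if i: "i < k" for i
  proof -
    have "integral\<^sup>L P (g i) = (\<integral>s. g i (w s) \<partial>measure_pmf (pmf_of_set {..<t}))"
      unfolding P_def using cylinder_measurable[OF T0 g] by (intro integral_distr wm) auto
    also have "\<dots> = (\<Sum>s<t. g i (w s)) / real t"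
      by (subst integral_pmf_of_set) (auto simp: t_def)
    finally show ?thesis using avg[OF i] by (simp add: c_def)
  qed
  ultimately show ?thesis by (intro exI[of _ P]) (simp add: P_def)
qed

text \<open>An \<open>L\<close>-Lipschitz function is the infimum of the cones of slope
  \<open>L\<close> standing on its graph. Vertices on a fine finite grid in a box suffice up to
  \<open>e / 2\<close> for paths whose values lie in the box. Outside the box both functions are
  bounded by \<open>K\<close> in absolute value, and the fourth moments make this part cost at most
  another \<open>e / 2\<close> under \<open>Ehat\<close>.\<close>

lemma cone_min_approx:
  assumes X: "cylinder (dyadics T) X" and e: "0 < e"
  shows "\<exists>p. (\<forall>\<omega>. X \<omega> \<le> cone_min T p \<omega>) \<and> Ehat (cone_min T p) \<le> Ehat X + e"
proof -
  obtain K0 F L0 where *: "0 \<le> K0" "\<And>\<omega>. \<bar>X \<omega>\<bar> \<le> K0" "finite F" "F \<subseteq> dyadics T" "1 \<le> L0"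
    "\<And>\<omega> \<omega>'. \<bar>X \<omega> - X \<omega>'\<bar> \<le> L0 * (\<Sum>s\<in>F. \<bar>\<omega> s - \<omega>' s\<bar>)" using X by (rule cylinderE) blast
  obtain m where m: "F \<subseteq> dyadic_time T m ` {..2^m}" using dyadic_time_cover[OF *(3,4)] by blast
  let ?t = "dyadic_time T m"
  define n :: nat where "n = 2 ^ m + 1"
  obtain K :: nat where K0: "K0 \<le> real K" using real_arch_simple by blast
  obtain L :: nat where L0: "L0 \<le> real L" using real_arch_simple by blast
  have XK: "\<bar>X \<omega>\<bar> \<le> real K" for \<omega> using *(2)[of \<omega>] K0 by linarith
  have inj: "inj_on ?t {..2^m}" using T by (auto simp: inj_on_def dyadic_time_def)
  have XL: "\<bar>X \<omega> - X \<omega>'\<bar> \<le> real L * (\<Sum>k\<le>2^m. \<bar>\<omega> (?t k) - \<omega>' (?t k)\<bar>)" for \<omega> \<omega>'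
  proof -
    have "(\<Sum>s\<in>F. \<bar>\<omega> s - \<omega>' s\<bar>) \<le> (\<Sum>s\<in>?t ` {..2^m}. \<bar>\<omega> s - \<omega>' s\<bar>)"
      using m by (intro sum_mono2) auto
    also have "\<dots> = (\<Sum>k\<le>2^m. \<bar>\<omega> (?t k) - \<omega>' (?t k)\<bar>)" by (subst sum.reindex[OF inj]) simp
    finally have "L0 * (\<Sum>s\<in>F. \<bar>\<omega> s - \<omega>' s\<bar>) \<le> real L * (\<Sum>k\<le>2^m. \<bar>\<omega> (?t k) - \<omega>' (?t k)\<bar>)"
      using L0 by (intro mult_mono sum_nonneg) auto
    then show ?thesis using *(6)[of \<omega> \<omega>'] by linarith
  qed
  \<comment> \<open>The size of the box, chosen so that \<open>2 * K / R\<close> times the total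
    fourth moment is at most \<open>e / 2\<close>.\<close>
  obtain R0 :: nat where R0: "4 * K * (n * (C * T\<^sup>2)) / e \<le> real R0" using real_arch_simple by blast
  define R where "R = Suc R0"
  have R: "1 \<le> real R" "4 * K * (n * (C * T\<^sup>2)) / e \<le> real R" using R0 by (auto simp: R_def)
  \<comment> \<open>The mesh: rounding the height of a cone costs \<open>1 / Suc N\<close>, and
    displacing its vertex costs \<open>L * n / Suc N\<close> twice, once in the height and once in
    the distance.\<close>
  obtain N :: nat where N: "2 * (1 + 2 * real L * n) / e \<le> real N" using real_arch_simple by blast
  let ?N = "real (Suc N)"
  \<comment> \<open>Bound for the numerators of the vertices, with room for rounding down at the
    edge of the box.\<close>
  define A where "A = int (Suc N * (R + 1))"
  define Q where "Q = {q :: int list. set q \<subseteq> {-A..A} \<and> length q = n}"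
  have finQ: "finite Q" unfolding Q_def by (rule finite_lists_length_eq) simp
  \<comment> \<open>A step path through the vertex \<open>q\<close>, needed to evaluate
    \<open>X\<close> there; rounding the height up in \<open>r\<close> keeps every cone above
    \<open>X\<close>.\<close>
  define pq where "pq q s = real_of_int (q ! nat \<lfloor>s / T * 2 ^ m\<rfloor>) / ?N" for q :: "int list" and s
  define r where "r q = \<lceil>?N * X (pq q)\<rceil>" for q
  have pq_t: "pq q (?t k) = real_of_int (q ! k) / ?N" for q k
  proof -
    have "?t k / T * 2 ^ m = real_of_int (int k)" using T by (simp add: dyadic_time_def)
    then have "\<lfloor>?t k / T * 2 ^ m\<rfloor> = int k" by (simp only: floor_of_int)
    then show ?thesis by (simp add: pq_def)
  qed
  have r: "X (pq q) \<le> real_of_int (r q) / ?N" "real_of_int (r q) / ?N \<le> X (pq q) + 1 / ?N" for q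
  proof -
    have "?N * X (pq q) \<le> real_of_int (r q)" "real_of_int (r q) \<le> ?N * X (pq q) + 1" unfolding r_def by linarith+
    then show "X (pq q) \<le> real_of_int (r q) / ?N" "real_of_int (r q) / ?N \<le> X (pq q) + 1 / ?N"
      by (simp_all add: field_simps del: of_nat_Suc)
  qed
  have "finite ((\<lambda>q. (q, r q)) ` Q)" using finQ by (rule finite_imageI)
  from finite_list[OF this] obtain ps where ps: "set ps = (\<lambda>q. (q, r q)) ` Q" by (elim exE)
  define p where "p = (m, L, K, N, ps)"
  define h where "h \<omega> p = real_of_int (snd p) / ?N +
        real L * (\<Sum>k\<le>2^m. \<bar>\<omega> (?t k) - real_of_int (fst p ! k) / ?N\<bar>)"
    for \<omega> :: "real \<Rightarrow> real" and p :: "int list \<times> int"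
  have eq: "cone_min T p \<omega> = max (- real K) (foldr (\<lambda>p. min (h \<omega> p)) ps (real K))" for \<omega>
    unfolding p_def cone_min_def h_def by (simp only: prod.case)
  have above: "X \<omega> \<le> cone_min T p \<omega>" for \<omega>
  proof -
    have "X \<omega> \<le> h \<omega> (q, r q)" for q
      using XL[of \<omega> "pq q"] r(1)[of q] unfolding h_def pq_t by simp
    then have "X \<omega> \<le> foldr (\<lambda>p. min (h \<omega> p)) ps (real K)"
      unfolding le_foldr_min using XK[of \<omega>] ps by auto
    then show ?thesis unfolding eq by simp
  qed
  have leK: "cone_min T p \<omega> \<le> real K" for \<omega>
  proof -
    have "foldr (\<lambda>p. min (h \<omega> p)) ps (real K) \<le> real K"
      using le_foldr_min[of "foldr (\<lambda>p. min (h \<omega> p)) ps (real K)" "h \<omega>" ps "real K"] by blast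
    then show ?thesis unfolding eq by (simp only: max.bounded_iff) simp
  qed
  let ?W = "\<lambda>\<omega> :: real \<Rightarrow> real. \<Sum>k\<le>2^m. (min (real R) \<bar>\<omega> (?t k)\<bar>) ^ 4"
  have below: "cone_min T p \<omega> \<le> X \<omega> + (e / 2 + (2 * K / R ^ 4) * ?W \<omega>)" for \<omega>
  proof (cases "\<forall>k\<le>2^m. \<bar>\<omega> (?t k)\<bar> \<le> real R")
    case True
    define q where "q = map (\<lambda>k. \<lfloor>?N * \<omega> (?t k)\<rfloor>) [0..<n]"
    have qk: "q ! k = \<lfloor>?N * \<omega> (?t k)\<rfloor>" if "k \<le> 2^m" for k
    proof -
      have "k < n" using that by (simp add: n_def)
      then have "k < length [0..<n]" "[0..<n] ! k = k" by simp_all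
      then show ?thesis unfolding q_def by (simp only: nth_map)
    qed
    have "set q \<subseteq> {-A..A}"
    proof
      fix z assume "z \<in> set q"
      then obtain k where "k < n" and k2: "z = \<lfloor>?N * \<omega> (?t k)\<rfloor>"
        unfolding q_def set_map set_upt by fastforce
      have k1: "k \<le> 2^m" using \<open>k < n\<close> by (simp add: n_def)
      note k = k1 k2
      have "\<bar>?N * \<omega> (?t k)\<bar> \<le> ?N * real R" using True k(1) by (simp add: abs_mult del: of_nat_Suc)
      moreover have "real_of_int A = ?N * real R + ?N" by (simp add: A_def algebra_simps)
      moreover have "1 \<le> ?N" by simp
      moreover have "- a \<le> x \<and> x \<le> a" if "\<bar>x\<bar> \<le> b" "a = b + c" "1 \<le> c" for a b c x :: real
        using that by linarith
      ultimately have "- real_of_int A \<le> ?N * \<omega> (?t k)" "?N * \<omega> (?t k) \<le> real_of_int A" by blast+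
      then show "z \<in> {-A..A}" unfolding k(2) by (auto simp: le_floor_iff floor_le_iff)
    qed
    then have "q \<in> Q" by (simp add: Q_def q_def)
    then have "(q, r q) \<in> set ps" using ps by blast
    from foldr_min_le[OF this] have "foldr (\<lambda>p. min (h \<omega> p)) ps (real K) \<le> h \<omega> (q, r q)" .
    also have "\<dots> \<le> X \<omega> + e / 2"
    proof -
      have "\<bar>\<omega> (?t k) - real_of_int (q ! k) / ?N\<bar> \<le> 1 / ?N" if "k \<le> 2^m" for k
      proof -
        have "\<bar>?N * \<omega> (?t k) - real_of_int (q ! k)\<bar> \<le> 1" unfolding qk[OF that] by linarith
        then have "\<bar>?N * \<omega> (?t k) - real_of_int (q ! k)\<bar> / ?N \<le> 1 / ?N" by (rule divide_right_mono) simp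
        moreover have "\<bar>?N * \<omega> (?t k) - real_of_int (q ! k)\<bar> / ?N = \<bar>(?N * \<omega> (?t k) - real_of_int (q ! k)) / ?N\<bar>"
          by (simp only: abs_divide abs_of_nat)
        ultimately show ?thesis by (simp add: diff_divide_distrib del: of_nat_Suc)
      qed
      then have "(\<Sum>k\<le>2^m. \<bar>\<omega> (?t k) - real_of_int (q ! k) / ?N\<bar>) \<le> (\<Sum>k\<le>(2::nat)^m. 1 / ?N)" by (intro sum_mono) auto
      also have "\<dots> = n / ?N" by (simp add: n_def)
      finally have d: "real L * (\<Sum>k\<le>2^m. \<bar>\<omega> (?t k) - real_of_int (q ! k) / ?N\<bar>) \<le> real L * (n / ?N)"
        by (intro mult_left_mono) auto
      have "X (pq q) \<le> X \<omega> + real L * (n / ?N)" using XL[of \<omega> "pq q"] d unfolding pq_t by linarith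
      then have "h \<omega> (q, r q) \<le> X \<omega> + (1 / ?N + 2 * (real L * (n / ?N)))"
        using r(2)[of q] d unfolding h_def by simp
      moreover have "1 / ?N + 2 * (real L * (n / ?N)) = (1 + 2 * real L * n) / ?N" by (simp add: add_divide_distrib)
      moreover have "(1 + 2 * real L * n) / ?N \<le> e / 2"
        using N e by (simp add: field_simps)
      ultimately show ?thesis by linarith
    qed
    finally have "foldr (\<lambda>p. min (h \<omega> p)) ps (real K) \<le> X \<omega> + e / 2" .
    moreover have "- real K \<le> X \<omega> + e / 2" using XK[of \<omega>] e by linarith
    ultimately have "cone_min T p \<omega> \<le> X \<omega> + e / 2" unfolding eq by simp
    moreover have "0 \<le> (2 * K / R ^ 4) * ?W \<omega>" by (intro mult_nonneg_nonneg sum_nonneg) auto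
    ultimately show ?thesis by linarith
  next
    case False
    then obtain k where k: "k \<le> 2^m" "real R < \<bar>\<omega> (?t k)\<bar>" by force
    have "real R ^ 4 = (min (real R) \<bar>\<omega> (?t k)\<bar>) ^ 4" using k by simp
    also have "\<dots> \<le> ?W \<omega>" using k(1) by (intro member_le_sum) auto
    finally have "2 * K / R ^ 4 * real R ^ 4 \<le> (2 * K / R ^ 4) * ?W \<omega>" by (intro mult_left_mono) auto
    then have "2 * K \<le> (2 * K / R ^ 4) * ?W \<omega>" using R by simp
    then show ?thesis using leK[of \<omega>] XK[of \<omega>] e by linarith
  qed
  have tin: "?t k \<in> {0..T}" if "k \<le> 2^m" for k using dyadic_time_in[OF that, of T] dyadics_subset[OF T] by blast
  have cylV: "cylinder {0..T} (\<lambda>\<omega>. (min (real R) \<bar>\<omega> (?t k)\<bar>) ^ 4)" if "k \<in> {..2^m}" for k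
    using that tin by (intro cylinder_power cylinder_coordinate) auto
  have cylW: "cylinder {0..T} ?W" by (intro cylinder_sum cylV)
  have X': "cylinder {0..T} X" by (rule cylinder_dyadics[OF X])
  have EW: "Ehat ?W \<le> real n * (C * T\<^sup>2)"
  proof -
    have "Ehat ?W \<le> (\<Sum>k\<le>2^m. Ehat (\<lambda>\<omega>. (min (real R) \<bar>\<omega> (?t k)\<bar>) ^ 4))" by (intro E_sum cylV)
    also have "\<dots> \<le> (\<Sum>k\<le>(2::nat)^m. C * T\<^sup>2)"
    proof (rule sum_mono)
      fix k :: nat assume "k \<in> {..2^m}"
      then have k: "?t k \<in> {0..T}" using tin by simp
      have "Ehat (\<lambda>\<omega>. (min (real R) \<bar>\<omega> (?t k)\<bar>) ^ 4) \<le> C * (?t k)\<^sup>2" by (rule moment_value[OF k]) simp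
      also have "\<dots> \<le> C * T\<^sup>2" using k C by (intro mult_left_mono power_mono) auto
      finally show "Ehat (\<lambda>\<omega>. (min (real R) \<bar>\<omega> (?t k)\<bar>) ^ 4) \<le> C * T\<^sup>2" .
    qed
    also have "\<dots> = real n * (C * T\<^sup>2)" by (simp add: n_def)
    finally show ?thesis .
  qed
  have "Ehat (cone_min T p) \<le> Ehat (\<lambda>\<omega>. X \<omega> + (e / 2 + (2 * K / R ^ 4) * ?W \<omega>))"
    by (intro E_mono below cylinder_add cylinder_cmult cylinder_const X' cylW cylinder_dyadics[OF cylinder_cone_min])
  also have "\<dots> \<le> Ehat X + Ehat (\<lambda>\<omega>. e / 2 + (2 * K / R ^ 4) * ?W \<omega>)"
    by (intro E_add X' cylinder_add cylinder_cmult cylinder_const cylW)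
  also have "Ehat (\<lambda>\<omega>. e / 2 + (2 * K / R ^ 4) * ?W \<omega>) \<le> e / 2 + Ehat (\<lambda>\<omega>. (2 * K / R ^ 4) * ?W \<omega>)"
    using E_add[OF cylinder_const[of _ "e / 2"] cylinder_cmult[OF cylW, of "2 * K / R ^ 4"]] by (simp add: E_const)
  also have "Ehat (\<lambda>\<omega>. (2 * K / R ^ 4) * ?W \<omega>) = (2 * K / R ^ 4) * Ehat ?W"
    by (intro E_scale cylW) simp
  also have "(2 * K / R ^ 4) * Ehat ?W \<le> (2 * K / R ^ 4) * (real n * (C * T\<^sup>2))"
    by (intro mult_left_mono EW) simp
  also have "\<dots> \<le> (2 * K / R) * (real n * (C * T\<^sup>2))"
    using R C power_increasing[of 1 4 "real R"] by (intro mult_right_mono frac_le) auto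
  also have "\<dots> \<le> e / 2"
    using R e by (simp add: field_simps)
  finally show ?thesis using above by (intro exI[of _ p]) simp
qed

text \<open>Countably many constraints are enough: the measure with index \<open>n\<close> satisfies
  the first \<open>n\<close> of them up to \<open>1 / Suc n\<close>, and every dyadic cylinder
  function lies below a cone minimum of almost the same expectation. This is domination in the
  limit, and compactness makes it exact.\<close>

lemma dominated_nonempty: "dominated_on_L_ip T Ehat \<noteq> {}"
proof -
  define g where "g j = cone_min T (from_nat j)" for j
  have g: "cylinder {0..T} (g j)" for j unfolding g_def by (rule cylinder_dyadics[OF cylinder_cone_min])
  have "\<exists>P. prob_space P \<and> sets P = sets (path_borel T) \<and> (\<forall>i<n. integral\<^sup>L P (g i) \<le> Ehat (g i) + 1 / Suc n)" for n
    by (rule finite_domination[OF g]) simp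
  then obtain P where P: "\<And>n. prob_space (P n)" "\<And>n. sets (P n) = sets (path_borel T)"
      "\<And>n i. i < n \<Longrightarrow> integral\<^sup>L (P n) (g i) \<le> Ehat (g i) + 1 / Suc n"
    by metis
  have dom: "\<forall>\<^sub>F n in sequentially. integral\<^sup>L (P n) X \<le> Ehat X + e" if X: "cylinder (dyadics T) X" and e: "0 < e" for X e
  proof -
    have "0 < e / 2" using e by simp
    from cone_min_approx[OF X this]
    obtain p where p: "\<And>\<omega>. X \<omega> \<le> cone_min T p \<omega>" "Ehat (cone_min T p) \<le> Ehat X + e / 2"
      by blast
    have gp: "g (to_nat p) = cone_min T p" by (simp add: g_def)
    obtain N where N: "1 / real (Suc N) < e / 2" using e by (metis half_gt_zero nat_approx_posE)
    show ?thesis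
    proof (rule eventually_sequentiallyI[of "max (Suc N) (Suc (to_nat p))"])
      fix n assume n: "max (Suc N) (Suc (to_nat p)) \<le> n"
      have "integral\<^sup>L (P n) X \<le> integral\<^sup>L (P n) (cone_min T p)"
        by (intro integral_mono cylinder_integrable[OF T0 P(1,2)] cylinder_dyadics[OF X]
              cylinder_dyadics[OF cylinder_cone_min] p(1))
      also have "\<dots> \<le> Ehat (cone_min T p) + 1 / Suc n" using P(3)[of "to_nat p" n] n by (simp add: gp)
      also have "1 / real (Suc n) \<le> 1 / real (Suc N)" using n by (intro frac_le) auto
      finally show "integral\<^sup>L (P n) X \<le> Ehat X + e" using p(2) N by linarith
    qed
  qed
  show ?thesis by (rule sequential_compactness[OF P(1,2), OF dom]) auto
qed

end

section \<open>Wasserstein distance and Lions' derivative\<close>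

lemma W2_le:
  assumes "\<pi> \<in> couplings \<mu> \<nu>"
  shows "W2 \<mu> \<nu> \<le> sqrt (\<integral>z. (dist (fst z) (snd z))\<^sup>2 \<partial>\<pi>)"
proof -
  have "bdd_below ((\<lambda>\<pi>. \<integral>z. (dist (fst z) (snd z))\<^sup>2 \<partial>\<pi>) ` couplings \<mu> \<nu>)"
    by (rule bdd_belowI2[of _ 0]) simp
  then have "(INF \<pi>\<in>couplings \<mu> \<nu>. \<integral>z. (dist (fst z) (snd z))\<^sup>2 \<partial>\<pi>) \<le> (\<integral>z. (dist (fst z) (snd z))\<^sup>2 \<partial>\<pi>)"
    using assms by (rule cINF_lower)
  then show ?thesis unfolding W2_def by (rule real_sqrt_le_mono)
qed

lemma borel_measurable_fst [measurable]:
  "fst \<in> borel_measurable (borel :: ('a::euclidean_space \<times> 'b::euclidean_space) measure)"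
  by (intro borel_measurable_continuous_onI continuous_intros)

lemma borel_measurable_snd [measurable]:
  "snd \<in> borel_measurable (borel :: ('a::euclidean_space \<times> 'b::euclidean_space) measure)"
  by (intro borel_measurable_continuous_onI continuous_intros)

lemma law_coupling:
  fixes U U' :: "'w \<Rightarrow> 'a::euclidean_space"
  assumes "prob_space M" and [measurable]: "U \<in> borel_measurable M" "U' \<in> borel_measurable M"
  shows "distr M borel (\<lambda>w. (U w, U' w)) \<in> couplings (distr M borel U) (distr M borel U')"
proof -
  interpret prob_space M by fact
  show ?thesis
    unfolding couplings_def using borel_measurable_fst[where 'a='a and 'b='a] borel_measurable_snd[where 'a='a and 'b='a]
    by (auto simp: distr_distr comp_def intro!: prob_space_distr)
qed

lemma W2_law_le:
  fixes U U' :: "'w \<Rightarrow> 'a::euclidean_space"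
  assumes "prob_space M" and [measurable]: "U \<in> borel_measurable M" "U' \<in> borel_measurable M"
  shows "W2 (distr M borel U) (distr M borel U') \<le> sqrt (\<integral>w. (dist (U w) (U' w))\<^sup>2 \<partial>M)"
proof -
  have "(\<lambda>z :: 'a \<times> 'a. (dist (fst z) (snd z))\<^sup>2) \<in> borel_measurable borel"
    by (intro borel_measurable_continuous_onI continuous_intros)
  then show ?thesis using W2_le[OF law_coupling[OF assms]] by (simp add: integral_distr)
qed

lemma law_in_P2:
  fixes U :: "'w \<Rightarrow> 'a::euclidean_space"
  assumes "prob_space M" and [measurable]: "U \<in> borel_measurable M" and "integrable M (\<lambda>w. (norm (U w))\<^sup>2)"
  shows "distr M borel U \<in> P2"
proof -
  interpret prob_space M by fact
  show ?thesis
    using assms(3) unfolding P2_def by (auto simp: integrable_distr_eq intro!: prob_space_distr)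
qed

lemma W2_self: "prob_space \<mu> \<Longrightarrow> sets \<mu> = sets borel \<Longrightarrow> W2 \<mu> (\<mu> :: 'a::euclidean_space measure) \<le> 0"
proof -
  assume "prob_space \<mu>" and s: "sets \<mu> = sets borel"
  moreover have "(\<lambda>x. x) \<in> borel_measurable \<mu>" using s by (simp add: measurable_cong_sets[OF s refl])
  moreover have "distr \<mu> borel (\<lambda>x. x) = \<mu>" by (rule distr_id2) (use s in simp)
  ultimately show ?thesis using W2_law_le[of \<mu> "\<lambda>x. x" "\<lambda>x. x"] by simp
qed

section \<open>Mixtures of laws and of couplings\<close>

lemma sets_mixture [simp, measurable_cong]: "sets (mixture l \<mu> \<nu>) = sets (borel :: 'a::euclidean_space measure)"
  using sets.sets_measure_of_eq[of "borel :: 'a measure"] by (simp add: mixture_def)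

lemma space_mixture [simp]: "space (mixture l \<mu> (\<nu> :: 'a::euclidean_space measure)) = UNIV"
  using sets_eq_imp_space_eq[OF sets_mixture, of l \<mu> \<nu>] by simp

lemma emeasure_mixture:
  fixes \<mu> \<nu> :: "'a::euclidean_space measure"
  assumes "sets \<mu> = sets borel" "sets \<nu> = sets borel" "A \<in> sets borel"
  shows "emeasure (mixture l \<mu> \<nu>) A = ennreal (1 - l) * emeasure \<mu> A + ennreal l * emeasure \<nu> A"
  unfolding mixture_def
proof (rule emeasure_measure_of_sigma)
  show "sigma_algebra UNIV (sets (borel :: 'a measure))" using sets.sigma_algebra_axioms[of "borel :: 'a measure"] by simp
  show "positive (sets borel) (\<lambda>A. ennreal (1 - l) * emeasure \<mu> A + ennreal l * emeasure \<nu> A)"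
    by (simp add: positive_def)
  show "countably_additive (sets borel) (\<lambda>A. ennreal (1 - l) * emeasure \<mu> A + ennreal l * emeasure \<nu> A)"
  proof (rule countably_additiveI)
    fix F :: "nat \<Rightarrow> 'a set" assume F: "range F \<subseteq> sets borel" "disjoint_family F"
    have "(\<Sum>i. ennreal (1 - l) * emeasure \<mu> (F i) + ennreal l * emeasure \<nu> (F i))
        = (\<Sum>i. ennreal (1 - l) * emeasure \<mu> (F i)) + (\<Sum>i. ennreal l * emeasure \<nu> (F i))"
      by (intro suminf_add[symmetric] summableI)
    also have "\<dots> = ennreal (1 - l) * emeasure \<mu> (\<Union>i. F i) + ennreal l * emeasure \<nu> (\<Union>i. F i)"
      using F assms by (simp add: suminf_emeasure)
    finally show "(\<Sum>i. ennreal (1 - l) * emeasure \<mu> (F i) + ennreal l * emeasure \<nu> (F i))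
        = ennreal (1 - l) * emeasure \<mu> (\<Union>i. F i) + ennreal l * emeasure \<nu> (\<Union>i. F i)" .
  qed
qed fact

lemma nn_integral_mixture:
  fixes \<mu> \<nu> :: "'a::euclidean_space measure"
  assumes s: "sets \<mu> = sets borel" "sets \<nu> = sets borel" and f: "f \<in> borel_measurable borel"
  shows "(\<integral>\<^sup>+x. f x \<partial>mixture l \<mu> \<nu>) = ennreal (1 - l) * (\<integral>\<^sup>+x. f x \<partial>\<mu>) + ennreal l * (\<integral>\<^sup>+x. f x \<partial>\<nu>)"
proof -
  have sp: "space \<mu> = UNIV" "space \<nu> = UNIV" using s[THEN sets_eq_imp_space_eq] by auto
  have m: "g \<in> borel_measurable \<mu>" "g \<in> borel_measurable \<nu>" "g \<in> borel_measurable (mixture l \<mu> \<nu>)"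
    if "g \<in> borel_measurable borel" for g :: "'a \<Rightarrow> ennreal"
    using that measurable_cong_sets[OF s(1) refl] measurable_cong_sets[OF s(2) refl]
      measurable_cong_sets[OF sets_mixture refl] by auto
  show ?thesis
    using f
  proof (induction rule: borel_measurable_induct)
    case (cong f g)
    then have "f = g" by auto
    then show ?case using cong by simp
  next
    case (set A)
    then show ?case using emeasure_mixture[OF s, of A l] s by simp
  next
    case (mult u c)
    have "c * (a * x + b * y) = a * (c * x) + b * (c * y)" for a b x y :: ennreal
      by (simp add: distrib_left mult.left_commute)
    moreover have u: "u \<in> borel_measurable borel" by fact
    ultimately show ?case
      using mult.IH nn_integral_cmult[OF m(1)[OF u], of c] nn_integral_cmult[OF m(2)[OF u], of c]
        nn_integral_cmult[OF m(3)[OF u], of c] by (simp only:)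
  next
    case (add u v)
    have "(a * x + b * y) + (a * x' + b * y') = a * (x + x') + b * (y + y')" for a b x y x' y' :: ennreal
      by (simp add: distrib_left add.assoc add.left_commute)
    moreover have u: "u \<in> borel_measurable borel" and v: "v \<in> borel_measurable borel" by fact+
    ultimately show ?case
      using add.IH nn_integral_add[OF m(1)[OF v] m(1)[OF u]] nn_integral_add[OF m(2)[OF v] m(2)[OF u]]
        nn_integral_add[OF m(3)[OF v] m(3)[OF u]] by (simp only:)
  next
    case (seq U)
    have incU: "incseq U" and U: "\<And>i. U i \<in> borel_measurable borel" by fact+
    have inc: "incseq (\<lambda>i. \<integral>\<^sup>+x. U i x \<partial>N)" for N
      using incU by (auto simp: incseq_def le_fun_def intro!: nn_integral_mono)
    have sup: "(\<integral>\<^sup>+x. (SUP i. U i) x \<partial>N) = (SUP i. \<integral>\<^sup>+x. U i x \<partial>N)"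
      if "\<And>i. U i \<in> borel_measurable N" for N
      using nn_integral_monotone_convergence_SUP[OF incU that] by (simp add: image_comp)
    have "(\<integral>\<^sup>+x. (SUP i. U i) x \<partial>mixture l \<mu> \<nu>) = (SUP i. ennreal (1 - l) * (\<integral>\<^sup>+x. U i x \<partial>\<mu>) + ennreal l * (\<integral>\<^sup>+x. U i x \<partial>\<nu>))"
      unfolding sup[OF m(3)[OF U]] by (simp only: seq.IH)
    also have "\<dots> = (SUP i. ennreal (1 - l) * (\<integral>\<^sup>+x. U i x \<partial>\<mu>)) + (SUP i. ennreal l * (\<integral>\<^sup>+x. U i x \<partial>\<nu>))"
      using inc by (intro ennreal_SUP_add) (auto simp: incseq_def intro!: mult_left_mono)
    also have "\<dots> = ennreal (1 - l) * (SUP i. \<integral>\<^sup>+x. U i x \<partial>\<mu>) + ennreal l * (SUP i. \<integral>\<^sup>+x. U i x \<partial>\<nu>)"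
      by (simp add: SUP_mult_left_ennreal)
    also have "\<dots> = ennreal (1 - l) * (\<integral>\<^sup>+x. (SUP i. U i) x \<partial>\<mu>) + ennreal l * (\<integral>\<^sup>+x. (SUP i. U i) x \<partial>\<nu>)"
      by (simp only: sup[OF m(1)[OF U]] sup[OF m(2)[OF U]])
    finally show ?case .
  qed
qed

lemma integral_mixture:
  fixes \<mu> \<nu> :: "'a::euclidean_space measure" and f :: "'a \<Rightarrow> real"
  assumes s: "sets \<mu> = sets borel" "sets \<nu> = sets borel" and l: "0 \<le> l" "l \<le> 1"
    and f: "integrable \<mu> f" "integrable \<nu> f"
  shows "integrable (mixture l \<mu> \<nu>) f"
    and "(\<integral>x. f x \<partial>mixture l \<mu> \<nu>) = (1 - l) * (\<integral>x. f x \<partial>\<mu>) + l * (\<integral>x. f x \<partial>\<nu>)"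
proof -
  have fm[measurable]: "f \<in> borel_measurable borel"
    using f(1) measurable_cong_sets[OF s(1) refl] by (auto dest: borel_measurable_integrable)
  have fin: "(\<integral>\<^sup>+x. ennreal \<bar>f x\<bar> \<partial>\<mu>) < \<infinity>" "(\<integral>\<^sup>+x. ennreal \<bar>f x\<bar> \<partial>\<nu>) < \<infinity>"
    using f by (auto simp: integrable_iff_bounded)
  show int: "integrable (mixture l \<mu> \<nu>) f"
  proof (rule integrableI_bounded)
    show "f \<in> borel_measurable (mixture l \<mu> \<nu>)" by measurable
    have "(\<integral>\<^sup>+x. ennreal (norm (f x)) \<partial>mixture l \<mu> \<nu>)
       = ennreal (1 - l) * (\<integral>\<^sup>+x. ennreal (norm (f x)) \<partial>\<mu>) + ennreal l * (\<integral>\<^sup>+x. ennreal (norm (f x)) \<partial>\<nu>)"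
      by (rule nn_integral_mixture[OF s]) measurable
    also have "\<dots> < \<infinity>" using fin by (simp add: ennreal_mult_less_top)
    finally show "(\<integral>\<^sup>+x. ennreal (norm (f x)) \<partial>mixture l \<mu> \<nu>) < \<infinity>" .
  qed
  have pos: "enn2real (\<integral>\<^sup>+x. ennreal (g x) \<partial>mixture l \<mu> \<nu>) =
      (1 - l) * enn2real (\<integral>\<^sup>+x. ennreal (g x) \<partial>\<mu>) + l * enn2real (\<integral>\<^sup>+x. ennreal (g x) \<partial>\<nu>)"
    if g[measurable]: "g \<in> borel_measurable borel" and le: "\<And>x. g x \<le> \<bar>f x\<bar>" for g
  proof -
    have "(\<integral>\<^sup>+x. ennreal (g x) \<partial>N) \<le> (\<integral>\<^sup>+x. ennreal \<bar>f x\<bar> \<partial>N)" for N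
      using le by (intro nn_integral_mono ennreal_leI)
    then have gf: "(\<integral>\<^sup>+x. ennreal (g x) \<partial>\<mu>) < \<top>" "(\<integral>\<^sup>+x. ennreal (g x) \<partial>\<nu>) < \<top>"
      using fin by (auto intro: le_less_trans)
    have "(\<integral>\<^sup>+x. ennreal (g x) \<partial>mixture l \<mu> \<nu>)
        = ennreal (1 - l) * (\<integral>\<^sup>+x. ennreal (g x) \<partial>\<mu>) + ennreal l * (\<integral>\<^sup>+x. ennreal (g x) \<partial>\<nu>)"
      by (rule nn_integral_mixture[OF s]) measurable
    then show ?thesis
      using gf l by (simp add: enn2real_plus enn2real_mult ennreal_mult_less_top)
  qed
  show "(\<integral>x. f x \<partial>mixture l \<mu> \<nu>) = (1 - l) * (\<integral>x. f x \<partial>\<mu>) + l * (\<integral>x. f x \<partial>\<nu>)"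
    using pos[of f] pos[of "\<lambda>x. - f x"]
    by (simp add: real_lebesgue_integral_def int f algebra_simps)
qed

lemma prob_space_mixture:
  fixes \<mu> \<nu> :: "'a::euclidean_space measure"
  assumes "prob_space \<mu>" "prob_space \<nu>" "sets \<mu> = sets borel" "sets \<nu> = sets borel" "0 \<le> l" "l \<le> 1"
  shows "prob_space (mixture l \<mu> \<nu>)"
proof (rule prob_spaceI)
  have "emeasure \<mu> UNIV = 1" "emeasure \<nu> UNIV = 1"
    using prob_space.emeasure_space_1[OF assms(1)] prob_space.emeasure_space_1[OF assms(2)]
      assms(3,4)[THEN sets_eq_imp_space_eq] by auto
  then have "emeasure (mixture l \<mu> \<nu>) UNIV = ennreal (1 - l) + ennreal l"
    using assms by (subst emeasure_mixture) auto
  then show "emeasure (mixture l \<mu> \<nu>) (space (mixture l \<mu> \<nu>)) = 1"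
    using assms by (simp add: ennreal_plus[symmetric] del: ennreal_plus)
qed

lemma mixture_P2:
  assumes "\<mu> \<in> P2" "\<nu> \<in> P2" "0 \<le> l" "l \<le> 1"
  shows "mixture l \<mu> \<nu> \<in> P2"
  using assms unfolding P2_def by (auto intro!: prob_space_mixture integral_mixture(1))

lemma mixture_0: "sets \<mu> = sets borel \<Longrightarrow> sets \<nu> = sets borel \<Longrightarrow> mixture 0 \<mu> \<nu> = (\<mu> :: 'a::euclidean_space measure)"
  by (rule measure_eqI) (auto simp: emeasure_mixture)

lemma mixture_1: "sets \<mu> = sets borel \<Longrightarrow> sets \<nu> = sets borel \<Longrightarrow> mixture 1 \<mu> \<nu> = (\<nu> :: 'a::euclidean_space measure)"
  by (rule measure_eqI) (auto simp: emeasure_mixture)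

lemma mixture_same:
  assumes "sets \<mu> = sets borel" "0 \<le> l" "l \<le> 1"
  shows "mixture l \<mu> \<mu> = (\<mu> :: 'a::euclidean_space measure)"
proof (rule measure_eqI)
  fix A assume "A \<in> sets (mixture l \<mu> \<mu>)"
  then have "emeasure (mixture l \<mu> \<mu>) A = (ennreal (1 - l) + ennreal l) * emeasure \<mu> A"
    using assms by (simp add: emeasure_mixture distrib_right)
  then show "emeasure (mixture l \<mu> \<mu>) A = emeasure \<mu> A"
    using assms by (simp add: ennreal_plus[symmetric] del: ennreal_plus)
qed (use assms in simp)

text \<open>Going from the mixture at \<open>l\<close> a fraction \<open>h\<close> of the remaining
  way towards \<open>\<nu>\<close>. In this way a right derivative at an inner point of the segment
  becomes a right derivative at 0 from a new base law.\<close>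

lemma mixture_mixture:
  fixes \<mu> \<nu> :: "'a::euclidean_space measure"
  assumes "sets \<mu> = sets borel" "sets \<nu> = sets borel" "0 \<le> l" "l \<le> 1" "0 \<le> h" "h \<le> 1"
  shows "mixture h (mixture l \<mu> \<nu>) \<nu> = mixture (l + h * (1 - l)) \<mu> \<nu>"
proof (rule measure_eqI)
  fix A assume "A \<in> sets (mixture h (mixture l \<mu> \<nu>) \<nu>)"
  then have A: "A \<in> sets borel" by simp
  let ?a = "emeasure \<mu> A" and ?b = "emeasure \<nu> A"
  have "emeasure (mixture h (mixture l \<mu> \<nu>) \<nu>) A
      = ennreal (1 - h) * (ennreal (1 - l) * ?a + ennreal l * ?b) + ennreal h * ?b"
    using A assms by (simp add: emeasure_mixture)
  also have "\<dots> = (ennreal (1 - h) * ennreal (1 - l)) * ?a + (ennreal (1 - h) * ennreal l + ennreal h) * ?b"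
    by (simp add: distrib_left distrib_right mult.assoc add.assoc)
  also have "ennreal (1 - h) * ennreal (1 - l) = ennreal (1 - (l + h * (1 - l)))"
    using assms by (simp add: ennreal_mult[symmetric] algebra_simps)
  also have "ennreal (1 - h) * ennreal l + ennreal h = ennreal (l + h * (1 - l))"
  proof -
    have "0 \<le> (1 - h) * l" using assms by simp
    then have "ennreal ((1 - h) * l + h) = ennreal ((1 - h) * l) + ennreal h" using assms by (intro ennreal_plus)
    moreover have "ennreal ((1 - h) * l) = ennreal (1 - h) * ennreal l" using assms by (intro ennreal_mult) auto
    moreover have "(1 - h) * l + h = l + h * (1 - l)" by (simp add: algebra_simps)
    ultimately show ?thesis by (simp only:)
  qed
  finally show "emeasure (mixture h (mixture l \<mu> \<nu>) \<nu>) A = emeasure (mixture (l + h * (1 - l)) \<mu> \<nu>) A"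
    using A assms by (simp add: emeasure_mixture)
qed simp

lemma distr_mixture:
  fixes \<mu> \<nu> :: "'a::euclidean_space measure" and h :: "'a \<Rightarrow> 'b::euclidean_space"
  assumes s: "sets \<mu> = sets borel" "sets \<nu> = sets borel" and h: "h \<in> borel_measurable borel"
  shows "distr (mixture l \<mu> \<nu>) borel h = mixture l (distr \<mu> borel h) (distr \<nu> borel h)"
proof (rule measure_eqI)
  fix A assume "A \<in> sets (distr (mixture l \<mu> \<nu>) borel h)"
  then have A: "A \<in> sets borel" by simp
  have h': "h \<in> borel_measurable \<mu>" "h \<in> borel_measurable \<nu>" "h \<in> borel_measurable (mixture l \<mu> \<nu>)"
    using h measurable_cong_sets[OF s(1) refl] measurable_cong_sets[OF s(2) refl]
      measurable_cong_sets[OF sets_mixture refl] by auto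
  have "h -` A \<in> sets borel" using measurable_sets[OF h A] by simp
  moreover have "space \<mu> = UNIV" "space \<nu> = UNIV" using s[THEN sets_eq_imp_space_eq] by auto
  ultimately show "emeasure (distr (mixture l \<mu> \<nu>) borel h) A = emeasure (mixture l (distr \<mu> borel h) (distr \<nu> borel h)) A"
    using A h' s by (simp add: emeasure_mixture emeasure_distr)
qed simp

text \<open>Mixing couplings mixes their costs linearly, which bounds \<open>W2\<close> between
  mixtures without optimal couplings.\<close>

lemma mixture_couplings:
  fixes \<alpha> \<alpha>' \<beta> \<beta>' :: "'a::euclidean_space measure"
  assumes "\<pi> \<in> couplings \<alpha> \<alpha>'" "\<kappa> \<in> couplings \<beta> \<beta>'" "0 \<le> l" "l \<le> 1"
  shows "mixture l \<pi> \<kappa> \<in> couplings (mixture l \<alpha> \<beta>) (mixture l \<alpha>' \<beta>')"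
proof -
  have "fst \<in> borel_measurable (borel :: ('a \<times> 'a) measure)" "snd \<in> borel_measurable (borel :: ('a \<times> 'a) measure)"
    by (intro borel_measurable_continuous_onI continuous_intros)+
  then show ?thesis
    using assms unfolding couplings_def by (auto simp: distr_mixture prob_space_mixture)
qed

section \<open>Taylor expansion of the functional at a law\<close>

text \<open>Only right derivatives are at hand, so the mean value theorem is replaced by a supremum
  argument: beyond the largest \<open>t\<close> with \<open>g t - g 0 \<le> (B + e) * t\<close>, the
  right derivative there would still allow a further step.\<close>

lemma right_derivative_bound:
  fixes g :: "real \<Rightarrow> real"
  assumes g: "continuous_on {0..1} g"
    and deriv: "\<And>l. 0 \<le> l \<Longrightarrow> l < 1 \<Longrightarrow> ((\<lambda>k. (g (l + k) - g l) / k) \<longlongrightarrow> G l) (at_right 0)"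
    and G: "\<And>l. 0 \<le> l \<Longrightarrow> l < 1 \<Longrightarrow> G l \<le> B"
  shows "g 1 - g 0 \<le> B"
proof (rule field_le_epsilon)
  fix e :: real assume e: "0 < e"
  define S where "S = {t \<in> {0..1}. g t - g 0 - (B + e) * t \<in> {..0}}"
  have "continuous_on {0..1} (\<lambda>t. g t - g 0 - (B + e) * t)" using g by (intro continuous_intros)
  then have "closed ({0..1} \<inter> (\<lambda>t. g t - g 0 - (B + e) * t) -` {..0})"
    by (intro continuous_closed_preimage) auto
  moreover have "{0..1} \<inter> (\<lambda>t. g t - g 0 - (B + e) * t) -` {..0} = S" by (auto simp: S_def)
  ultimately have "closed S" by simp
  moreover have "0 \<in> S" by (simp add: S_def)
  moreover have bdd: "bdd_above S" by (rule bdd_aboveI[of _ 1]) (simp add: S_def)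
  ultimately have s: "Sup S \<in> S" by (intro closed_contains_Sup) auto
  show "g 1 - g 0 \<le> B + e"
  proof (cases "Sup S < 1")
    case False
    then have "Sup S = 1" using s by (simp add: S_def)
    then show ?thesis using s by (simp add: S_def)
  next
    case True
    let ?s = "Sup S"
    have s0: "0 \<le> ?s" using s by (simp add: S_def)
    have "\<forall>\<^sub>F k in at_right 0. (g (?s + k) - g ?s) / k < B + e"
      using G[OF s0 True] e by (intro order_tendstoD(2)[OF deriv[OF s0 True]]) linarith
    moreover have "\<forall>\<^sub>F k in at_right 0. 0 < k \<and> k < 1 - ?s"
      using True by (intro eventually_mono[OF eventually_at_right_real[of 0 "1 - ?s"]]) auto
    ultimately have "\<forall>\<^sub>F k in at_right 0. 0 < k \<and> k < 1 - ?s \<and> (g (?s + k) - g ?s) / k < B + e"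
      by eventually_elim auto
    from eventually_happens'[OF trivial_limit_at_right_real this]
    obtain k where k: "0 < k" "k < 1 - ?s" "(g (?s + k) - g ?s) / k < B + e" by (elim exE conjE)
    then have "g (?s + k) - g ?s \<le> (B + e) * k" by (simp add: divide_less_eq)
    then have "?s + k \<in> S" using s k s0 by (simp add: S_def algebra_simps)
    then have "?s + k \<le> ?s" using bdd by (rule cSup_upper)
    then show ?thesis using k by simp
  qed
qed

lemma norm_sq_add_le: "(norm (x + y))\<^sup>2 \<le> 2 * (norm x)\<^sup>2 + 2 * (norm (y :: 'a::real_inner))\<^sup>2"
proof -
  have "(norm (x + y))\<^sup>2 \<le> (norm x + norm y)\<^sup>2" by (intro power_mono norm_triangle_ineq) simp
  also have "\<dots> \<le> 2 * (norm x)\<^sup>2 + 2 * (norm y)\<^sup>2"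
    using sum_squares_bound[of "norm x" "norm y"] by (simp add: power2_sum)
  finally show ?thesis .
qed

lemma square_integrable_add:
  fixes U V :: "'w \<Rightarrow> 'a::euclidean_space"
  assumes [measurable]: "U \<in> borel_measurable M" "V \<in> borel_measurable M"
    and "integrable M (\<lambda>w. (norm (U w))\<^sup>2)" "integrable M (\<lambda>w. (norm (V w))\<^sup>2)"
  shows "integrable M (\<lambda>w. (norm (U w + V w))\<^sup>2)"
proof (rule Bochner_Integration.integrable_bound)
  show "integrable M (\<lambda>w. 2 * (norm (U w))\<^sup>2 + 2 * (norm (V w))\<^sup>2)" using assms by auto
qed (use norm_sq_add_le in auto)

lemma square_integrable_scaleR:
  fixes V :: "'w \<Rightarrow> 'a::euclidean_space"
  assumes "integrable M (\<lambda>w. (norm (V w))\<^sup>2)"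
  shows "integrable M (\<lambda>w. (norm (c *\<^sub>R V w))\<^sup>2)"
  using assms by (simp add: power_mult_distrib)

lemma square_integrable_diff:
  fixes U V :: "'w \<Rightarrow> 'a::euclidean_space"
  assumes "U \<in> borel_measurable M" "V \<in> borel_measurable M"
    and "integrable M (\<lambda>w. (norm (U w))\<^sup>2)" "integrable M (\<lambda>w. (norm (V w))\<^sup>2)"
  shows "integrable M (\<lambda>w. (norm (U w - V w))\<^sup>2)"
  using square_integrable_add[of U M "\<lambda>w. - V w"] assms by simp

locale Lions_differentiable =
  fixes f :: "'a::euclidean_space measure \<Rightarrow> real" and D :: "'a measure \<Rightarrow> 'a \<Rightarrow> 'a" and Cf C :: real
    and dm :: "'a measure \<Rightarrow> 'a \<Rightarrow> real"
  assumes Cf: "0 < Cf" and f_Lipschitz: "\<And>\<mu> \<nu>. \<mu> \<in> P2 \<Longrightarrow> \<nu> \<in> P2 \<Longrightarrow> \<bar>f \<mu> - f \<nu>\<bar> \<le> Cf * W2 \<mu> \<nu>"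
    and C: "0 < C" and D_Lipschitz: "\<And>\<mu> \<nu> y z. \<mu> \<in> P2 \<Longrightarrow> \<nu> \<in> P2 \<Longrightarrow> dist (D \<mu> y) (D \<nu> z) \<le> C * (W2 \<mu> \<nu> + dist y z)"
    and dm_deriv: "\<And>\<mu> y. \<mu> \<in> P2 \<Longrightarrow> GDERIV (dm \<mu>) y :> D \<mu> y"
    and dm_integrable: "\<And>\<mu> \<nu>. \<mu> \<in> P2 \<Longrightarrow> \<nu> \<in> P2 \<Longrightarrow> integrable \<nu> (dm \<mu>)"
    and f_deriv: "\<And>\<mu> \<nu>. \<mu> \<in> P2 \<Longrightarrow> \<nu> \<in> P2 \<Longrightarrow>
      ((\<lambda>l. (f (mixture l \<mu> \<nu>) - f \<mu>) / l) \<longlongrightarrow> (\<integral>y. dm \<mu> y \<partial>\<nu>) - (\<integral>y. dm \<mu> y \<partial>\<mu>)) (at_right 0)"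

lemma Lions_differentiableI:
  assumes "W2_Lipschitz f" "has_Lions_derivative f D" "Lipschitz_derivative D"
  shows "\<exists>Cf C dm. Lions_differentiable f D Cf C dm"
proof -
  obtain Cf where "0 < Cf" "\<forall>\<mu>\<in>P2. \<forall>\<nu>\<in>P2. \<bar>f \<mu> - f \<nu>\<bar> \<le> Cf * W2 \<mu> \<nu>"
    using assms(1) unfolding W2_Lipschitz_def by blast
  moreover obtain C where "0 < C" "\<forall>\<mu>\<in>P2. \<forall>\<nu>\<in>P2. \<forall>y z. dist (D \<mu> y) (D \<nu> z) \<le> C * (W2 \<mu> \<nu> + dist y z)"
    using assms(3) unfolding Lipschitz_derivative_def by blast
  moreover obtain dm where "\<forall>\<mu>\<in>P2. \<forall>y. GDERIV (dm \<mu>) y :> D \<mu> y" "\<forall>\<mu>\<in>P2. \<forall>\<nu>\<in>P2. integrable \<nu> (dm \<mu>)"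
    "\<forall>\<mu>\<in>P2. \<forall>\<nu>\<in>P2. ((\<lambda>l. (f (mixture l \<mu> \<nu>) - f \<mu>) / l) \<longlongrightarrow>
        (\<integral>y. dm \<mu> y \<partial>\<nu>) - (\<integral>y. dm \<mu> y \<partial>\<mu>)) (at_right 0)"
    using assms(2) unfolding has_Lions_derivative_def by blast
  ultimately have "Lions_differentiable f D Cf C dm" by unfold_locales blast+
  then show ?thesis by blast
qed

context Lions_differentiable
begin

lemma P2D: "\<mu> \<in> P2 \<Longrightarrow> prob_space \<mu>" "\<mu> \<in> P2 \<Longrightarrow> sets \<mu> = sets borel"
  by (auto simp: P2_def)

lemma D_Lipschitz_space: "\<mu> \<in> P2 \<Longrightarrow> norm (D \<mu> y - D \<mu> z) \<le> C * norm (y - z)"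
proof -
  assume \<mu>: "\<mu> \<in> P2"
  have "dist (D \<mu> y) (D \<mu> z) \<le> C * (W2 \<mu> \<mu> + dist y z)" by (rule D_Lipschitz[OF \<mu> \<mu>])
  also have "\<dots> \<le> C * (0 + dist y z)" using C W2_self[OF P2D[OF \<mu>]] by (intro mult_left_mono add_right_mono) auto
  finally show ?thesis by (simp add: dist_norm)
qed

lemma D_growth: "\<mu> \<in> P2 \<Longrightarrow> norm (D \<mu> y) \<le> norm (D \<mu> 0) + C * norm y"
  using D_Lipschitz_space[of \<mu> y 0] norm_triangle_ineq2[of "D \<mu> y" "D \<mu> 0"] by simp

lemma D_measurable: "\<mu> \<in> P2 \<Longrightarrow> D \<mu> \<in> borel_measurable borel"
proof (intro borel_measurable_continuous_onI lipschitz_on_continuous_on)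
  show "\<mu> \<in> P2 \<Longrightarrow> C-lipschitz_on UNIV (D \<mu>)"
    using C D_Lipschitz_space by (intro lipschitz_onI) (auto simp: dist_norm)
qed

lemma D_inner_integrable:
  fixes U V :: "'w \<Rightarrow> 'a"
  assumes M: "prob_space M" and [measurable]: "U \<in> borel_measurable M" "V \<in> borel_measurable M"
    and U: "integrable M (\<lambda>w. (norm (U w))\<^sup>2)" and V: "integrable M (\<lambda>w. (norm (V w))\<^sup>2)" and \<mu>: "\<mu> \<in> P2"
  shows "integrable M (\<lambda>w. D \<mu> (U w) \<bullet> V w)"
proof (rule Bochner_Integration.integrable_bound)
  interpret prob_space M by fact
  note [measurable] = D_measurable[OF \<mu>]
  show "integrable M (\<lambda>w. (norm (D \<mu> 0))\<^sup>2 + C\<^sup>2 * (norm (U w))\<^sup>2 + (norm (V w))\<^sup>2)"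
    using U V by auto
  show "(\<lambda>w. D \<mu> (U w) \<bullet> V w) \<in> borel_measurable M" by measurable
  show "AE w in M. norm (D \<mu> (U w) \<bullet> V w) \<le> norm ((norm (D \<mu> 0))\<^sup>2 + C\<^sup>2 * (norm (U w))\<^sup>2 + (norm (V w))\<^sup>2)"
  proof (rule AE_I2)
    fix w
    have "\<bar>D \<mu> (U w) \<bullet> V w\<bar> \<le> (norm (D \<mu> 0) + C * norm (U w)) * norm (V w)"
      using D_growth[OF \<mu>, of "U w"] by (intro order.trans[OF Cauchy_Schwarz_ineq2] mult_right_mono) auto
    also have "\<dots> \<le> (norm (D \<mu> 0))\<^sup>2 + (C * norm (U w))\<^sup>2 + (norm (V w))\<^sup>2"
      using sum_squares_bound[of "norm (D \<mu> 0)" "norm (V w)"] sum_squares_bound[of "C * norm (U w)" "norm (V w)"]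
        zero_le_power2[of "norm (D \<mu> 0)"] zero_le_power2[of "C * norm (U w)"]
      unfolding distrib_right by linarith
    finally show "norm (D \<mu> (U w) \<bullet> V w) \<le> norm ((norm (D \<mu> 0))\<^sup>2 + C\<^sup>2 * (norm (U w))\<^sup>2 + (norm (V w))\<^sup>2)"
      by (simp add: power_mult_distrib)
  qed
qed

text \<open>The mean value theorem on the segment compares the gradient at an intermediate point
  with that at \<open>y\<close>. The constant is not sharp: half of it would do.\<close>

lemma dm_Taylor:
  assumes \<mu>: "\<mu> \<in> P2"
  shows "\<bar>dm \<mu> (y + v) - dm \<mu> y - D \<mu> y \<bullet> v\<bar> \<le> C * (norm v)\<^sup>2"
proof -
  define \<phi> where "\<phi> s = dm \<mu> (y + s *\<^sub>R v)" for s :: real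
  have "(\<phi> has_real_derivative (D \<mu> (y + s *\<^sub>R v) \<bullet> v)) (at s)" for s
  proof -
    have d2: "(dm \<mu> has_derivative (\<lambda>h. h \<bullet> D \<mu> (y + s *\<^sub>R v))) (at (y + s *\<^sub>R v))"
      using dm_deriv[OF \<mu>] unfolding gderiv_def .
    have d1: "((\<lambda>s. y + s *\<^sub>R v) has_derivative (\<lambda>h. h *\<^sub>R v)) (at s)"
      by (auto intro!: derivative_eq_intros)
    have "((\<lambda>s. dm \<mu> (y + s *\<^sub>R v)) has_derivative (\<lambda>h. (h *\<^sub>R v) \<bullet> D \<mu> (y + s *\<^sub>R v))) (at s)"
      by (rule has_derivative_compose[OF d1 d2])
    then have "(\<phi> has_derivative (\<lambda>h. (h *\<^sub>R v) \<bullet> D \<mu> (y + s *\<^sub>R v))) (at s)"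
      by (simp add: \<phi>_def[abs_def])
    moreover have "(\<lambda>h. (h *\<^sub>R v) \<bullet> D \<mu> (y + s *\<^sub>R v)) = (*) (D \<mu> (y + s *\<^sub>R v) \<bullet> v)"
      by (auto simp: fun_eq_iff inner_commute)
    ultimately show ?thesis by (simp only: has_field_derivative_def)
  qed
  then obtain s where s: "0 < s" "s < 1" "\<phi> 1 - \<phi> 0 = (1 - 0) * (D \<mu> (y + s *\<^sub>R v) \<bullet> v)"
    using MVT2[of 0 1 \<phi> "\<lambda>s. D \<mu> (y + s *\<^sub>R v) \<bullet> v"] by auto
  have "\<bar>dm \<mu> (y + v) - dm \<mu> y - D \<mu> y \<bullet> v\<bar> = \<bar>(D \<mu> (y + s *\<^sub>R v) - D \<mu> y) \<bullet> v\<bar>"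
    using s(3) by (simp add: \<phi>_def inner_diff_left)
  also have "\<dots> \<le> norm (D \<mu> (y + s *\<^sub>R v) - D \<mu> y) * norm v" by (rule Cauchy_Schwarz_ineq2)
  also have "\<dots> \<le> (C * norm (s *\<^sub>R v)) * norm v"
    using D_Lipschitz_space[OF \<mu>, of "y + s *\<^sub>R v" y] by (intro mult_right_mono) auto
  also have "\<dots> \<le> (C * norm v) * norm v"
    using s C by (intro mult_right_mono mult_left_mono) (auto simp: mult_left_le_one_le)
  finally show ?thesis by (simp add: power2_eq_square mult.assoc)
qed

text \<open>Along the segment of mixtures \<open>\<rho> l\<close> the derivative of \<open>f\<close>
  is the integral of \<open>dm (\<rho> l)\<close> against \<open>\<nu> - \<mu>\<close>. Written with
  \<open>U\<close> and \<open>U + V\<close> on one space, it is the mean of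
  \<open>dm (\<rho> l) (U + V) - dm (\<rho> l) U\<close>, to which the pointwise expansion applies.
  Replacing the base law \<open>\<rho> l\<close> by \<open>\<mu>\<close> in \<open>D\<close> costs
  their distance, at most the square root of the mean of \<open>|V|^2\<close>. The Lipschitz bound
  on \<open>f\<close> gives continuity along the segment.\<close>

theorem law_Taylor:
  fixes U V :: "'w \<Rightarrow> 'a"
  assumes M: "prob_space M" and [measurable]: "U \<in> borel_measurable M" "V \<in> borel_measurable M"
    and U: "integrable M (\<lambda>w. (norm (U w))\<^sup>2)" and V: "integrable M (\<lambda>w. (norm (V w))\<^sup>2)"
  shows "\<bar>f (distr M borel (\<lambda>w. U w + V w)) - f (distr M borel U) - (\<integral>w. D (distr M borel U) (U w) \<bullet> V w \<partial>M)\<bar>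
    \<le> 2 * C * (\<integral>w. (norm (V w))\<^sup>2 \<partial>M)"
proof -
  interpret prob_space M by (rule M)
  define \<mu> where "\<mu> = distr M borel U"
  define \<nu> where "\<nu> = distr M borel (\<lambda>w. U w + V w)"
  define c where "c = (\<integral>w. (norm (V w))\<^sup>2 \<partial>M)"
  define A where "A = (\<integral>w. D \<mu> (U w) \<bullet> V w \<partial>M)"
  define \<rho> where "\<rho> l = mixture l \<mu> \<nu>" for l
  have c: "0 \<le> c" by (simp add: c_def)
  have UV: "integrable M (\<lambda>w. (norm (U w + V w))\<^sup>2)" by (rule square_integrable_add[OF _ _ U V]) auto
  have \<mu>: "\<mu> \<in> P2" unfolding \<mu>_def by (rule law_in_P2[OF M _ U]) measurable
  have \<nu>: "\<nu> \<in> P2" unfolding \<nu>_def by (rule law_in_P2[OF M _ UV]) measurable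
  have s: "sets \<mu> = sets borel" "sets \<nu> = sets borel" by (simp_all add: \<mu>_def \<nu>_def)
  have \<rho>: "\<rho> l \<in> P2" if "0 \<le> l" "l \<le> 1" for l unfolding \<rho>_def using that by (intro mixture_P2 \<mu> \<nu>)
  \<comment> \<open>\<open>\<pi>\<close> and \<open>\<pi>'\<close> move mass between the end points
    at cost \<open>c\<close>; \<open>\<kappa>\<close> and \<open>\<kappa>'\<close> leave it in
    place. Mixtures of them couple the laws on the segment with its end points.\<close>
  define \<pi> where "\<pi> = distr M borel (\<lambda>w. (U w, U w + V w))"
  define \<kappa> where "\<kappa> = distr M borel (\<lambda>w. (U w + V w, U w + V w))"
  define \<pi>' where "\<pi>' = distr M borel (\<lambda>w. (U w + V w, U w))"
  define \<kappa>' where "\<kappa>' = distr M borel (\<lambda>w. (U w, U w))"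
  have \<pi>: "\<pi> \<in> couplings \<mu> \<nu>" unfolding \<pi>_def \<mu>_def \<nu>_def by (rule law_coupling[OF M]) measurable
  have \<kappa>: "\<kappa> \<in> couplings \<nu> \<nu>" unfolding \<kappa>_def \<nu>_def by (rule law_coupling[OF M]) measurable
  have \<pi>': "\<pi>' \<in> couplings \<nu> \<mu>" unfolding \<pi>'_def \<mu>_def \<nu>_def by (rule law_coupling[OF M]) measurable
  have \<kappa>': "\<kappa>' \<in> couplings \<mu> \<mu>" unfolding \<kappa>'_def \<mu>_def by (rule law_coupling[OF M]) measurable
  let ?d = "\<lambda>z :: 'a \<times> 'a. (dist (fst z) (snd z))\<^sup>2"
  have dm': "?d \<in> borel_measurable borel" by (intro borel_measurable_continuous_onI continuous_intros)
  have sets\<pi>: "sets \<pi> = sets borel" "sets \<kappa> = sets borel" "sets \<pi>' = sets borel" "sets \<kappa>' = sets borel"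
    by (simp_all add: \<pi>_def \<kappa>_def \<pi>'_def \<kappa>'_def)
  have int: "integrable \<pi> ?d" "integrable \<kappa> ?d" "integrable \<pi>' ?d" "integrable \<kappa>' ?d"
    and val: "(\<integral>z. ?d z \<partial>\<pi>) = c" "(\<integral>z. ?d z \<partial>\<kappa>) = 0" "(\<integral>z. ?d z \<partial>\<pi>') = c" "(\<integral>z. ?d z \<partial>\<kappa>') = 0"
    unfolding \<pi>_def \<kappa>_def \<pi>'_def \<kappa>'_def c_def using dm' V
    by (auto simp: integrable_distr_eq integral_distr dist_norm)
  define g where "g l = f (\<rho> l)" for l
  have W\<rho>: "W2 (\<rho> l) (\<rho> l') \<le> sqrt ((l' - l) * c)" if l: "0 \<le> l" "l < l'" "l' \<le> 1" for l l'
  proof -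
    \<comment> \<open>Only the fraction \<open>h\<close> of the mass of \<open>\<rho> l\<close> is
      sent towards \<open>\<nu>\<close>, at cost \<open>(1 - l) * c\<close>, and the rest stays;
      this gives the factor \<open>l' - l\<close>. The resulting exponent 1/2 is enough for
      continuity.\<close>
    define h where "h = (l' - l) / (1 - l)"
    have h: "0 \<le> h" "h \<le> 1" "l + h * (1 - l) = l'" using l by (auto simp: h_def)
    define \<delta> where "\<delta> = distr (\<rho> l) borel (\<lambda>x. (x, x))"
    have l1: "l \<le> 1" using l by simp
    have P: "prob_space (\<rho> l)" "sets (\<rho> l) = sets borel" using P2D[OF \<rho>[OF l(1) l1]] by auto
    have idm: "(\<lambda>x. x) \<in> borel_measurable (\<rho> l)" using P(2) by (simp add: measurable_cong_sets[OF P(2) refl])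
    have "distr (\<rho> l) borel (\<lambda>x. x) = \<rho> l" by (rule distr_id2) (use P in simp)
    then have \<delta>: "\<delta> \<in> couplings (\<rho> l) (\<rho> l)" using law_coupling[OF P(1) idm idm] by (simp add: \<delta>_def)
    have mk: "mixture l \<pi> \<kappa> \<in> couplings (\<rho> l) \<nu>"
      using mixture_couplings[OF \<pi> \<kappa> l(1) l1] mixture_same[OF s(2) l(1) l1] by (simp add: \<rho>_def)
    have "mixture h \<delta> (mixture l \<pi> \<kappa>) \<in> couplings (mixture h (\<rho> l) (\<rho> l)) (mixture h (\<rho> l) \<nu>)"
      by (rule mixture_couplings[OF \<delta> mk h(1,2)])
    moreover have "mixture h (\<rho> l) (\<rho> l) = \<rho> l" by (rule mixture_same[OF P(2) h(1,2)])
    moreover have "mixture h (\<rho> l) \<nu> = \<rho> l'"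
      unfolding \<rho>_def using mixture_mixture[OF s l(1) l1 h(1,2)] h(3) by simp
    ultimately have "W2 (\<rho> l) (\<rho> l') \<le> sqrt (\<integral>z. ?d z \<partial>mixture h \<delta> (mixture l \<pi> \<kappa>))"
      using W2_le[of "mixture h \<delta> (mixture l \<pi> \<kappa>)"] by simp
    also have "(\<integral>z. ?d z \<partial>mixture h \<delta> (mixture l \<pi> \<kappa>)) = (1 - h) * (\<integral>z. ?d z \<partial>\<delta>) + h * (\<integral>z. ?d z \<partial>mixture l \<pi> \<kappa>)"
    proof (rule integral_mixture(2)[OF _ _ h(1,2)])
      show "integrable \<delta> ?d" unfolding \<delta>_def using dm' idm by (subst integrable_distr_eq) auto
      show "integrable (mixture l \<pi> \<kappa>) ?d" by (rule integral_mixture(1)[OF sets\<pi>(1,2) l(1) l1 int(1,2)])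
    qed (simp_all add: \<delta>_def)
    also have "(\<integral>z. ?d z \<partial>\<delta>) = 0" unfolding \<delta>_def using dm' idm by (subst integral_distr) auto
    also have "(\<integral>z. ?d z \<partial>mixture l \<pi> \<kappa>) = (1 - l) * c"
      using integral_mixture(2)[OF sets\<pi>(1,2) l(1) l1 int(1,2)] val by simp
    also have "(1 - h) * 0 + h * ((1 - l) * c) = (l' - l) * c"
    proof -
      have "h * (1 - l) = l' - l" using h(3) by simp
      then show ?thesis by (simp add: mult.assoc[symmetric])
    qed
    finally show ?thesis .
  qed
  have g_cont: "continuous_on {0..1} g"
    unfolding continuous_on_def
  proof (rule ballI)
    fix l :: real assume l: "l \<in> {0..1}"
    have "((\<lambda>l'. Cf * sqrt (\<bar>l' - l\<bar> * c)) \<longlongrightarrow> Cf * sqrt (\<bar>l - l\<bar> * c)) (at l within {0..1})"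
      by (intro tendsto_intros)
    then have lim0: "((\<lambda>l'. Cf * sqrt (\<bar>l' - l\<bar> * c)) \<longlongrightarrow> 0) (at l within {0..1})" by simp
    have "((\<lambda>l'. g l' - g l) \<longlongrightarrow> 0) (at l within {0..1})"
    proof (rule Lim_null_comparison[OF _ lim0])
      show "\<forall>\<^sub>F l' in at l within {0..1}. norm (g l' - g l) \<le> Cf * sqrt (\<bar>l' - l\<bar> * c)"
        unfolding eventually_at_filter
      proof (rule always_eventually, intro allI impI)
        fix l' assume l': "l' \<noteq> l" "l' \<in> {0..1}"
        show "norm (g l' - g l) \<le> Cf * sqrt (\<bar>l' - l\<bar> * c)"
        proof (cases "l < l'")
          case True
          have "\<bar>f (\<rho> l) - f (\<rho> l')\<bar> \<le> Cf * W2 (\<rho> l) (\<rho> l')" using l l' by (intro f_Lipschitz \<rho>) auto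
          also have "\<dots> \<le> Cf * sqrt ((l' - l) * c)" using Cf l l' True by (intro mult_left_mono W\<rho>) auto
          finally show ?thesis using True by (simp add: g_def abs_minus_commute)
        next
          case False
          have "\<bar>f (\<rho> l') - f (\<rho> l)\<bar> \<le> Cf * W2 (\<rho> l') (\<rho> l)" using l l' by (intro f_Lipschitz \<rho>) auto
          also have "\<dots> \<le> Cf * sqrt ((l - l') * c)" using Cf l l' False by (intro mult_left_mono W\<rho>) auto
          finally show ?thesis using False by (simp add: g_def abs_minus_commute)
        qed
      qed
    qed
    then show "(g \<longlongrightarrow> g l) (at l within {0..1})" by (rule LIM_zero_cancel)
  qed
  define G where "G l = (\<integral>y. dm (\<rho> l) y \<partial>\<nu>) - (\<integral>y. dm (\<rho> l) y \<partial>\<mu>)" for l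
  \<comment> \<open>From the base law \<open>\<rho> l\<close> in direction \<open>\<nu>\<close> the
    derivative is \<open>(1 - l) * G l\<close>; the substitution \<open>h = k / (1 - l)\<close>
    removes the factor.\<close>
  have g_deriv: "((\<lambda>k. (g (l + k) - g l) / k) \<longlongrightarrow> G l) (at_right 0)" if l: "0 \<le> l" "l < 1" for l
  proof -
    have l1: "l \<le> 1" using l by simp
    have "(\<integral>y. dm (\<rho> l) y \<partial>\<rho> l) = (1 - l) * (\<integral>y. dm (\<rho> l) y \<partial>\<mu>) + l * (\<integral>y. dm (\<rho> l) y \<partial>\<nu>)"
      unfolding \<rho>_def[of l] using dm_integrable[OF \<rho>[OF l(1) l1]] \<mu> \<nu>
      by (intro integral_mixture(2)[OF s l(1) l1]) (auto simp: \<rho>_def)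
    then have "(\<integral>y. dm (\<rho> l) y \<partial>\<nu>) - (\<integral>y. dm (\<rho> l) y \<partial>\<rho> l) = (1 - l) * G l"
      by (simp add: G_def algebra_simps)
    then have "((\<lambda>h. (f (mixture h (\<rho> l) \<nu>) - f (\<rho> l)) / h) \<longlongrightarrow> (1 - l) * G l) (at_right 0)"
      using f_deriv[OF \<rho>[OF l(1) l1] \<nu>] by (simp only:)
    moreover have "filterlim (\<lambda>k. k / (1 - l)) (at_right 0) (at_right 0)"
      unfolding filterlim_at
    proof
      show "\<forall>\<^sub>F k in at_right 0. k / (1 - l) \<in> {0<..} \<and> k / (1 - l) \<noteq> 0"
        using l by (intro eventually_mono[OF eventually_at_right_less]) auto
      have "((\<lambda>k. k / (1 - l)) \<longlongrightarrow> 0 / (1 - l)) (at_right 0)" using l by (intro tendsto_intros) auto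
      then show "((\<lambda>k. k / (1 - l)) \<longlongrightarrow> 0) (at_right 0)" by simp
    qed
    ultimately have "((\<lambda>k. (f (mixture (k / (1 - l)) (\<rho> l) \<nu>) - f (\<rho> l)) / (k / (1 - l))) \<longlongrightarrow> (1 - l) * G l) (at_right 0)"
      by (rule filterlim_compose)
    then have "((\<lambda>k. (f (mixture (k / (1 - l)) (\<rho> l) \<nu>) - f (\<rho> l)) / (k / (1 - l)) / (1 - l)) \<longlongrightarrow> (1 - l) * G l / (1 - l)) (at_right 0)"
      using l by (intro tendsto_intros) auto
    then have lim: "((\<lambda>k. (f (mixture (k / (1 - l)) (\<rho> l) \<nu>) - f (\<rho> l)) / k) \<longlongrightarrow> G l) (at_right 0)"
      using l by simp
    show ?thesis
    proof (rule Lim_transform_eventually[OF lim])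
      have "\<forall>\<^sub>F k in at_right 0. 0 < k \<and> k < 1 - l"
        using l by (intro eventually_mono[OF eventually_at_right_real[of 0 "1 - l"]]) auto
      then show "\<forall>\<^sub>F k in at_right 0. (f (mixture (k / (1 - l)) (\<rho> l) \<nu>) - f (\<rho> l)) / k = (g (l + k) - g l) / k"
      proof eventually_elim
        case (elim k)
        have "mixture (k / (1 - l)) (\<rho> l) \<nu> = mixture (l + k / (1 - l) * (1 - l)) \<mu> \<nu>"
          unfolding \<rho>_def using l elim by (intro mixture_mixture[OF s]) auto
        then show ?case using l by (simp add: g_def \<rho>_def)
      qed
    qed
  qed
  have G_bound: "\<bar>G l - A\<bar> \<le> 2 * C * c" if l: "0 \<le> l" "l < 1" for l
  proof -
    have l1: "l \<le> 1" using l by simp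
    note \<rho>l = \<rho>[OF l(1) l1]
    have W: "W2 (\<rho> l) \<mu> \<le> sqrt c"
    proof -
      have "mixture l \<kappa>' \<pi>' \<in> couplings (\<rho> l) \<mu>"
        using mixture_couplings[OF \<kappa>' \<pi>' l(1) l1] mixture_same[OF s(1) l(1) l1] by (simp add: \<rho>_def)
      from W2_le[OF this] have "W2 (\<rho> l) \<mu> \<le> sqrt (l * c)"
        using integral_mixture(2)[OF sets\<pi>(4,3) l(1) l1 int(4,3)] val by simp
      also have "\<dots> \<le> sqrt c" using l c by (intro real_sqrt_le_mono) (simp add: mult_left_le_one_le)
      finally show ?thesis .
    qed
    have dmm[measurable]: "dm (\<rho> l) \<in> borel_measurable borel"
      using borel_measurable_integrable[OF dm_integrable[OF \<rho>l \<mu>]] measurable_cong_sets[OF s(1) refl] by blast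
    have i1: "integrable M (\<lambda>w. dm (\<rho> l) (U w))"
      using dm_integrable[OF \<rho>l \<mu>] unfolding \<mu>_def by (subst (asm) integrable_distr_eq) auto
    have i2: "integrable M (\<lambda>w. dm (\<rho> l) (U w + V w))"
      using dm_integrable[OF \<rho>l \<nu>] unfolding \<nu>_def by (subst (asm) integrable_distr_eq) auto
    have i3: "integrable M (\<lambda>w. D \<mu> (U w) \<bullet> V w)" by (rule D_inner_integrable[OF M _ _ U V \<mu>]) measurable
    have eq: "G l - A = (\<integral>w. dm (\<rho> l) (U w + V w) - dm (\<rho> l) (U w) - D \<mu> (U w) \<bullet> V w \<partial>M)"
      unfolding G_def A_def \<mu>_def \<nu>_def using i1 i2 i3
      by (subst (1 2) integral_distr) (auto simp: \<mu>_def)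
    have "\<bar>G l - A\<bar> \<le> (\<integral>w. \<bar>dm (\<rho> l) (U w + V w) - dm (\<rho> l) (U w) - D \<mu> (U w) \<bullet> V w\<bar> \<partial>M)"
      unfolding eq by (rule integral_abs_bound)
    \<comment> \<open>The first term is the remainder of \<open>dm_Taylor\<close>, the second bounds
      \<open>C * sqrt c * norm (V w)\<close>, the price for the change of base law. Each integrates
      to \<open>C * c\<close>.\<close>
    also have "\<dots> \<le> (\<integral>w. C * (norm (V w))\<^sup>2 + C * ((c + (norm (V w))\<^sup>2) / 2) \<partial>M)"
    proof (rule integral_mono)
      show "integrable M (\<lambda>w. \<bar>dm (\<rho> l) (U w + V w) - dm (\<rho> l) (U w) - D \<mu> (U w) \<bullet> V w\<bar>)" using i1 i2 i3 by auto
      show "integrable M (\<lambda>w. C * (norm (V w))\<^sup>2 + C * ((c + (norm (V w))\<^sup>2) / 2))" using V by auto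
      fix w
      have "\<bar>(D (\<rho> l) (U w) - D \<mu> (U w)) \<bullet> V w\<bar> \<le> dist (D (\<rho> l) (U w)) (D \<mu> (U w)) * norm (V w)"
        unfolding dist_norm by (rule Cauchy_Schwarz_ineq2)
      also have "\<dots> \<le> (C * (W2 (\<rho> l) \<mu> + dist (U w) (U w))) * norm (V w)"
        by (intro mult_right_mono D_Lipschitz \<rho>l \<mu>) simp
      also have "\<dots> \<le> (C * sqrt c) * norm (V w)" using W C by (intro mult_right_mono mult_left_mono) auto
      also have "\<dots> \<le> C * ((c + (norm (V w))\<^sup>2) / 2)"
        using sum_squares_bound[of "sqrt c" "norm (V w)"] c C by (simp add: mult.assoc)
      finally have "\<bar>D (\<rho> l) (U w) \<bullet> V w - D \<mu> (U w) \<bullet> V w\<bar> \<le> C * ((c + (norm (V w))\<^sup>2) / 2)"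
        by (simp add: inner_diff_left)
      then show "\<bar>dm (\<rho> l) (U w + V w) - dm (\<rho> l) (U w) - D \<mu> (U w) \<bullet> V w\<bar>
          \<le> C * (norm (V w))\<^sup>2 + C * ((c + (norm (V w))\<^sup>2) / 2)"
        using dm_Taylor[OF \<rho>l, of "U w" "V w"] by linarith
    qed
    also have "\<dots> = 2 * C * c" using V by (simp add: c_def prob_space algebra_simps)
    finally show ?thesis .
  qed
  have ends: "g 1 = f \<nu>" "g 0 = f \<mu>" using s by (simp_all add: g_def \<rho>_def mixture_0 mixture_1)
  have Gb: "G l \<le> A + 2 * C * c" "- G l \<le> - A + 2 * C * c" if "0 \<le> l" "l < 1" for l
    using G_bound[OF that] by (simp_all add: abs_le_iff)
  have "g 1 - g 0 \<le> A + 2 * C * c"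
    by (rule right_derivative_bound[OF g_cont g_deriv Gb(1)])
  moreover have "- g 1 - - g 0 \<le> - A + 2 * C * c"
  proof (rule right_derivative_bound[of "\<lambda>l. - g l" "\<lambda>l. - G l"])
    show "continuous_on {0..1} (\<lambda>l. - g l)" using g_cont by (rule continuous_on_minus)
    show "((\<lambda>k. (- g (l + k) - - g l) / k) \<longlongrightarrow> - G l) (at_right 0)" if "0 \<le> l" "l < 1" for l
    proof -
      have "(\<lambda>k. (- g (l + k) - - g l) / k) = (\<lambda>k. - ((g (l + k) - g l) / k))"
        by (auto simp: fun_eq_iff minus_divide_left)
      then show ?thesis using tendsto_minus[OF g_deriv[OF that]] by simp
    qed
  qed (rule Gb(2))
  ultimately show ?thesis
    unfolding ends by (simp add: abs_le_iff A_def c_def \<mu>_def \<nu>_def)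
qed

end

text \<open>Lipschitz continuity for the 2-Wasserstein distance on sets of bounded second moment,
  tested on given couplings instead of optimal ones. The constant depends on \<open>R\<close>
  because functionals of quadratic growth have to be covered.\<close>

definition coupling_Lipschitz :: "('b::euclidean_space measure \<Rightarrow> real) \<Rightarrow> bool" where
  "coupling_Lipschitz \<Theta> \<longleftrightarrow> (\<forall>R. \<exists>K\<ge>0. \<forall>\<pi> :: ('b \<times> 'b) measure. \<forall>\<delta>>0.
     prob_space \<pi> \<and> sets \<pi> = sets borel \<and>
     integrable \<pi> (\<lambda>z. (norm (fst z))\<^sup>2) \<and> integrable \<pi> (\<lambda>z. (norm (snd z))\<^sup>2) \<and>
     (\<integral>z. (norm (fst z))\<^sup>2 \<partial>\<pi>) \<le> R \<and> (\<integral>z. (norm (snd z))\<^sup>2 \<partial>\<pi>) \<le> R \<and>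
     (\<integral>z. (dist (fst z) (snd z))\<^sup>2 \<partial>\<pi>) \<le> \<delta>\<^sup>2 \<longrightarrow>
     \<bar>\<Theta> (distr \<pi> borel fst) - \<Theta> (distr \<pi> borel snd)\<bar> \<le> K * \<delta>)"

text \<open>\<open>K\<close> is kept explicit so that one constant, fixed once for \<open>R\<close>,
  serves all couplings of a later estimate.\<close>

lemma coupling_LipschitzD:
  fixes U U' :: "'w \<Rightarrow> 'b::euclidean_space"
  assumes K: "\<And>(\<pi> :: ('b \<times> 'b) measure) \<delta>. 0 < \<delta> \<Longrightarrow>
     prob_space \<pi> \<and> sets \<pi> = sets borel \<and>
     integrable \<pi> (\<lambda>z. (norm (fst z))\<^sup>2) \<and> integrable \<pi> (\<lambda>z. (norm (snd z))\<^sup>2) \<and>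
     (\<integral>z. (norm (fst z))\<^sup>2 \<partial>\<pi>) \<le> R \<and> (\<integral>z. (norm (snd z))\<^sup>2 \<partial>\<pi>) \<le> R \<and>
     (\<integral>z. (dist (fst z) (snd z))\<^sup>2 \<partial>\<pi>) \<le> \<delta>\<^sup>2 \<Longrightarrow>
     \<bar>\<Theta> (distr \<pi> borel fst) - \<Theta> (distr \<pi> borel snd)\<bar> \<le> K * \<delta>"
    and M: "prob_space M" and [measurable]: "U \<in> borel_measurable M" "U' \<in> borel_measurable M"
    and U: "integrable M (\<lambda>w. (norm (U w))\<^sup>2)" "(\<integral>w. (norm (U w))\<^sup>2 \<partial>M) \<le> R"
    and U': "integrable M (\<lambda>w. (norm (U' w))\<^sup>2)" "(\<integral>w. (norm (U' w))\<^sup>2 \<partial>M) \<le> R"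
    and d: "0 < \<delta>" "(\<integral>w. (dist (U w) (U' w))\<^sup>2 \<partial>M) \<le> \<delta>\<^sup>2"
  shows "\<bar>\<Theta> (distr M borel U) - \<Theta> (distr M borel U')\<bar> \<le> K * \<delta>"
proof -
  interpret prob_space M by (rule M)
  let ?\<pi> = "distr M borel (\<lambda>w. (U w, U' w))"
  have m: "(\<lambda>z :: 'b \<times> 'b. (norm (fst z))\<^sup>2) \<in> borel_measurable borel" "(\<lambda>z :: 'b \<times> 'b. (norm (snd z))\<^sup>2) \<in> borel_measurable borel"
    "(\<lambda>z :: 'b \<times> 'b. (dist (fst z) (snd z))\<^sup>2) \<in> borel_measurable borel"
    by (intro borel_measurable_continuous_onI continuous_intros)+
  have "\<bar>\<Theta> (distr ?\<pi> borel fst) - \<Theta> (distr ?\<pi> borel snd)\<bar> \<le> K * \<delta>"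
    using U U' d m by (intro K) (auto simp: integrable_distr_eq integral_distr intro!: prob_space_distr)
  then show ?thesis by (simp add: distr_distr comp_def)
qed

context Lions_differentiable
begin

lemma coupling_Lipschitz_f: "coupling_Lipschitz (\<lambda>\<rho> :: ('a \<times> 'a) measure. f (distr \<rho> borel fst))"
  unfolding coupling_Lipschitz_def
proof (intro allI exI conjI impI)
  show "0 \<le> Cf" using Cf by simp
  fix R \<delta> :: real and \<pi> :: "(('a \<times> 'a) \<times> ('a \<times> 'a)) measure"
  assume d: "0 < \<delta>" and "prob_space \<pi> \<and> sets \<pi> = sets borel \<and>
     integrable \<pi> (\<lambda>z. (norm (fst z))\<^sup>2) \<and> integrable \<pi> (\<lambda>z. (norm (snd z))\<^sup>2) \<and>
     (\<integral>z. (norm (fst z))\<^sup>2 \<partial>\<pi>) \<le> R \<and> (\<integral>z. (norm (snd z))\<^sup>2 \<partial>\<pi>) \<le> R \<and>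
     (\<integral>z. (dist (fst z) (snd z))\<^sup>2 \<partial>\<pi>) \<le> \<delta>\<^sup>2"
  then have \<pi>: "prob_space \<pi>" and s[measurable_cong]: "sets \<pi> = sets borel"
    and i: "integrable \<pi> (\<lambda>z. (norm (fst z))\<^sup>2)" "integrable \<pi> (\<lambda>z. (norm (snd z))\<^sup>2)"
    and dd: "(\<integral>z. (dist (fst z) (snd z))\<^sup>2 \<partial>\<pi>) \<le> \<delta>\<^sup>2" by auto
  have m[measurable]: "(\<lambda>z. fst (fst z)) \<in> borel_measurable \<pi>" "(\<lambda>z. fst (snd z)) \<in> borel_measurable \<pi>"
    "fst \<in> borel_measurable \<pi>" "snd \<in> borel_measurable \<pi>"
    unfolding measurable_cong_sets[OF s refl] by (intro borel_measurable_continuous_onI continuous_intros)+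
  have mf: "fst \<in> borel_measurable (borel :: ('a \<times> 'a) measure)" by (intro borel_measurable_continuous_onI continuous_intros)
  have le: "norm (fst z) \<le> norm z" "dist (fst z) (fst z') \<le> dist z z'" for z z' :: "'a \<times> 'a"
    by (metis norm_fst_le prod.collapse, rule dist_fst_le)
  have idist: "integrable \<pi> (\<lambda>z. (dist (fst z) (snd z))\<^sup>2)"
    unfolding dist_norm by (rule square_integrable_diff[OF _ _ i]) measurable
  have j: "integrable \<pi> (\<lambda>z. (norm (fst (fst z)))\<^sup>2)" "integrable \<pi> (\<lambda>z. (norm (fst (snd z)))\<^sup>2)"
    by (rule Bochner_Integration.integrable_bound[OF i(1)], measurable, auto intro!: power_mono le(1))
       (rule Bochner_Integration.integrable_bound[OF i(2)], measurable, auto intro!: power_mono le(1))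
  let ?\<mu> = "distr \<pi> borel (\<lambda>z. fst (fst z))" and ?\<nu> = "distr \<pi> borel (\<lambda>z. fst (snd z))"
  have P: "?\<mu> \<in> P2" "?\<nu> \<in> P2" using j by (auto intro!: law_in_P2[OF \<pi>])
  have "W2 ?\<mu> ?\<nu> \<le> sqrt (\<integral>z. (dist (fst (fst z)) (fst (snd z)))\<^sup>2 \<partial>\<pi>)" by (rule W2_law_le[OF \<pi>]) measurable
  also have "\<dots> \<le> sqrt (\<integral>z. (dist (fst z) (snd z))\<^sup>2 \<partial>\<pi>)"
  proof (intro real_sqrt_le_mono integral_mono idist)
    show "integrable \<pi> (\<lambda>z. (dist (fst (fst z)) (fst (snd z)))\<^sup>2)"
      by (rule Bochner_Integration.integrable_bound[OF idist]) (auto intro!: power_mono le(2))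
  qed (auto intro!: power_mono le(2))
  also have "\<dots> \<le> sqrt (\<delta>\<^sup>2)" by (intro real_sqrt_le_mono dd)
  also have "\<dots> = \<delta>" using d by simp
  finally have "Cf * W2 ?\<mu> ?\<nu> \<le> Cf * \<delta>" using Cf by (intro mult_left_mono) auto
  moreover have "distr (distr \<pi> borel fst) borel fst = ?\<mu>" "distr (distr \<pi> borel snd) borel fst = ?\<nu>"
    using mf by (simp_all add: distr_distr comp_def)
  ultimately show "\<bar>f (distr (distr \<pi> borel fst) borel fst) - f (distr (distr \<pi> borel snd) borel fst)\<bar> \<le> Cf * \<delta>"
    using f_Lipschitz[OF P] by simp
qed

text \<open>The difference of the two inner products splits into a change of \<open>D\<close>
  against \<open>V\<close> and a change of \<open>V\<close> against \<open>D\<close>. The weighted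
  inequality \<open>x * y \<le> (x^2 / \<delta> + \<delta> * y^2) / 2\<close> turns the squared
  differences, of mean at most \<open>\<delta>^2\<close>, and the bounded second moments both into
  multiples of \<open>\<delta>\<close>.\<close>

lemma coupling_Lipschitz_D:
  "coupling_Lipschitz (\<lambda>\<rho> :: ('a \<times> 'a) measure. \<integral>z. D (distr \<rho> borel fst) (fst z) \<bullet> snd z \<partial>\<rho>)"
  unfolding coupling_Lipschitz_def
proof (rule allI)
  fix R :: real
  \<comment> \<open>The Dirac law at 0 is a fixed reference point: a law with second moment at most
    \<open>R\<close> is within \<open>sqrt R\<close> of it, so \<open>b + C * norm y\<close> bounds
    \<open>D\<close> at \<open>y\<close> uniformly over such laws.\<close>
  define b where "b = norm (D (return borel 0) 0) + C * sqrt (max 0 R)"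
  define K where "K = C * (1 + max 0 R) / 2 + C * (1 + max 0 R) / 2 + 1 / 2 + (b\<^sup>2 + C\<^sup>2 * max 0 R)"
  show "\<exists>K\<ge>0. \<forall>(\<pi> :: (('a \<times> 'a) \<times> ('a \<times> 'a)) measure) \<delta>. 0 < \<delta> \<longrightarrow> prob_space \<pi> \<and> sets \<pi> = sets borel \<and>
     integrable \<pi> (\<lambda>z. (norm (fst z))\<^sup>2) \<and> integrable \<pi> (\<lambda>z. (norm (snd z))\<^sup>2) \<and>
     (\<integral>z. (norm (fst z))\<^sup>2 \<partial>\<pi>) \<le> R \<and> (\<integral>z. (norm (snd z))\<^sup>2 \<partial>\<pi>) \<le> R \<and>
     (\<integral>z. (dist (fst z) (snd z))\<^sup>2 \<partial>\<pi>) \<le> \<delta>\<^sup>2 \<longrightarrow>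
     \<bar>(\<integral>z. D (distr (distr \<pi> borel fst) borel fst) (fst z) \<bullet> snd z \<partial>distr \<pi> borel fst) -
      (\<integral>z. D (distr (distr \<pi> borel snd) borel fst) (fst z) \<bullet> snd z \<partial>distr \<pi> borel snd)\<bar> \<le> K * \<delta>"
  proof (intro exI[of _ K] conjI allI impI)
    show "0 \<le> K" using C unfolding K_def by (intro add_nonneg_nonneg divide_nonneg_nonneg mult_nonneg_nonneg) auto
    fix \<delta> :: real and \<pi> :: "(('a \<times> 'a) \<times> ('a \<times> 'a)) measure"
    assume d: "0 < \<delta>" and "prob_space \<pi> \<and> sets \<pi> = sets borel \<and>
       integrable \<pi> (\<lambda>z. (norm (fst z))\<^sup>2) \<and> integrable \<pi> (\<lambda>z. (norm (snd z))\<^sup>2) \<and>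
       (\<integral>z. (norm (fst z))\<^sup>2 \<partial>\<pi>) \<le> R \<and> (\<integral>z. (norm (snd z))\<^sup>2 \<partial>\<pi>) \<le> R \<and>
       (\<integral>z. (dist (fst z) (snd z))\<^sup>2 \<partial>\<pi>) \<le> \<delta>\<^sup>2"
    then have \<pi>: "prob_space \<pi>" and s: "sets \<pi> = sets borel"
      and i: "integrable \<pi> (\<lambda>z. (norm (fst z))\<^sup>2)" "integrable \<pi> (\<lambda>z. (norm (snd z))\<^sup>2)"
      and iR: "(\<integral>z. (norm (fst z))\<^sup>2 \<partial>\<pi>) \<le> R" "(\<integral>z. (norm (snd z))\<^sup>2 \<partial>\<pi>) \<le> R"
      and dd: "(\<integral>z. (dist (fst z) (snd z))\<^sup>2 \<partial>\<pi>) \<le> \<delta>\<^sup>2" by auto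
    interpret prob_space \<pi> by (rule \<pi>)
    define U V U' V' where "U z = fst (fst z)" and "V z = snd (fst z)" and "U' z = fst (snd z)" and "V' z = snd (snd z)"
      for z :: "('a \<times> 'a) \<times> ('a \<times> 'a)"
    have m[measurable]: "U \<in> borel_measurable \<pi>" "U' \<in> borel_measurable \<pi>" "V \<in> borel_measurable \<pi>" "V' \<in> borel_measurable \<pi>"
      "fst \<in> borel_measurable \<pi>" "snd \<in> borel_measurable \<pi>"
      unfolding measurable_cong_sets[OF s refl] U_def U'_def V_def V'_def
      by (intro borel_measurable_continuous_onI continuous_intros)+
    have nsq: "(norm z)\<^sup>2 = (norm (fst z))\<^sup>2 + (norm (snd z))\<^sup>2" for z :: "'a \<times> 'a"
      by (cases z) (simp add: norm_Pair)
    have e1: "(norm (fst z))\<^sup>2 = (norm (U z))\<^sup>2 + (norm (V z))\<^sup>2"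
      and e2: "(norm (snd z))\<^sup>2 = (norm (U' z))\<^sup>2 + (norm (V' z))\<^sup>2"
      and e3: "(dist (fst z) (snd z))\<^sup>2 = (norm (U z - U' z))\<^sup>2 + (norm (V z - V' z))\<^sup>2" for z
      by (simp_all add: nsq dist_norm U_def V_def U'_def V'_def)
    have iU: "integrable \<pi> (\<lambda>z. (norm (U z))\<^sup>2)" "integrable \<pi> (\<lambda>z. (norm (V z))\<^sup>2)"
      using i(1) unfolding e1 by (auto intro: Bochner_Integration.integrable_bound)
    have iU': "integrable \<pi> (\<lambda>z. (norm (U' z))\<^sup>2)" "integrable \<pi> (\<lambda>z. (norm (V' z))\<^sup>2)"
      using i(2) unfolding e2 by (auto intro: Bochner_Integration.integrable_bound)
    have id: "integrable \<pi> (\<lambda>z. (norm (U z - U' z))\<^sup>2)" "integrable \<pi> (\<lambda>z. (norm (V z - V' z))\<^sup>2)"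
      using iU iU' by (auto intro!: square_integrable_diff)
    have bR: "(\<integral>z. (norm (V z))\<^sup>2 \<partial>\<pi>) \<le> R" "(\<integral>z. (norm (U' z))\<^sup>2 \<partial>\<pi>) \<le> R"
    proof -
      have "(\<integral>z. (norm (V z))\<^sup>2 \<partial>\<pi>) \<le> (\<integral>z. (norm (fst z))\<^sup>2 \<partial>\<pi>)" by (intro integral_mono iU i) (simp add: e1)
      then show "(\<integral>z. (norm (V z))\<^sup>2 \<partial>\<pi>) \<le> R" using iR by linarith
      have "(\<integral>z. (norm (U' z))\<^sup>2 \<partial>\<pi>) \<le> (\<integral>z. (norm (snd z))\<^sup>2 \<partial>\<pi>)" by (intro integral_mono iU' i) (simp add: e2)
      then show "(\<integral>z. (norm (U' z))\<^sup>2 \<partial>\<pi>) \<le> R" using iR by linarith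
    qed
    have sum: "(\<integral>z. (norm (U z - U' z))\<^sup>2 \<partial>\<pi>) + (\<integral>z. (norm (V z - V' z))\<^sup>2 \<partial>\<pi>) \<le> \<delta>\<^sup>2"
      using dd id unfolding e3 by simp
    have p: "0 \<le> (\<integral>z. (norm (U z - U' z))\<^sup>2 \<partial>\<pi>)" "0 \<le> (\<integral>z. (norm (V z - V' z))\<^sup>2 \<partial>\<pi>)" by simp_all
    have bd: "(\<integral>z. (norm (U z - U' z))\<^sup>2 \<partial>\<pi>) \<le> \<delta>\<^sup>2" "(\<integral>z. (norm (V z - V' z))\<^sup>2 \<partial>\<pi>) \<le> \<delta>\<^sup>2"
      using sum p by linarith+
    define \<mu> where "\<mu> = distr \<pi> borel U"
    define \<nu> where "\<nu> = distr \<pi> borel U'"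
    have P: "\<mu> \<in> P2" "\<nu> \<in> P2" unfolding \<mu>_def \<nu>_def using iU(1) iU'(1) by (auto intro!: law_in_P2[OF \<pi>])
    have W: "W2 \<mu> \<nu> \<le> \<delta>"
    proof -
      have "W2 \<mu> \<nu> \<le> sqrt (\<integral>z. (dist (U z) (U' z))\<^sup>2 \<partial>\<pi>)" unfolding \<mu>_def \<nu>_def by (rule W2_law_le[OF \<pi>]) measurable
      also have "\<dots> \<le> sqrt (\<delta>\<^sup>2)" using bd(1) unfolding dist_norm by (rule real_sqrt_le_mono)
      finally show ?thesis using d by simp
    qed
    have D\<nu>: "norm (D \<nu> y) \<le> b + C * norm y" for y
    proof -
      have ret: "distr \<pi> borel (\<lambda>_. 0) = return borel (0::'a)" by (rule distr_const) simp
      have P0: "return borel 0 \<in> (P2 :: 'a measure set)"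
        unfolding ret[symmetric] by (rule law_in_P2[OF \<pi>]) auto
      from ret have "W2 \<nu> (return borel 0) \<le> sqrt (\<integral>z. (dist (U' z) 0)\<^sup>2 \<partial>\<pi>)"
        unfolding \<nu>_def using W2_law_le[OF \<pi>, of U' "\<lambda>_. 0"] by simp
      also have "\<dots> \<le> sqrt (max 0 R)" using bR(2) by (intro real_sqrt_le_mono) simp
      finally have "C * (W2 \<nu> (return borel 0) + dist y 0) \<le> C * (sqrt (max 0 R) + norm y)"
        using C by (intro mult_left_mono) auto
      with D_Lipschitz[OF P(2) P0, of y 0] have "dist (D \<nu> y) (D (return borel 0) 0) \<le> C * (sqrt (max 0 R) + norm y)" by linarith
      then show ?thesis unfolding b_def using norm_triangle_ineq2[of "D \<nu> y" "D (return borel 0) 0"]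
        by (simp add: dist_norm algebra_simps)
    qed
    have b0: "0 \<le> b" using C by (simp add: b_def)
    define B where "B z = C * (\<delta> * (1 + (norm (V z))\<^sup>2) / 2) + C * (((norm (U z - U' z))\<^sup>2 / \<delta> + \<delta> * (norm (V z))\<^sup>2) / 2) +
        ((norm (V z - V' z))\<^sup>2 / (2 * \<delta>) + \<delta> * (b\<^sup>2 + C\<^sup>2 * (norm (U' z))\<^sup>2))" for z
    have am_gm: "x * y \<le> (x\<^sup>2 / \<delta> + \<delta> * y\<^sup>2) / 2" for x y :: real
    proof -
      have "0 \<le> (x - \<delta> * y)\<^sup>2 / \<delta>" using d by simp
      also have "(x - \<delta> * y)\<^sup>2 / \<delta> = x\<^sup>2 / \<delta> + \<delta> * y\<^sup>2 - 2 * (x * y)"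
        using d by (simp add: power2_eq_square field_simps)
      finally show ?thesis by simp
    qed
    have pw: "\<bar>D \<mu> (U z) \<bullet> V z - D \<nu> (U' z) \<bullet> V' z\<bar> \<le> B z" for z
    proof -
      have "D \<mu> (U z) \<bullet> V z - D \<nu> (U' z) \<bullet> V' z = (D \<mu> (U z) - D \<nu> (U' z)) \<bullet> V z + D \<nu> (U' z) \<bullet> (V z - V' z)"
        by (simp add: inner_diff_left inner_diff_right)
      then have "\<bar>D \<mu> (U z) \<bullet> V z - D \<nu> (U' z) \<bullet> V' z\<bar>
          \<le> \<bar>(D \<mu> (U z) - D \<nu> (U' z)) \<bullet> V z\<bar> + \<bar>D \<nu> (U' z) \<bullet> (V z - V' z)\<bar>" by linarith
      also have "\<bar>(D \<mu> (U z) - D \<nu> (U' z)) \<bullet> V z\<bar> \<le> dist (D \<mu> (U z)) (D \<nu> (U' z)) * norm (V z)"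
        unfolding dist_norm by (rule Cauchy_Schwarz_ineq2)
      also have "\<dots> \<le> (C * (W2 \<mu> \<nu> + dist (U z) (U' z))) * norm (V z)"
        by (intro mult_right_mono D_Lipschitz P) simp
      also have "\<dots> \<le> (C * (\<delta> + norm (U z - U' z))) * norm (V z)"
        using W C by (intro mult_right_mono mult_left_mono add_mono) (auto simp: dist_norm)
      also have "\<dots> = C * (\<delta> * (1 * norm (V z))) + C * (norm (U z - U' z) * norm (V z))" by (simp add: algebra_simps)
      also have "\<dots> \<le> C * (\<delta> * ((1 + (norm (V z))\<^sup>2) / 2)) + C * (((norm (U z - U' z))\<^sup>2 / \<delta> + \<delta> * (norm (V z))\<^sup>2) / 2)"
        using C d sum_squares_bound[of 1 "norm (V z)"]
        by (intro add_mono mult_left_mono am_gm) auto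
      also have "\<bar>D \<nu> (U' z) \<bullet> (V z - V' z)\<bar> \<le> norm (D \<nu> (U' z)) * norm (V z - V' z)" by (rule Cauchy_Schwarz_ineq2)
      also have "\<dots> \<le> norm (V z - V' z) * (b + C * norm (U' z))"
        using mult_right_mono[OF D\<nu>[of "U' z"], of "norm (V z - V' z)"] by (simp add: mult.commute)
      also have "\<dots> \<le> ((norm (V z - V' z))\<^sup>2 / \<delta> + \<delta> * (b + C * norm (U' z))\<^sup>2) / 2" by (rule am_gm)
      also have "\<dots> \<le> (norm (V z - V' z))\<^sup>2 / (2 * \<delta>) + \<delta> * (b\<^sup>2 + C\<^sup>2 * (norm (U' z))\<^sup>2)"
      proof -
        have "(b + C * norm (U' z))\<^sup>2 / 2 \<le> b\<^sup>2 + C\<^sup>2 * (norm (U' z))\<^sup>2"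
          using sum_squares_bound[of b "C * norm (U' z)"] by (simp add: power2_sum power_mult_distrib)
        then have "\<delta> * ((b + C * norm (U' z))\<^sup>2 / 2) \<le> \<delta> * (b\<^sup>2 + C\<^sup>2 * (norm (U' z))\<^sup>2)"
          using d by (intro mult_left_mono) auto
        then show ?thesis by (simp add: add_divide_distrib)
      qed
      finally show ?thesis by (simp add: B_def)
    qed
    have iB: "integrable \<pi> B" unfolding B_def using iU iU' id by simp
    have iD: "integrable \<pi> (\<lambda>z. D \<mu> (U z) \<bullet> V z)" "integrable \<pi> (\<lambda>z. D \<nu> (U' z) \<bullet> V' z)"
      using iU iU' P by (auto intro!: D_inner_integrable[OF \<pi>])
    have "\<bar>(\<integral>z. D \<mu> (U z) \<bullet> V z \<partial>\<pi>) - (\<integral>z. D \<nu> (U' z) \<bullet> V' z \<partial>\<pi>)\<bar>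
        \<le> (\<integral>z. \<bar>D \<mu> (U z) \<bullet> V z - D \<nu> (U' z) \<bullet> V' z\<bar> \<partial>\<pi>)"
      unfolding Bochner_Integration.integral_diff[OF iD, symmetric] by (rule integral_abs_bound)
    also have "\<dots> \<le> (\<integral>z. B z \<partial>\<pi>)" using iD iB pw by (intro integral_mono) auto
    also have "(\<integral>z. B z \<partial>\<pi>) = C * (\<delta> * (1 + (\<integral>z. (norm (V z))\<^sup>2 \<partial>\<pi>)) / 2)
        + C * (((\<integral>z. (norm (U z - U' z))\<^sup>2 \<partial>\<pi>) / \<delta> + \<delta> * (\<integral>z. (norm (V z))\<^sup>2 \<partial>\<pi>)) / 2)
        + ((\<integral>z. (norm (V z - V' z))\<^sup>2 \<partial>\<pi>) / (2 * \<delta>) + \<delta> * (b\<^sup>2 + C\<^sup>2 * (\<integral>z. (norm (U' z))\<^sup>2 \<partial>\<pi>)))"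
      unfolding B_def using iU iU' id by (simp add: prob_space)
    also have "\<dots> \<le> C * (\<delta> * (1 + max 0 R) / 2) + C * ((\<delta>\<^sup>2 / \<delta> + \<delta> * max 0 R) / 2)
        + (\<delta>\<^sup>2 / (2 * \<delta>) + \<delta> * (b\<^sup>2 + C\<^sup>2 * max 0 R))"
      using C d bd bR by (intro add_mono mult_left_mono divide_right_mono) auto
    also have "\<dots> = K * \<delta>" using d by (simp add: K_def power2_eq_square field_simps)
    finally have main: "\<bar>(\<integral>z. D \<mu> (U z) \<bullet> V z \<partial>\<pi>) - (\<integral>z. D \<nu> (U' z) \<bullet> V' z \<partial>\<pi>)\<bar> \<le> K * \<delta>" .
    have fm: "fst \<in> borel_measurable (borel :: ('a \<times> 'a) measure)" "snd \<in> borel_measurable (borel :: ('a \<times> 'a) measure)"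
      by (intro borel_measurable_continuous_onI continuous_intros)+
    have l: "distr (distr \<pi> borel fst) borel fst = \<mu>" "distr (distr \<pi> borel snd) borel fst = \<nu>"
      using fm by (simp_all add: distr_distr comp_def \<mu>_def \<nu>_def U_def[abs_def] U'_def[abs_def])
    have mD: "(\<lambda>z. D \<mu> (fst z) \<bullet> snd z) \<in> borel_measurable borel" "(\<lambda>z. D \<nu> (fst z) \<bullet> snd z) \<in> borel_measurable borel"
      using fm P by (auto intro!: borel_measurable_inner measurable_compose[OF fm(1) D_measurable])
    show "\<bar>(\<integral>z. D (distr (distr \<pi> borel fst) borel fst) (fst z) \<bullet> snd z \<partial>distr \<pi> borel fst) -
      (\<integral>z. D (distr (distr \<pi> borel snd) borel fst) (fst z) \<bullet> snd z \<partial>distr \<pi> borel snd)\<bar> \<le> K * \<delta>"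
      unfolding l using main mD by (simp add: integral_distr U_def V_def U'_def V'_def)
  qed
qed

end

section \<open>Directional derivative of the maximum\<close>

lemma norm_sq_Basis: "(norm x)\<^sup>2 = (\<Sum>b\<in>Basis. (x \<bullet> b)\<^sup>2)" for x :: "'a::euclidean_space"
  unfolding power2_norm_eq_inner by (subst euclidean_inner) (simp add: power2_eq_square)

lemma sq_add_le: "(a + b)\<^sup>2 \<le> 2 * a\<^sup>2 + 2 * (b::real)\<^sup>2"
  using norm_sq_add_le[of a b] by simp

context moment_expectation
begin

lemma dominatedD:
  assumes "P \<in> dominated_on_L_ip T Ehat"
  shows "prob_space P" "sets P = sets (path_borel T)" "\<And>X. cylinder {0..T} X \<Longrightarrow> integral\<^sup>L P X \<le> Ehat X"
  using assms unfolding dominated_eq[OF T0] by auto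

lemma dominated_measurable:
  assumes "P \<in> dominated_on_L_ip T Ehat" "X \<in> measurable (path_borel T) N"
  shows "X \<in> measurable P N"
  using assms(2) measurable_cong_sets[OF dominatedD(2)[OF assms(1)] refl] by blast

text \<open>Membership in \<open>LG\<close> supplies a cylinder function close in mean square
  uniformly over the dominated measures. Its dyadic version is known to be close only in first mean;
  since both are bounded by \<open>K\<close>, the squared difference is at most \<open>2 * K\<close>
  times the difference.\<close>

lemma LG_square_approx:
  assumes X: "X \<in> LG T Ehat 2" and d: "0 < d"
  shows "\<exists>X'. cylinder (dyadics T) X' \<and>
    (\<forall>P\<in>dominated_on_L_ip T Ehat. (\<integral>\<^sup>+\<omega>. ennreal ((X \<omega> - X' \<omega>)\<^sup>2) \<partial>P) \<le> ennreal d)"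
proof -
  obtain Xs where Xm: "X \<in> borel_measurable (path_borel T)" and Xs: "\<And>n. cylinder {0..T} (Xs n)"
    and lim: "(\<lambda>n. upper_expectation (dominated_on_L_ip T Ehat) (\<lambda>\<omega>. \<bar>X \<omega> - Xs n \<omega>\<bar> ^ 2)) \<longlonglongrightarrow> 0"
    using X unfolding LG_def LG_represents_def L_ip_eq[OF T0] by auto
  have "\<forall>\<^sub>F n in sequentially. upper_expectation (dominated_on_L_ip T Ehat) (\<lambda>\<omega>. \<bar>X \<omega> - Xs n \<omega>\<bar> ^ 2) < ennreal (d / 4)"
    using d by (intro order_tendstoD[OF lim]) simp
  then obtain n where n: "upper_expectation (dominated_on_L_ip T Ehat) (\<lambda>\<omega>. \<bar>X \<omega> - Xs n \<omega>\<bar> ^ 2) < ennreal (d / 4)"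
    by (auto simp: eventually_sequentially)
  obtain K where K: "\<And>\<omega>. \<bar>Xs n \<omega>\<bar> \<le> K" using Xs[of n] by (auto simp: cylinder_def)
  have K0: "0 \<le> K" using K[of undefined] by linarith
  \<comment> \<open>This makes \<open>2 * K * e\<close> at most \<open>d / 4\<close>. Two errors of
    \<open>d / 4\<close> are each doubled by the inequality for the square of a sum.\<close>
  define e where "e = d / (8 * (K + 1))"
  have e: "0 < e" using d K0 by (simp add: e_def)
  obtain m where m: "Ehat (\<lambda>\<omega>. \<bar>Xs n \<omega> - dyadic_version m (Xs n) \<omega>\<bar>) \<le> e"
    using dyadic_version_approx[OF Xs[of n] e] by (auto simp: eventually_sequentially)
  define X' where "X' = dyadic_version m (Xs n)"
  have X': "cylinder (dyadics T) X'" unfolding X'_def by (rule cylinder_dyadic_version[OF Xs])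
  have X'T: "cylinder {0..T} X'" by (rule cylinder_dyadics[OF X'])
  have K': "\<bar>X' \<omega>\<bar> \<le> K" for \<omega> by (simp add: X'_def dyadic_version_def K)
  have "(\<integral>\<^sup>+\<omega>. ennreal ((X \<omega> - X' \<omega>)\<^sup>2) \<partial>P) \<le> ennreal d" if P: "P \<in> dominated_on_L_ip T Ehat" for P
  proof -
    note PD = dominatedD[OF P]
    have [measurable]: "X \<in> borel_measurable P" "Xs n \<in> borel_measurable P" "X' \<in> borel_measurable P"
      using Xm cylinder_measurable[OF T0 Xs] cylinder_measurable[OF T0 X'T] by (auto intro: dominated_measurable[OF P])
    have 1: "(\<integral>\<^sup>+\<omega>. ennreal ((X \<omega> - Xs n \<omega>)\<^sup>2) \<partial>P) \<le> ennreal (d / 4)"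
      using upper_expectation_ge[OF P, of "\<lambda>\<omega>. \<bar>X \<omega> - Xs n \<omega>\<bar> ^ 2"] n by simp
    have cyl: "cylinder {0..T} (\<lambda>\<omega>. \<bar>Xs n \<omega> - X' \<omega>\<bar>)" by (intro cylinder_abs cylinder_diff Xs X'T)
    have i: "integrable P (\<lambda>\<omega>. \<bar>Xs n \<omega> - X' \<omega>\<bar>)" by (rule cylinder_integrable[OF T0 PD(1,2) cyl])
    have "(\<integral>\<^sup>+\<omega>. ennreal ((Xs n \<omega> - X' \<omega>)\<^sup>2) \<partial>P) \<le> (\<integral>\<^sup>+\<omega>. ennreal (2 * K * \<bar>Xs n \<omega> - X' \<omega>\<bar>) \<partial>P)"
    proof (intro nn_integral_mono ennreal_leI)
      fix \<omega>
      have "\<bar>Xs n \<omega> - X' \<omega>\<bar> \<le> 2 * K" using K[of \<omega>] K'[of \<omega>] by linarith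
      then have "\<bar>Xs n \<omega> - X' \<omega>\<bar> * \<bar>Xs n \<omega> - X' \<omega>\<bar> \<le> 2 * K * \<bar>Xs n \<omega> - X' \<omega>\<bar>" by (intro mult_right_mono) auto
      then show "(Xs n \<omega> - X' \<omega>)\<^sup>2 \<le> 2 * K * \<bar>Xs n \<omega> - X' \<omega>\<bar>" by (simp add: power2_eq_square abs_mult_self_eq)
    qed
    also have "\<dots> = ennreal (\<integral>\<omega>. 2 * K * \<bar>Xs n \<omega> - X' \<omega>\<bar> \<partial>P)"
      using i K0 by (intro nn_integral_eq_integral) auto
    also have "(\<integral>\<omega>. 2 * K * \<bar>Xs n \<omega> - X' \<omega>\<bar> \<partial>P) \<le> 2 * K * e"
      using PD(3)[OF cyl] m K0 by (simp add: X'_def mult_left_mono)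
    also have "2 * K * e \<le> d / 4" using K0 d by (simp add: e_def field_simps)
    finally have 2: "(\<integral>\<^sup>+\<omega>. ennreal ((Xs n \<omega> - X' \<omega>)\<^sup>2) \<partial>P) \<le> ennreal (d / 4)"
      by (auto intro: ennreal_leI elim: order.trans)
    have "(\<integral>\<^sup>+\<omega>. ennreal ((X \<omega> - X' \<omega>)\<^sup>2) \<partial>P) \<le> (\<integral>\<^sup>+\<omega>. 2 * ennreal ((X \<omega> - Xs n \<omega>)\<^sup>2) + 2 * ennreal ((Xs n \<omega> - X' \<omega>)\<^sup>2) \<partial>P)"
    proof (intro nn_integral_mono)
      fix \<omega>
      have "ennreal ((X \<omega> - X' \<omega>)\<^sup>2) \<le> ennreal (2 * (X \<omega> - Xs n \<omega>)\<^sup>2 + 2 * (Xs n \<omega> - X' \<omega>)\<^sup>2)"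
        using sq_add_le[of "X \<omega> - Xs n \<omega>" "Xs n \<omega> - X' \<omega>"] by (intro ennreal_leI) simp
      then show "ennreal ((X \<omega> - X' \<omega>)\<^sup>2) \<le> 2 * ennreal ((X \<omega> - Xs n \<omega>)\<^sup>2) + 2 * ennreal ((Xs n \<omega> - X' \<omega>)\<^sup>2)"
        by (simp add: ennreal_mult)
    qed
    also have "\<dots> = 2 * (\<integral>\<^sup>+\<omega>. ennreal ((X \<omega> - Xs n \<omega>)\<^sup>2) \<partial>P) + 2 * (\<integral>\<^sup>+\<omega>. ennreal ((Xs n \<omega> - X' \<omega>)\<^sup>2) \<partial>P)"
      by (simp add: nn_integral_add nn_integral_cmult)
    also have "\<dots> \<le> 2 * ennreal (d / 4) + 2 * ennreal (d / 4)" by (intro add_mono mult_left_mono 1 2) auto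
    also have "\<dots> = ennreal (2 * (d / 4) + 2 * (d / 4))" using d by (simp only: ennreal_plus ennreal_mult ennreal_numeral)
    also have "2 * (d / 4) + 2 * (d / 4) = d" by simp
    finally show ?thesis .
  qed
  then show ?thesis using X' by blast
qed

lemma LG_measurable: "X \<in> LG T Ehat p \<Longrightarrow> X \<in> borel_measurable (path_borel T)"
  unfolding LG_def LG_represents_def by blast

lemma LG_vec_measurable: "\<zeta> \<in> LG_vec T Ehat p \<Longrightarrow> \<zeta> \<in> borel_measurable (path_borel T)"
  using LG_measurable unfolding LG_vec_def by (subst borel_measurable_euclidean_space) blast

lemma LG_vec_square_approx:
  fixes \<zeta> :: "(real \<Rightarrow> real) \<Rightarrow> 'b::euclidean_space"
  assumes \<zeta>: "\<zeta> \<in> LG_vec T Ehat 2" and d: "0 < d"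
  obtains \<zeta>' where "\<And>b. b \<in> Basis \<Longrightarrow> cylinder (dyadics T) (\<lambda>\<omega>. \<zeta>' \<omega> \<bullet> b)"
    "\<And>P. P \<in> dominated_on_L_ip T Ehat \<Longrightarrow> (\<integral>\<^sup>+\<omega>. ennreal ((norm (\<zeta> \<omega> - \<zeta>' \<omega>))\<^sup>2) \<partial>P) \<le> ennreal d"
proof -
  define d' where "d' = d / real DIM('b)"
  have d': "0 < d'" using d by (simp add: d'_def)
  have "\<forall>b\<in>Basis. \<exists>X'. cylinder (dyadics T) X' \<and>
    (\<forall>P\<in>dominated_on_L_ip T Ehat. (\<integral>\<^sup>+\<omega>. ennreal ((\<zeta> \<omega> \<bullet> b - X' \<omega>)\<^sup>2) \<partial>P) \<le> ennreal d')"
    using \<zeta> LG_square_approx[OF _ d'] unfolding LG_vec_def by blast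
  then obtain X where X: "\<And>b. b \<in> Basis \<Longrightarrow> cylinder (dyadics T) (X b)"
    "\<And>b P. b \<in> Basis \<Longrightarrow> P \<in> dominated_on_L_ip T Ehat \<Longrightarrow> (\<integral>\<^sup>+\<omega>. ennreal ((\<zeta> \<omega> \<bullet> b - X b \<omega>)\<^sup>2) \<partial>P) \<le> ennreal d'"
    by metis
  define \<zeta>' where "\<zeta>' \<omega> = (\<Sum>b\<in>Basis. X b \<omega> *\<^sub>R b)" for \<omega>
  have \<zeta>': "\<zeta>' \<omega> \<bullet> b = X b \<omega>" if "b \<in> Basis" for \<omega> b
    using that by (simp add: \<zeta>'_def inner_sum_left_Basis)
  show ?thesis
  proof (rule that[of \<zeta>'])
    show "cylinder (dyadics T) (\<lambda>\<omega>. \<zeta>' \<omega> \<bullet> b)" if "b \<in> Basis" for b using X(1)[OF that] that by (simp add: \<zeta>')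
    fix P assume P: "P \<in> dominated_on_L_ip T Ehat"
    have meas: "(\<lambda>\<omega>. ennreal ((\<zeta> \<omega> \<bullet> b - X b \<omega>)\<^sup>2)) \<in> borel_measurable P" if b: "b \<in> Basis" for b
    proof -
      have [measurable]: "\<zeta> \<in> borel_measurable P" by (rule dominated_measurable[OF P LG_vec_measurable[OF \<zeta>]])
      have [measurable]: "X b \<in> borel_measurable P"
        by (rule dominated_measurable[OF P cylinder_measurable[OF T0 cylinder_dyadics[OF X(1)[OF b]]]])
      show ?thesis by measurable
    qed
    have "(\<integral>\<^sup>+\<omega>. ennreal ((norm (\<zeta> \<omega> - \<zeta>' \<omega>))\<^sup>2) \<partial>P) = (\<integral>\<^sup>+\<omega>. (\<Sum>b\<in>Basis. ennreal ((\<zeta> \<omega> \<bullet> b - X b \<omega>)\<^sup>2)) \<partial>P)"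
      by (intro nn_integral_cong) (simp add: norm_sq_Basis inner_diff_left \<zeta>' sum_ennreal)
    also have "\<dots> = (\<Sum>b\<in>Basis. \<integral>\<^sup>+\<omega>. ennreal ((\<zeta> \<omega> \<bullet> b - X b \<omega>)\<^sup>2) \<partial>P)" by (rule nn_integral_sum[OF meas])
    also have "\<dots> \<le> (\<Sum>b\<in>(Basis :: 'b set). ennreal d')" by (intro sum_mono X(2) P)
    also have "\<dots> = ennreal (\<Sum>b\<in>(Basis :: 'b set). d')" using d' by (intro sum_ennreal) auto
    also have "(\<Sum>b\<in>(Basis :: 'b set). d') = d" by (simp add: d'_def)
    finally show "(\<integral>\<^sup>+\<omega>. ennreal ((norm (\<zeta> \<omega> - \<zeta>' \<omega>))\<^sup>2) \<partial>P) \<le> ennreal d" .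
  qed
qed

lemma cylinder_vec_bounded:
  fixes \<zeta>' :: "(real \<Rightarrow> real) \<Rightarrow> 'b::euclidean_space"
  assumes "\<And>b. b \<in> Basis \<Longrightarrow> cylinder D (\<lambda>\<omega>. \<zeta>' \<omega> \<bullet> b)"
  shows "\<exists>B\<ge>0. \<forall>\<omega>. norm (\<zeta>' \<omega>) \<le> B"
proof -
  have "\<forall>b\<in>Basis. \<exists>K. \<forall>\<omega>. \<bar>\<zeta>' \<omega> \<bullet> b\<bar> \<le> K" using assms unfolding cylinder_def by blast
  then obtain K where K: "\<And>b \<omega>. b \<in> Basis \<Longrightarrow> \<bar>\<zeta>' \<omega> \<bullet> b\<bar> \<le> K b" by metis
  have le: "norm (\<zeta>' \<omega>) \<le> (\<Sum>b\<in>Basis. K b)" for \<omega>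
    by (rule order.trans[OF norm_le_l1]) (intro sum_mono K)
  have "0 \<le> (\<Sum>b\<in>Basis. K b)" using le[of undefined] norm_ge_zero order.trans by blast
  then show ?thesis using le by blast
qed

text \<open>A single bounded approximation at distance 1 already bounds the second moment under all
  dominated measures at once.\<close>

lemma LG_vec_square_integrable:
  fixes \<zeta> :: "(real \<Rightarrow> real) \<Rightarrow> 'b::euclidean_space"
  assumes \<zeta>: "\<zeta> \<in> LG_vec T Ehat 2"
  shows "\<exists>R\<ge>0. \<forall>P\<in>dominated_on_L_ip T Ehat. integrable P (\<lambda>\<omega>. (norm (\<zeta> \<omega>))\<^sup>2) \<and> (\<integral>\<omega>. (norm (\<zeta> \<omega>))\<^sup>2 \<partial>P) \<le> R"
proof -
  obtain \<zeta>' where \<zeta>': "\<And>b. b \<in> Basis \<Longrightarrow> cylinder (dyadics T) (\<lambda>\<omega>. \<zeta>' \<omega> \<bullet> b)"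
    and ap: "\<And>P. P \<in> dominated_on_L_ip T Ehat \<Longrightarrow> (\<integral>\<^sup>+\<omega>. ennreal ((norm (\<zeta> \<omega> - \<zeta>' \<omega>))\<^sup>2) \<partial>P) \<le> ennreal 1"
    by (rule LG_vec_square_approx[OF \<zeta> zero_less_one]) (rule that)
  obtain B where B: "0 \<le> B" "\<And>\<omega>. norm (\<zeta>' \<omega>) \<le> B" using cylinder_vec_bounded[OF \<zeta>'] by blast
  have "integrable P (\<lambda>\<omega>. (norm (\<zeta> \<omega>))\<^sup>2) \<and> (\<integral>\<omega>. (norm (\<zeta> \<omega>))\<^sup>2 \<partial>P) \<le> 2 + 2 * B\<^sup>2"
    if P: "P \<in> dominated_on_L_ip T Ehat" for P
  proof -
    interpret prob_space P by (rule dominatedD(1)[OF P])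
    have [measurable]: "\<zeta> \<in> borel_measurable P" by (rule dominated_measurable[OF P LG_vec_measurable[OF \<zeta>]])
    have "(\<lambda>\<omega>. \<zeta>' \<omega> \<bullet> b) \<in> borel_measurable P" if "b \<in> Basis" for b
      by (rule dominated_measurable[OF P cylinder_measurable[OF T0 cylinder_dyadics[OF \<zeta>'[OF that]]]])
    then have [measurable]: "\<zeta>' \<in> borel_measurable P" by (subst borel_measurable_euclidean_space) blast
    have "(\<integral>\<^sup>+\<omega>. ennreal ((norm (\<zeta> \<omega>))\<^sup>2) \<partial>P) \<le> (\<integral>\<^sup>+\<omega>. 2 * ennreal ((norm (\<zeta> \<omega> - \<zeta>' \<omega>))\<^sup>2) + ennreal (2 * B\<^sup>2) \<partial>P)"
    proof (intro nn_integral_mono)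
      fix \<omega>
      have "(norm (\<zeta> \<omega>))\<^sup>2 \<le> 2 * (norm (\<zeta> \<omega> - \<zeta>' \<omega>))\<^sup>2 + 2 * (norm (\<zeta>' \<omega>))\<^sup>2"
        using norm_sq_add_le[of "\<zeta> \<omega> - \<zeta>' \<omega>" "\<zeta>' \<omega>"] by simp
      moreover have "(norm (\<zeta>' \<omega>))\<^sup>2 \<le> B\<^sup>2" using B(2) by (intro power_mono) auto
      ultimately have "ennreal ((norm (\<zeta> \<omega>))\<^sup>2) \<le> ennreal (2 * (norm (\<zeta> \<omega> - \<zeta>' \<omega>))\<^sup>2 + 2 * B\<^sup>2)" by (intro ennreal_leI) simp
      then show "ennreal ((norm (\<zeta> \<omega>))\<^sup>2) \<le> 2 * ennreal ((norm (\<zeta> \<omega> - \<zeta>' \<omega>))\<^sup>2) + ennreal (2 * B\<^sup>2)"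
        by (simp add: ennreal_mult)
    qed
    also have "\<dots> = 2 * (\<integral>\<^sup>+\<omega>. ennreal ((norm (\<zeta> \<omega> - \<zeta>' \<omega>))\<^sup>2) \<partial>P) + ennreal (2 * B\<^sup>2)"
      by (simp add: nn_integral_add nn_integral_cmult emeasure_space_1)
    also have "\<dots> \<le> 2 * ennreal 1 + ennreal (2 * B\<^sup>2)" by (intro add_mono mult_left_mono ap[OF P]) auto
    also have "\<dots> = ennreal (2 + 2 * B\<^sup>2)" by (simp add: ennreal_plus)
    finally have le: "(\<integral>\<^sup>+\<omega>. ennreal ((norm (\<zeta> \<omega>))\<^sup>2) \<partial>P) \<le> ennreal (2 + 2 * B\<^sup>2)" .
    have i: "integrable P (\<lambda>\<omega>. (norm (\<zeta> \<omega>))\<^sup>2)"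
      by (rule integrableI_bounded) (use le in \<open>auto intro: le_less_trans\<close>)
    have "ennreal (\<integral>\<omega>. (norm (\<zeta> \<omega>))\<^sup>2 \<partial>P) \<le> ennreal (2 + 2 * B\<^sup>2)"
      using le i by (subst nn_integral_eq_integral[symmetric]) auto
    then have "(\<integral>\<omega>. (norm (\<zeta> \<omega>))\<^sup>2 \<partial>P) \<le> 2 + 2 * B\<^sup>2" by (subst (asm) ennreal_le_iff) auto
    then show ?thesis using i by blast
  qed
  then show ?thesis by (intro exI[of _ "2 + 2 * B\<^sup>2"]) auto
qed

text \<open>The subsequence is chosen before \<open>\<Theta>\<close>, so that one subsequence serves
  several functionals. The estimate has three terms of size \<open>K * \<delta>\<close>:
  \<open>\<zeta>\<close> is replaced by a dyadic cylinder map under \<open>P (r n)\<close> and under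
  the limit, and the two laws of that map are coupled through \<open>Y n\<close> and
  \<open>Z\<close>, whose images converge boundedly.\<close>

lemma law_functional_compactness:
  fixes \<zeta> :: "(real \<Rightarrow> real) \<Rightarrow> 'b::euclidean_space"
  assumes \<zeta>: "\<zeta> \<in> LG_vec T Ehat 2" and P: "\<And>n. P n \<in> dominated_on_L_ip T Ehat"
  obtains r P' where "strict_mono (r :: nat \<Rightarrow> nat)" "P' \<in> dominated_on_L_ip T Ehat"
    "\<And>\<Theta>. coupling_Lipschitz \<Theta> \<Longrightarrow> (\<lambda>n. \<Theta> (distr (P (r n)) borel \<zeta>)) \<longlonglongrightarrow> \<Theta> (distr P' borel \<zeta>)"
proof -
  have dom: "\<forall>\<^sub>F n in sequentially. integral\<^sup>L (P n) X \<le> Ehat X + e" if "cylinder (dyadics T) X" "0 < e" for X e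
    using dominatedD(3)[OF P cylinder_dyadics[OF that(1)]] that(2)
    by (intro always_eventually allI) (meson add_increasing2 less_imp_le order.trans order_refl add_mono)
  obtain r P' \<Omega> and Y :: "nat \<Rightarrow> real \<Rightarrow> nat \<Rightarrow> real" and Z where r: "strict_mono r"
    and P': "P' \<in> dominated_on_L_ip T Ehat" and \<Omega>: "prob_space \<Omega>"
    and Y[measurable]: "\<And>n. Y n \<in> measurable \<Omega> RN" and Z[measurable]: "Z \<in> measurable \<Omega> RN"
    and lawY: "\<And>n. distr \<Omega> RN (Y n) = distr (P (r n)) RN (dyadic_coords T)"
    and lawZ: "distr \<Omega> RN Z = distr P' RN (dyadic_coords T)"
    and conv: "AE w in \<Omega>. \<forall>i. (\<lambda>n. Y n w i) \<longlonglongrightarrow> Z w i"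
    by (rule sequential_compactness[OF dominatedD(1)[OF P] dominatedD(2)[OF P]], erule (1) dom) (rule that)
  interpret \<Omega>: prob_space \<Omega> by (rule \<Omega>)
  obtain R0 where R0: "0 \<le> R0" "\<And>P. P \<in> dominated_on_L_ip T Ehat \<Longrightarrow> integrable P (\<lambda>\<omega>. (norm (\<zeta> \<omega>))\<^sup>2)"
     "\<And>P. P \<in> dominated_on_L_ip T Ehat \<Longrightarrow> (\<integral>\<omega>. (norm (\<zeta> \<omega>))\<^sup>2 \<partial>P) \<le> R0"
    using LG_vec_square_integrable[OF \<zeta>] by blast
  \<comment> \<open>Covers \<open>\<zeta>\<close> and its approximation: the square of the latter is
    at most twice that of \<open>\<zeta>\<close> plus twice the squared error, whose mean is at most
    1.\<close>
  define R where "R = 2 * R0 + 2"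
  have "(\<lambda>n. \<Theta> (distr (P (r n)) borel \<zeta>)) \<longlonglongrightarrow> \<Theta> (distr P' borel \<zeta>)" if \<Theta>: "coupling_Lipschitz \<Theta>" for \<Theta>
  proof (rule LIMSEQ_I)
    fix e :: real assume e: "0 < e"
    from spec[OF \<Theta>[unfolded coupling_Lipschitz_def], of R]
    obtain K where K0: "0 \<le> K" and K': "\<forall>(\<pi> :: ('b \<times> 'b) measure) \<delta>. 0 < \<delta> \<longrightarrow>
     prob_space \<pi> \<and> sets \<pi> = sets borel \<and>
     integrable \<pi> (\<lambda>z. (norm (fst z))\<^sup>2) \<and> integrable \<pi> (\<lambda>z. (norm (snd z))\<^sup>2) \<and>
     (\<integral>z. (norm (fst z))\<^sup>2 \<partial>\<pi>) \<le> R \<and> (\<integral>z. (norm (snd z))\<^sup>2 \<partial>\<pi>) \<le> R \<and>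
     (\<integral>z. (dist (fst z) (snd z))\<^sup>2 \<partial>\<pi>) \<le> \<delta>\<^sup>2 \<longrightarrow>
     \<bar>\<Theta> (distr \<pi> borel fst) - \<Theta> (distr \<pi> borel snd)\<bar> \<le> K * \<delta>"
      by (elim exE conjE)
    note K = K'[THEN spec, THEN spec, THEN mp, THEN mp]
    \<comment> \<open>Three terms of at most \<open>e / 4\<close> stay below \<open>e\<close>; the
      bound by 1 enters the choice of \<open>R\<close>.\<close>
    define \<delta> where "\<delta> = min 1 (e / (4 * (K + 1)))"
    have \<delta>: "0 < \<delta>" "\<delta> \<le> 1" using e K0 by (auto simp: \<delta>_def)
    have "K * \<delta> \<le> (K + 1) * (e / (4 * (K + 1)))" using K0 e by (intro mult_mono) (auto simp: \<delta>_def)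
    also have "\<dots> = e / 4"
    proof -
      have "k * (e / (4 * k)) = e / 4" if "k \<noteq> 0" for k :: real using that by simp
      from this[of "K + 1"] show ?thesis using K0 by linarith
    qed
    finally have K\<delta>: "K * \<delta> \<le> e / 4" .
    have \<delta>2: "0 < \<delta>\<^sup>2" "\<delta>\<^sup>2 \<le> 1" using \<delta> by (auto simp: power_le_one)
    obtain \<zeta>' where \<zeta>': "\<And>b. b \<in> Basis \<Longrightarrow> cylinder (dyadics T) (\<lambda>\<omega>. \<zeta>' \<omega> \<bullet> b)"
      and ap: "\<And>P. P \<in> dominated_on_L_ip T Ehat \<Longrightarrow> (\<integral>\<^sup>+\<omega>. ennreal ((norm (\<zeta> \<omega> - \<zeta>' \<omega>))\<^sup>2) \<partial>P) \<le> ennreal (\<delta>\<^sup>2)"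
      by (rule LG_vec_square_approx[OF \<zeta> \<delta>2(1)]) (rule that)
    obtain B where B: "0 \<le> B" "\<And>\<omega>. norm (\<zeta>' \<omega>) \<le> B" using cylinder_vec_bounded[OF \<zeta>'] by blast
    have near: "\<zeta>' \<in> borel_measurable Q" "integrable Q (\<lambda>\<omega>. (norm (\<zeta>' \<omega>))\<^sup>2)" "(\<integral>\<omega>. (norm (\<zeta>' \<omega>))\<^sup>2 \<partial>Q) \<le> R"
      "\<bar>\<Theta> (distr Q borel \<zeta>) - \<Theta> (distr Q borel \<zeta>')\<bar> \<le> K * \<delta>" if Q: "Q \<in> dominated_on_L_ip T Ehat" for Q
    proof -
      interpret Q: prob_space Q by (rule dominatedD(1)[OF Q])
      have \<zeta>m[measurable]: "\<zeta> \<in> borel_measurable Q" by (rule dominated_measurable[OF Q LG_vec_measurable[OF \<zeta>]])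
      have "(\<lambda>\<omega>. \<zeta>' \<omega> \<bullet> b) \<in> borel_measurable Q" if "b \<in> Basis" for b
        by (rule dominated_measurable[OF Q cylinder_measurable[OF T0 cylinder_dyadics[OF \<zeta>'[OF that]]]])
      then show \<zeta>'m[measurable]: "\<zeta>' \<in> borel_measurable Q" by (subst borel_measurable_euclidean_space) blast
      show i': "integrable Q (\<lambda>\<omega>. (norm (\<zeta>' \<omega>))\<^sup>2)"
        using B by (intro Q.integrable_const_bound[where B="B\<^sup>2"]) (auto intro!: power_mono)
      have id: "integrable Q (\<lambda>\<omega>. (norm (\<zeta> \<omega> - \<zeta>' \<omega>))\<^sup>2)"
        by (rule square_integrable_diff[OF \<zeta>m \<zeta>'m R0(2)[OF Q] i'])
      have "ennreal (\<integral>\<omega>. (norm (\<zeta> \<omega> - \<zeta>' \<omega>))\<^sup>2 \<partial>Q) \<le> ennreal (\<delta>\<^sup>2)"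
        using ap[OF Q] id by (subst nn_integral_eq_integral[symmetric]) auto
      then have d: "(\<integral>\<omega>. (norm (\<zeta> \<omega> - \<zeta>' \<omega>))\<^sup>2 \<partial>Q) \<le> \<delta>\<^sup>2" by (subst (asm) ennreal_le_iff) auto
      have "(\<integral>\<omega>. (norm (\<zeta>' \<omega>))\<^sup>2 \<partial>Q) \<le> (\<integral>\<omega>. 2 * (norm (\<zeta> \<omega>))\<^sup>2 + 2 * (norm (\<zeta> \<omega> - \<zeta>' \<omega>))\<^sup>2 \<partial>Q)"
      proof (rule integral_mono[OF i'])
        show "integrable Q (\<lambda>\<omega>. 2 * (norm (\<zeta> \<omega>))\<^sup>2 + 2 * (norm (\<zeta> \<omega> - \<zeta>' \<omega>))\<^sup>2)" using R0(2)[OF Q] id by auto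
        show "(norm (\<zeta>' \<omega>))\<^sup>2 \<le> 2 * (norm (\<zeta> \<omega>))\<^sup>2 + 2 * (norm (\<zeta> \<omega> - \<zeta>' \<omega>))\<^sup>2" for \<omega>
          using norm_sq_add_le[of "\<zeta> \<omega>" "- (\<zeta> \<omega> - \<zeta>' \<omega>)"] by (simp only: norm_minus_cancel) simp
      qed
      also have "\<dots> = 2 * (\<integral>\<omega>. (norm (\<zeta> \<omega>))\<^sup>2 \<partial>Q) + 2 * (\<integral>\<omega>. (norm (\<zeta> \<omega> - \<zeta>' \<omega>))\<^sup>2 \<partial>Q)"
        using R0(2)[OF Q] id by simp
      also have "\<dots> \<le> R" using R0(3)[OF Q] d \<delta>2 unfolding R_def by linarith
      finally show R': "(\<integral>\<omega>. (norm (\<zeta>' \<omega>))\<^sup>2 \<partial>Q) \<le> R" .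
      have RR: "(\<integral>\<omega>. (norm (\<zeta> \<omega>))\<^sup>2 \<partial>Q) \<le> R" using R0(3)[OF Q] R0(1) by (simp add: R_def)
      show "\<bar>\<Theta> (distr Q borel \<zeta>) - \<Theta> (distr Q borel \<zeta>')\<bar> \<le> K * \<delta>"
        by (rule coupling_LipschitzD[OF K Q.prob_space_axioms \<zeta>m \<zeta>'m R0(2)[OF Q] RR i' R' \<delta>(1)])
           (use d in \<open>auto simp: dist_norm\<close>)
    qed
    define G where "G y = \<zeta>' (dyadic_path T y)" for y
    have G[measurable]: "G \<in> borel_measurable RN"
      unfolding G_def using cylinder_path_measurable[OF \<zeta>'] by (subst borel_measurable_euclidean_space) blast
    have GB: "norm (G y) \<le> B" for y unfolding G_def by (rule B(2))
    have Gc: "G (dyadic_coords T \<omega>) = \<zeta>' \<omega>" for \<omega>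
      unfolding G_def by (rule euclidean_eqI) (rule cylinder_dyadic_path[OF \<zeta>'])
    have lawG: "distr \<Omega> borel (\<lambda>w. G (y w)) = distr Q borel \<zeta>'"
      if y[measurable]: "y \<in> measurable \<Omega> RN" and l: "distr \<Omega> RN y = distr Q RN (dyadic_coords T)"
        and Q: "Q \<in> dominated_on_L_ip T Ehat" for y Q
    proof -
      have [measurable]: "dyadic_coords T \<in> measurable Q RN" by (rule dominated_measurable[OF Q dyadic_coords_measurable[OF T]])
      have "distr \<Omega> borel (\<lambda>w. G (y w)) = distr (distr \<Omega> RN y) borel G" by (simp add: distr_distr comp_def)
      also have "\<dots> = distr Q borel (\<lambda>\<omega>. G (dyadic_coords T \<omega>))" unfolding l by (simp add: distr_distr comp_def)
      finally show ?thesis by (simp add: Gc)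
    qed
    have Gint: "integrable \<Omega> (\<lambda>w. (norm (G (y w)))\<^sup>2)" "(\<integral>w. (norm (G (y w)))\<^sup>2 \<partial>\<Omega>) \<le> R"
      if y[measurable]: "y \<in> measurable \<Omega> RN" and l: "distr \<Omega> RN y = distr Q RN (dyadic_coords T)"
        and Q: "Q \<in> dominated_on_L_ip T Ehat" for y Q
    proof -
      show "integrable \<Omega> (\<lambda>w. (norm (G (y w)))\<^sup>2)"
        using GB by (intro \<Omega>.integrable_const_bound[where B="B\<^sup>2"]) (auto intro!: power_mono)
      have "(\<integral>w. (norm (G (y w)))\<^sup>2 \<partial>\<Omega>) = (\<integral>x. (norm x)\<^sup>2 \<partial>distr \<Omega> borel (\<lambda>w. G (y w)))"
        by (subst integral_distr) auto
      also have "\<dots> = (\<integral>\<omega>. (norm (\<zeta>' \<omega>))\<^sup>2 \<partial>Q)"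
        unfolding lawG[OF y l Q] using near(1)[OF Q] by (subst integral_distr) auto
      finally show "(\<integral>w. (norm (G (y w)))\<^sup>2 \<partial>\<Omega>) \<le> R" using near(3)[OF Q] by simp
    qed
    have "(\<lambda>n. \<integral>w. (dist (G (Y n w)) (G (Z w)))\<^sup>2 \<partial>\<Omega>) \<longlonglongrightarrow> (\<integral>w. 0 \<partial>\<Omega>)"
    proof (rule integral_dominated_convergence[where w="\<lambda>_. (2 * B)\<^sup>2"])
      show "AE w in \<Omega>. (\<lambda>n. (dist (G (Y n w)) (G (Z w)))\<^sup>2) \<longlonglongrightarrow> 0"
        using conv
      proof eventually_elim
        case (elim w)
        have "(\<lambda>n. G (Y n w)) \<longlonglongrightarrow> G (Z w)"
          unfolding G_def using elim by (subst tendsto_componentwise_iff) (auto intro: cylinder_path_tendsto[OF \<zeta>'])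
        then have "(\<lambda>n. (dist (G (Y n w)) (G (Z w)))\<^sup>2) \<longlonglongrightarrow> (dist (G (Z w)) (G (Z w)))\<^sup>2"
          by (intro tendsto_intros)
        then show ?case by simp
      qed
      show "AE w in \<Omega>. norm ((dist (G (Y n w)) (G (Z w)))\<^sup>2) \<le> (2 * B)\<^sup>2" for n
      proof (rule AE_I2)
        fix w
        have "dist (G (Y n w)) (G (Z w)) \<le> B + B"
          unfolding dist_norm G_def by (rule order.trans[OF norm_triangle_ineq4 add_mono[OF B(2) B(2)]])
        then have "(dist (G (Y n w)) (G (Z w)))\<^sup>2 \<le> (2 * B)\<^sup>2" by (intro power_mono) auto
        then show "norm ((dist (G (Y n w)) (G (Z w)))\<^sup>2) \<le> (2 * B)\<^sup>2" by simp
      qed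
    qed auto
    then have "(\<lambda>n. \<integral>w. (dist (G (Y n w)) (G (Z w)))\<^sup>2 \<partial>\<Omega>) \<longlonglongrightarrow> 0" by simp
    then have "\<forall>\<^sub>F n in sequentially. (\<integral>w. (dist (G (Y n w)) (G (Z w)))\<^sup>2 \<partial>\<Omega>) < \<delta>\<^sup>2"
      using \<delta>2(1) by (rule order_tendstoD)
    then obtain N where N: "\<And>n. n \<ge> N \<Longrightarrow> (\<integral>w. (dist (G (Y n w)) (G (Z w)))\<^sup>2 \<partial>\<Omega>) < \<delta>\<^sup>2"
      by (auto simp: eventually_sequentially)
    show "\<exists>N. \<forall>n\<ge>N. norm (\<Theta> (distr (P (r n)) borel \<zeta>) - \<Theta> (distr P' borel \<zeta>)) < e"
    proof (intro exI allI impI)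
      fix n assume n: "N \<le> n"
      have "\<bar>\<Theta> (distr \<Omega> borel (\<lambda>w. G (Y n w))) - \<Theta> (distr \<Omega> borel (\<lambda>w. G (Z w)))\<bar> \<le> K * \<delta>"
        by (rule coupling_LipschitzD[OF K \<Omega> _ _ Gint[OF Y lawY P] Gint[OF Z lawZ P'] \<delta>(1)])
           (use N[OF n] in auto)
      then have "\<bar>\<Theta> (distr (P (r n)) borel \<zeta>') - \<Theta> (distr P' borel \<zeta>')\<bar> \<le> K * \<delta>"
        by (simp add: lawG[OF Y lawY P] lawG[OF Z lawZ P'])
      then have "\<bar>\<Theta> (distr (P (r n)) borel \<zeta>) - \<Theta> (distr P' borel \<zeta>)\<bar> \<le> 3 * (K * \<delta>)"
        using near(4)[OF P[of "r n"]] near(4)[OF P'] by linarith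
      then show "norm (\<Theta> (distr (P (r n)) borel \<zeta>) - \<Theta> (distr P' borel \<zeta>)) < e"
        using K\<delta> e unfolding real_norm_def by linarith
    qed
  qed
  then show ?thesis by (rule that[OF r P'])
qed

end

text \<open>Points with value above \<open>n\<close> would have a subsequence of convergent, hence
  bounded, values, although \<open>r n \<ge> n\<close>.\<close>

lemma sequentially_compact_bdd_above:
  fixes h :: "'p \<Rightarrow> real"
  assumes cpt: "\<And>p :: nat \<Rightarrow> 'p. (\<And>n. p n \<in> Q) \<Longrightarrow> \<exists>r p'. strict_mono (r :: nat \<Rightarrow> nat) \<and> (\<lambda>n. h (p (r n))) \<longlonglongrightarrow> h p'"
  shows "bdd_above (h ` Q)"
proof (rule ccontr)
  assume "\<not> bdd_above (h ` Q)"
  then have "\<forall>n::nat. \<exists>p\<in>Q. real n < h p" unfolding bdd_above_def by (force simp: not_le)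
  then obtain p where p: "\<And>n::nat. p n \<in> Q" "\<And>n. real n < h (p n)" by metis
  then obtain r p' where r: "strict_mono (r :: nat \<Rightarrow> nat)" "(\<lambda>n. h (p (r n))) \<longlonglongrightarrow> h p'" using cpt[of p] by blast
  obtain K where K: "\<And>n. \<bar>h (p (r n))\<bar> \<le> K"
    using convergent_imp_Bseq[OF convergentI[OF r(2)]] unfolding Bseq_def by auto
  obtain n :: nat where n: "K \<le> real n" using real_arch_simple by blast
  have "real n \<le> real (r n)" using seq_suble[OF r(1), of n] by simp
  then show False using p(2)[of "r n"] K[of n] n by linarith
qed

text \<open>
  Near-maximizers of the perturbed functionals accumulate at maximizers of the unperturbed one,
  which gives the upper bound.
\<close>

lemma Danskin:
  fixes F0 A :: "'p \<Rightarrow> real" and Fe :: "real \<Rightarrow> 'p \<Rightarrow> real"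
  assumes ne: "Q \<noteq> {}" and K: "0 \<le> K"
    and Taylor: "\<And>\<epsilon> p. p \<in> Q \<Longrightarrow> \<bar>Fe \<epsilon> p - F0 p - \<epsilon> * A p\<bar> \<le> K * \<epsilon>\<^sup>2"
    and cpt: "\<And>p :: nat \<Rightarrow> 'p. (\<And>n. p n \<in> Q) \<Longrightarrow>
      \<exists>r. \<exists>p'\<in>Q. strict_mono (r :: nat \<Rightarrow> nat) \<and> (\<lambda>n. F0 (p (r n))) \<longlonglongrightarrow> F0 p' \<and> (\<lambda>n. A (p (r n))) \<longlonglongrightarrow> A p'"
  shows "((\<lambda>\<epsilon>. ((SUP p\<in>Q. Fe \<epsilon> p) - (SUP p\<in>Q. F0 p)) / \<epsilon>) \<longlongrightarrow>
      (SUP p\<in>{p \<in> Q. F0 p = (SUP p\<in>Q. F0 p)}. A p)) (at_right 0)"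
proof -
  define s where "s = (SUP p\<in>Q. F0 p)"
  define M where "M = {p \<in> Q. F0 p = s}"
  define S where "S = (SUP p\<in>M. A p)"
  define q where "q \<epsilon> = ((SUP p\<in>Q. Fe \<epsilon> p) - s) / \<epsilon>" for \<epsilon>
  have bF0: "bdd_above (F0 ` Q)" by (rule sequentially_compact_bdd_above) (use cpt in blast)
  have bA: "bdd_above (A ` Q)" by (rule sequentially_compact_bdd_above) (use cpt in blast)
  have F0s: "F0 p \<le> s" if "p \<in> Q" for p unfolding s_def using that bF0 by (rule cSUP_upper)
  have bM: "bdd_above (A ` M)" by (rule bdd_above_mono[OF bA]) (auto simp: M_def)
  \<comment> \<open>A supremum of reals controls its members only for sets bounded above; the bound
    comes from those of \<open>F0\<close> and \<open>A\<close> through the expansion.\<close>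
  have bFe: "bdd_above (Fe \<epsilon> ` Q)" if "0 < \<epsilon>" for \<epsilon>
  proof -
    obtain a where a: "\<And>p. p \<in> Q \<Longrightarrow> A p \<le> a" using bA unfolding bdd_above_def by auto
    have "Fe \<epsilon> p \<le> s + \<epsilon> * a + K * \<epsilon>\<^sup>2" if "p \<in> Q" for p
    proof -
      have "\<epsilon> * A p \<le> \<epsilon> * a" using a[OF that] \<open>0 < \<epsilon>\<close> by (intro mult_left_mono) auto
      then show ?thesis using Taylor[OF that, of \<epsilon>] F0s[OF that] by linarith
    qed
    then show ?thesis by (intro bdd_aboveI2)
  qed
  have limit_max: "p' \<in> M"
    if "\<And>n. p n \<in> Q" "p' \<in> Q" "(\<lambda>n. F0 (p n)) \<longlonglongrightarrow> F0 p'" "(\<lambda>n. s - c n) \<longlonglongrightarrow> s" "\<And>n. s - c n \<le> F0 (p n)" for p p' c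
  proof -
    have "s \<le> F0 p'" by (rule LIMSEQ_le[OF that(4,3)]) (use that(5) in blast)
    then show ?thesis using F0s[OF that(2)] that(2) by (simp add: M_def)
  qed
  \<comment> \<open>Maximizers exist because near-maximizers accumulate in \<open>Q\<close>;
    otherwise \<open>S\<close> would be a supremum over the empty set.\<close>
  have Mne: "M \<noteq> {}"
  proof -
    have "\<exists>p\<in>Q. s - 1 / real (Suc n) < F0 p" for n
      using less_cSUP_iff[OF ne bF0, of "s - 1 / real (Suc n)"] by (simp add: s_def)
    then obtain p where p: "\<And>n. p n \<in> Q" "\<And>n. s - 1 / real (Suc n) < F0 (p n)" by metis
    obtain r p' where r: "p' \<in> Q" "strict_mono (r :: nat \<Rightarrow> nat)" "(\<lambda>n. F0 (p (r n))) \<longlonglongrightarrow> F0 p'" using cpt[of p] p(1) by blast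
    have "(\<lambda>n. s - 1 / real (Suc n)) \<longlonglongrightarrow> s - 0" by (intro tendsto_intros LIMSEQ_Suc lim_1_over_n)
    from LIMSEQ_subseq_LIMSEQ[OF this r(2)] have "(\<lambda>n. s - 1 / real (Suc (r n))) \<longlonglongrightarrow> s" by (simp add: comp_def)
    then have "p' \<in> M" using p r by (intro limit_max[of "\<lambda>n. p (r n)" p' "\<lambda>n. 1 / real (Suc (r n))"]) (auto intro: less_imp_le)
    then show ?thesis by blast
  qed
  have lower: "S - K * \<epsilon> \<le> q \<epsilon>" if e: "0 < \<epsilon>" for \<epsilon>
  proof -
    have "A p \<le> q \<epsilon> + K * \<epsilon>" if p: "p \<in> M" for p
    proof -
      have pQ: "p \<in> Q" and ps: "F0 p = s" using p by (auto simp: M_def)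
      have "s + \<epsilon> * A p - K * \<epsilon>\<^sup>2 \<le> Fe \<epsilon> p" using Taylor[OF pQ, of \<epsilon>] ps by linarith
      also have "\<dots> \<le> (SUP p\<in>Q. Fe \<epsilon> p)" by (rule cSUP_upper[OF pQ bFe[OF e]])
      finally have "\<epsilon> * (A p - K * \<epsilon>) \<le> (SUP p\<in>Q. Fe \<epsilon> p) - s" by (simp add: power2_eq_square algebra_simps)
      then have "A p - K * \<epsilon> \<le> q \<epsilon>" unfolding q_def pos_le_divide_eq[OF e] by (simp add: mult.commute)
      then show ?thesis by linarith
    qed
    then have "S \<le> q \<epsilon> + K * \<epsilon>" unfolding S_def by (intro cSUP_least[OF Mne])
    then show ?thesis by simp
  qed
  have upper: "\<forall>\<^sub>F \<epsilon> in at_right 0. q \<epsilon> < S + d" if d: "0 < d" for d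
  proof (rule ccontr)
    assume neg: "\<not> ?thesis"
    have "\<exists>\<epsilon>. 0 < \<epsilon> \<and> \<epsilon> < 1 / real (Suc n) \<and> S + d \<le> q \<epsilon>" for n
    proof (rule ccontr)
      assume "\<not> ?thesis"
      then have *: "q \<epsilon> < S + d" if "0 < \<epsilon>" "\<epsilon> < 1 / real (Suc n)" for \<epsilon> using that by force
      have "\<forall>\<^sub>F \<epsilon> in at_right 0. q \<epsilon> < S + d"
        by (rule eventually_mono[OF eventually_at_right_real[of 0 "1 / real (Suc n)"]]) (use * in auto)
      then show False using neg by blast
    qed
    then obtain \<epsilon> where \<epsilon>: "\<And>n. 0 < \<epsilon> n" "\<And>n. \<epsilon> n < 1 / real (Suc n)" "\<And>n. S + d \<le> q (\<epsilon> n)" by metis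
    \<comment> \<open>Maximality up to \<open>(\<epsilon> n)^2\<close> is as good as the expansion
      itself and raises its constant from \<open>K\<close> to \<open>K + 1\<close>.\<close>
    have "\<exists>p\<in>Q. (SUP p\<in>Q. Fe (\<epsilon> n) p) - (\<epsilon> n)\<^sup>2 < Fe (\<epsilon> n) p" for n
      using less_cSUP_iff[OF ne bFe[OF \<epsilon>(1)], of "(SUP p\<in>Q. Fe (\<epsilon> n) p) - (\<epsilon> n)\<^sup>2" n] \<epsilon>(1)[of n] by simp
    then obtain p where p: "\<And>n. p n \<in> Q" "\<And>n. (SUP p\<in>Q. Fe (\<epsilon> n) p) - (\<epsilon> n)\<^sup>2 < Fe (\<epsilon> n) (p n)" by metis
    have low: "s + \<epsilon> n * (S + d) \<le> (SUP p\<in>Q. Fe (\<epsilon> n) p)" for n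
      using \<epsilon>(3)[of n] \<epsilon>(1)[of n] unfolding q_def by (simp add: pos_le_divide_eq algebra_simps)
    have comb: "s + \<epsilon> n * (S + d) - (K + 1) * (\<epsilon> n)\<^sup>2 \<le> F0 (p n) + \<epsilon> n * A (p n)" for n
      using low[of n] p(2)[of n] Taylor[OF p(1), of "\<epsilon> n" n] by (simp add: distrib_right)
    \<comment> \<open>As \<open>F0\<close> never exceeds \<open>s\<close>, the excess of the
      quotient has to come from \<open>A\<close>. In the limit this contradicts the definition of
      \<open>S\<close>, since the limit point is a maximizer.\<close>
    have Abound: "S + d - (K + 1) * \<epsilon> n \<le> A (p n)" for n
    proof -
      have "\<epsilon> n * (S + d - (K + 1) * \<epsilon> n) \<le> \<epsilon> n * A (p n)"
        using comb[of n] F0s[OF p(1)[of n]] by (simp add: power2_eq_square algebra_simps)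
      then show ?thesis using \<epsilon>(1)[of n] by simp
    qed
    obtain r p' where r: "p' \<in> Q" "strict_mono (r :: nat \<Rightarrow> nat)" "(\<lambda>n. F0 (p (r n))) \<longlonglongrightarrow> F0 p'"
      "(\<lambda>n. A (p (r n))) \<longlonglongrightarrow> A p'" using cpt[of p] p(1) by blast
    have e0: "\<epsilon> \<longlonglongrightarrow> 0"
    proof (rule tendsto_sandwich[OF _ _ tendsto_const])
      show "(\<lambda>n. 1 / real (Suc n)) \<longlonglongrightarrow> 0" by (intro LIMSEQ_Suc lim_1_over_n)
    qed (use \<epsilon>(1,2) in \<open>auto intro!: always_eventually less_imp_le\<close>)
    have er: "(\<lambda>n. \<epsilon> (r n)) \<longlonglongrightarrow> 0" using LIMSEQ_subseq_LIMSEQ[OF e0 r(2)] by (simp add: comp_def)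
    have "p' \<in> M"
    proof (rule limit_max[of "\<lambda>n. p (r n)" p' "\<lambda>n. \<epsilon> (r n) * A (p (r n)) - (\<epsilon> (r n) * (S + d) - (K + 1) * (\<epsilon> (r n))\<^sup>2)"])
      have "(\<lambda>n. s - (\<epsilon> (r n) * A (p (r n)) - (\<epsilon> (r n) * (S + d) - (K + 1) * (\<epsilon> (r n))\<^sup>2)))
          \<longlonglongrightarrow> s - (0 * A p' - (0 * (S + d) - (K + 1) * 0\<^sup>2))"
        by (intro tendsto_intros er r(4))
      then show "(\<lambda>n. s - (\<epsilon> (r n) * A (p (r n)) - (\<epsilon> (r n) * (S + d) - (K + 1) * (\<epsilon> (r n))\<^sup>2))) \<longlonglongrightarrow> s" by simp
      show "s - (\<epsilon> (r n) * A (p (r n)) - (\<epsilon> (r n) * (S + d) - (K + 1) * (\<epsilon> (r n))\<^sup>2)) \<le> F0 (p (r n))" for n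
        using comb[of "r n"] by linarith
    qed (use p r in auto)
    then have "A p' \<le> S" unfolding S_def by (rule cSUP_upper[OF _ bM])
    moreover have "S + d \<le> A p'"
    proof (rule LIMSEQ_le[OF _ r(4)])
      have "(\<lambda>n. S + d - (K + 1) * \<epsilon> (r n)) \<longlonglongrightarrow> S + d - (K + 1) * 0" by (intro tendsto_intros er)
      then show "(\<lambda>n. S + d - (K + 1) * \<epsilon> (r n)) \<longlonglongrightarrow> S + d" by simp
    qed (use Abound in blast)
    ultimately show False using d by simp
  qed
  have "(q \<longlongrightarrow> S) (at_right 0)"
  proof (rule order_tendstoI)
    fix a assume a: "a < S"
    have "((\<lambda>\<epsilon>. S - K * \<epsilon>) \<longlongrightarrow> S - K * 0) (at_right 0)" by (intro tendsto_intros)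
    then have "\<forall>\<^sub>F \<epsilon> in at_right 0. a < S - K * \<epsilon>" using a by (intro order_tendstoD) auto
    then show "\<forall>\<^sub>F \<epsilon> in at_right 0. a < q \<epsilon>"
      using eventually_at_right_less[of "0::real"] by eventually_elim (use lower in fastforce)
  next
    fix a assume "S < a"
    then show "\<forall>\<^sub>F \<epsilon> in at_right 0. q \<epsilon> < a" using upper[of "a - S"] by simp
  qed
  then show ?thesis by (simp add: q_def[abs_def] S_def M_def s_def)
qed

section \<open>The two one-sided derivatives\<close>

lemma LG_vec_Pair:
  fixes \<xi> \<eta> :: "(real \<Rightarrow> real) \<Rightarrow> 'a::euclidean_space"
  assumes "\<xi> \<in> LG_vec T Ehat p" "\<eta> \<in> LG_vec T Ehat p"
  shows "(\<lambda>\<omega>. (\<xi> \<omega>, \<eta> \<omega>)) \<in> LG_vec T Ehat p"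
  using assms unfolding LG_vec_def Basis_prod_def by auto

theorem proposition6p5:
  fixes T \<sigma>lo \<sigma>hi :: real
    and H :: "('w \<Rightarrow> real) set" and E :: "('w \<Rightarrow> real) \<Rightarrow> real" and x :: "nat \<Rightarrow> 'w \<Rightarrow> real"
    and Ehat :: "((real \<Rightarrow> real) \<Rightarrow> real) \<Rightarrow> real"
    and f :: "'a::euclidean_space measure \<Rightarrow> real" and D :: "'a measure \<Rightarrow> 'a \<Rightarrow> 'a"
    and \<xi> \<eta> :: "(real \<Rightarrow> real) \<Rightarrow> 'a"
  assumes "0 < T" and "0 < \<sigma>lo" and "\<sigma>lo \<le> \<sigma>hi"
    and "G_expectation T \<sigma>lo \<sigma>hi H E x Ehat"
    and "W2_Lipschitz f" and "has_Lions_derivative f D" and "Lipschitz_derivative D"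
    and "\<xi> \<in> LG_vec T Ehat 2" and "\<eta> \<in> LG_vec T Ehat 2"
    and "((\<lambda>N::real. upper_expectation (G_measures T Ehat)
            (\<lambda>\<omega>. ((norm (\<xi> \<omega>))\<^sup>2 + (norm (\<eta> \<omega>))\<^sup>2) *
                  indicator {\<omega>. norm (\<xi> \<omega>) + norm (\<eta> \<omega>) \<ge> N} \<omega>)) \<longlongrightarrow> 0) at_top"
  shows "((\<lambda>\<epsilon>. (F_sup T Ehat f (\<lambda>\<omega>. \<xi> \<omega> + \<epsilon> *\<^sub>R \<eta> \<omega>) - F_sup T Ehat f \<xi>) / \<epsilon>) \<longlongrightarrow>
            (SUP P\<in>G_maximizers T Ehat f \<xi>. \<integral>\<omega>. D (distr P borel \<xi>) (\<xi> \<omega>) \<bullet> \<eta> \<omega> \<partial>P))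
          (at_right 0) \<and>
         ((\<lambda>\<epsilon>. (F_sup T Ehat f (\<lambda>\<omega>. \<xi> \<omega> + \<epsilon> *\<^sub>R \<eta> \<omega>) - F_sup T Ehat f \<xi>) / \<epsilon>) \<longlongrightarrow>
            - (SUP P\<in>G_maximizers T Ehat f \<xi>. - (\<integral>\<omega>. D (distr P borel \<xi>) (\<xi> \<omega>) \<bullet> \<eta> \<omega> \<partial>P)))
          (at_left 0)"
proof -
  obtain C where "moment_expectation T Ehat C" using G_expectation_moments[OF assms(1,4)] by blast
  then interpret moment_expectation T Ehat C .
  obtain Cf CD dm where "Lions_differentiable f D Cf CD dm" using Lions_differentiableI[OF assms(5-7)] by blast
  then interpret L: Lions_differentiable f D Cf CD dm .
  note \<xi> = assms(8) and \<eta> = assms(9)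
  define Q where "Q = dominated_on_L_ip T Ehat"
  have GQ: "G_measures T Ehat = Q" unfolding Q_def using G_measures_eq[OF T0, of Ehat] E_const[of 0] by blast
  define F0 where "F0 P = f (distr P borel \<xi>)" for P
  define Fe where "Fe \<epsilon> P = f (distr P borel (\<lambda>\<omega>. \<xi> \<omega> + \<epsilon> *\<^sub>R \<eta> \<omega>))" for \<epsilon> P
  define A where "A P = (\<integral>\<omega>. D (distr P borel \<xi>) (\<xi> \<omega>) \<bullet> \<eta> \<omega> \<partial>P)" for P
  have meas: "\<xi> \<in> borel_measurable P" "\<eta> \<in> borel_measurable P" if "P \<in> Q" for P
    using that \<xi> \<eta> unfolding Q_def by (auto intro: dominated_measurable LG_vec_measurable)
  obtain R1 where R1: "\<And>P. P \<in> Q \<Longrightarrow> integrable P (\<lambda>\<omega>. (norm (\<xi> \<omega>))\<^sup>2)"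
    using LG_vec_square_integrable[OF \<xi>] unfolding Q_def by blast
  obtain R where R: "0 \<le> R" "\<And>P. P \<in> Q \<Longrightarrow> integrable P (\<lambda>\<omega>. (norm (\<eta> \<omega>))\<^sup>2)"
    "\<And>P. P \<in> Q \<Longrightarrow> (\<integral>\<omega>. (norm (\<eta> \<omega>))\<^sup>2 \<partial>P) \<le> R"
    using LG_vec_square_integrable[OF \<eta>] unfolding Q_def by blast
  have Taylor: "\<bar>Fe \<epsilon> P - F0 P - \<epsilon> * A P\<bar> \<le> 2 * CD * R * \<epsilon>\<^sup>2" if P: "P \<in> Q" for \<epsilon> P
  proof -
    have "\<bar>Fe \<epsilon> P - F0 P - (\<integral>\<omega>. D (distr P borel \<xi>) (\<xi> \<omega>) \<bullet> (\<epsilon> *\<^sub>R \<eta> \<omega>) \<partial>P)\<bar> \<le> 2 * CD * (\<integral>\<omega>. (norm (\<epsilon> *\<^sub>R \<eta> \<omega>))\<^sup>2 \<partial>P)"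
      unfolding Fe_def F0_def using P meas[OF P] dominatedD(1)
      by (intro L.law_Taylor R1 square_integrable_scaleR R(2)) (auto simp: Q_def)
    also have "(\<integral>\<omega>. (norm (\<epsilon> *\<^sub>R \<eta> \<omega>))\<^sup>2 \<partial>P) = \<epsilon>\<^sup>2 * (\<integral>\<omega>. (norm (\<eta> \<omega>))\<^sup>2 \<partial>P)"
      by (simp add: power_mult_distrib)
    also have "2 * CD * (\<epsilon>\<^sup>2 * (\<integral>\<omega>. (norm (\<eta> \<omega>))\<^sup>2 \<partial>P)) \<le> 2 * CD * (\<epsilon>\<^sup>2 * R)"
      using L.C R(3)[OF P] by (intro mult_left_mono) auto
    finally show ?thesis by (simp add: A_def mult_ac)
  qed
  \<comment> \<open>Compactness is applied to the pair of \<open>\<xi>\<close> and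
    \<open>\<eta>\<close>: the first functional sees only the first marginal of the joint law, the
    second sees all of it.\<close>
  have cpt: "\<exists>r. \<exists>P'\<in>Q. strict_mono (r :: nat \<Rightarrow> nat) \<and> (\<lambda>n. F0 (P (r n))) \<longlonglongrightarrow> F0 P' \<and> (\<lambda>n. A (P (r n))) \<longlonglongrightarrow> A P'"
    if P: "\<And>n. P n \<in> Q" for P
  proof -
    let ?\<zeta> = "\<lambda>\<omega>. (\<xi> \<omega>, \<eta> \<omega>)"
    have P_dom: "P n \<in> dominated_on_L_ip T Ehat" for n using P by (simp add: Q_def)
    obtain r P' where r: "strict_mono (r :: nat \<Rightarrow> nat)" and P': "P' \<in> dominated_on_L_ip T Ehat"
      and lim: "\<And>\<Theta>. coupling_Lipschitz \<Theta> \<Longrightarrow> (\<lambda>n. \<Theta> (distr (P (r n)) borel ?\<zeta>)) \<longlonglongrightarrow> \<Theta> (distr P' borel ?\<zeta>)"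
      by (rule law_functional_compactness[OF LG_vec_Pair[OF \<xi> \<eta>] P_dom]) (rule that)
    have P'Q: "P' \<in> Q" using P' by (simp add: Q_def)
    have fst: "distr (distr p borel ?\<zeta>) borel fst = distr p borel \<xi>" if "p \<in> Q" for p
      using meas[OF that] by (simp add: distr_distr comp_def)
    have F0_eq: "f (distr (distr p borel ?\<zeta>) borel fst) = F0 p" if "p \<in> Q" for p
      using fst[OF that] by (simp add: F0_def)
    have A_eq: "(\<integral>z. D (distr (distr p borel ?\<zeta>) borel fst) (fst z) \<bullet> snd z \<partial>distr p borel ?\<zeta>) = A p" if p: "p \<in> Q" for p
    proof -
      have "distr p borel \<xi> \<in> P2"
        using p meas[OF p] R1[OF p] dominatedD(1) by (intro law_in_P2) (auto simp: Q_def)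
      then have "(\<lambda>z. D (distr p borel \<xi>) (fst z) \<bullet> snd z) \<in> borel_measurable borel"
        by (intro borel_measurable_inner borel_measurable_snd measurable_compose[OF borel_measurable_fst L.D_measurable])
      then show ?thesis
        unfolding fst[OF p] A_def using meas[OF p] by (subst integral_distr) auto
    qed
    have "(\<lambda>n. F0 (P (r n))) \<longlonglongrightarrow> F0 P'"
      using lim[OF L.coupling_Lipschitz_f] P P'Q by (simp add: F0_eq)
    moreover have "(\<lambda>n. A (P (r n))) \<longlonglongrightarrow> A P'"
      using lim[OF L.coupling_Lipschitz_D] P P'Q by (simp add: A_eq)
    ultimately show ?thesis using r P'Q by blast
  qed
  have ne: "Q \<noteq> {}" unfolding Q_def by (rule dominated_nonempty)
  have K: "0 \<le> 2 * CD * R" using L.C R(1) by simp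
  have Fsup: "F_sup T Ehat f \<xi> = (SUP P\<in>Q. F0 P)"
    "F_sup T Ehat f (\<lambda>\<omega>. \<xi> \<omega> + \<epsilon> *\<^sub>R \<eta> \<omega>) = (SUP P\<in>Q. Fe \<epsilon> P)" for \<epsilon>
    by (simp_all add: F_sup_def GQ F0_def Fe_def)
  have max: "G_maximizers T Ehat f \<xi> = {P \<in> Q. F0 P = (SUP P\<in>Q. F0 P)}"
    unfolding G_maximizers_def GQ Fsup(1) by (simp add: F0_def)
  have right: "((\<lambda>\<epsilon>. ((SUP P\<in>Q. Fe \<epsilon> P) - (SUP P\<in>Q. F0 P)) / \<epsilon>) \<longlongrightarrow>
      (SUP P\<in>{P \<in> Q. F0 P = (SUP P\<in>Q. F0 P)}. A P)) (at_right 0)"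
    by (rule Danskin[OF ne K Taylor cpt])
  \<comment> \<open>Reflection at 0 replaces \<open>A\<close> by \<open>- A\<close>; division by the
    negative increment then produces the outer minus sign.\<close>
  have left: "((\<lambda>\<epsilon>. ((SUP P\<in>Q. Fe (- \<epsilon>) P) - (SUP P\<in>Q. F0 P)) / \<epsilon>) \<longlongrightarrow>
      (SUP P\<in>{P \<in> Q. F0 P = (SUP P\<in>Q. F0 P)}. - A P)) (at_right 0)"
  proof (rule Danskin[OF ne K])
    show "\<bar>Fe (- \<epsilon>) p - F0 p - \<epsilon> * - A p\<bar> \<le> 2 * CD * R * \<epsilon>\<^sup>2" if "p \<in> Q" for \<epsilon> p
      using Taylor[OF that, of "- \<epsilon>"] by simp
    show "\<exists>r. \<exists>p'\<in>Q. strict_mono (r :: nat \<Rightarrow> nat) \<and> (\<lambda>n. F0 (p (r n))) \<longlonglongrightarrow> F0 p' \<and> (\<lambda>n. - A (p (r n))) \<longlonglongrightarrow> - A p'"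
      if pQ: "\<And>n. p n \<in> Q" for p :: "nat \<Rightarrow> _"
    proof -
      obtain r p' where "p' \<in> Q" and r: "strict_mono (r :: nat \<Rightarrow> nat) \<and> (\<lambda>n. F0 (p (r n))) \<longlonglongrightarrow> F0 p' \<and>
        (\<lambda>n. A (p (r n))) \<longlonglongrightarrow> A p'" using cpt[of p, OF pQ] by (elim exE bexE)
      then show ?thesis by (intro exI[of _ r] bexI[of _ p'] conjI tendsto_minus) simp_all
    qed
  qed
  have "((\<lambda>\<epsilon>. ((SUP P\<in>Q. Fe \<epsilon> P) - (SUP P\<in>Q. F0 P)) / \<epsilon>) \<longlongrightarrow>
      - (SUP P\<in>{P \<in> Q. F0 P = (SUP P\<in>Q. F0 P)}. - A P)) (at_left 0)"
    using tendsto_minus[OF left] by (simp add: filterlim_at_left_to_right)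
  from conjI[OF right this] show ?thesis
    unfolding Fsup max A_def .
qed

end
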